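(* Let $1\le p<\infty$, $r,s\in\mathbb{N}$ with $s\le 2r$, and let $f\in L_p(\mathbb{R}^d)$ satisfy $f\in\ell_p(X_\sigma)$ for all $\sigma>0$. Suppose that for all $\sigma>0$ the operator $G_\sigma$ satisfies $(A_1)$, $(A_2)$ and $(A_3)$ (with this $s$). Then $G_\sigma f$ converges to $f$ in $L_p(\mathbb{R}^d)$ as $\sigma\to\infty$ if and only if $$\|f_{\gamma/\sigma,r}-f\|_{\ell_p(X_\sigma)}\to0\quad\text{as }\sigma\to\infty .$$
   Context: $L_p(\mathbb{R}^d)$, $1\le p<\infty$, is the space of finite-valued measurable $f:\mathbb{R}^d\to\mathbb{R}$ with $\|f\|_p=(\int_{\mathbb{R}^d}|f|^p)^{1/p}<\infty$; functions equal almost everywhere are NOT identified (each function has a definite value at each point). $|f|_{W_p^s}=\sum_{|\alpha|_1=s}\|D^\alpha f\|_p$. Sampling points: for each $\sigma>0$, $X_\sigma\subset\mathbb{R}^d$ is a finite or infinite set with $\min_{\xi\ne\xi'\in X_\sigma}|\xi-\xi'|>2\gamma/\sigma$, where $\gamma\in(0,1]$ is independent of $\sigma$. $\|f\|_{\ell_p(X_\sigma)}=\big(\sigma^{-d}\sum_{\xi\in X_\sigma}|f(\xi)|^p\big)^{1/p}$, and $f\in\ell_p(X_\sigma)$ means this is finite. Band-limited functions: $\mathcal{B}_p^\sigma(\mathbb{R}^d)=\{\varphi\in L_p(\mathbb{R}^d)\cap L_1(\mathbb{R}^d):\operatorname{supp}\widehat\varphi\subset[-\sigma,\sigma]^d\}$,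 with $\widehat\varphi(x)=\int_{\mathbb{R}^d}\varphi(y)e^{-2\pi i(x,y)}dy$. Sampling operator: $G_\sigma f(x)=\sum_{\xi\in X_\sigma}f(\xi)\psi_{\xi,\sigma}(x)$ with given kernel functions $\psi_{\xi,\sigma}$. Assumptions, with positive constants $\kappa_i$ independent of $\sigma$ and of the function: $(A_1)$ $\|G_\sigma f\|_p\le\kappa_1\|f\|_{\ell_p(X_\sigma)}$ for all $f\in L_p(\mathbb{R}^d)\cap\ell_p(X_\sigma)$; $(A_2)$ $\kappa_2\|f\|_{\ell_p(X_\sigma)}\le\|G_\sigma f\|_p$ for all $f\in L_p(\mathbb{R}^d)\cap\ell_p(X_\sigma)$; $(A_3)$ for the given $s\in\mathbb{N}$ there is $\lambda\in(0,1]$ (independent of $\sigma$) such that $\|g-G_\sigma g\|_p\le\kappa_3\sigma^{-s}|g|_{W_p^s}$ for all $g\in\mathcal{B}_p^{\lambda\sigma}(\mathbb{R}^d)$. Averaged operator: $f_{\delta,r}(x)=-\frac{2}{\binom{2r}{r}}\sum_{j=1}^r(-1)^j\binom{2r}{r-j}f_{\delta j/r}(x)$, where $f_\delta(x)=\frac1{|B_\delta|}\int_{B_\delta(x)}f(y)\,dy$ and $B_\delta(x)$ is the open Euclidean ball of radius $\delta$ centred at $x$, $B_\delta=B_\delta(0)$. *)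

theory Defs
  imports "HOL-Analysis.Analysis"
begin

section \<open>Norms and function spaces\<close>

text \<open>Norms take values in the extended nonnegative reals, so that they are meaningful for every
  measurable function; \<open>\<infinity>\<close> means "not in the space". Functions are not identified almost
  everywhere: \<open>Lp p\<close> is a set of functions.\<close>

definition ennreal_root :: "real \<Rightarrow> ennreal \<Rightarrow> ennreal" where
  "ennreal_root p x = (if x = \<infinity> then \<infinity> else ennreal (enn2real x powr (1 / p)))"

definition Lp_norm :: "real \<Rightarrow> (real ^ 'n \<Rightarrow> real) \<Rightarrow> ennreal" where
  "Lp_norm p f = ennreal_root p (\<integral>\<^sup>+x. ennreal (\<bar>f x\<bar> powr p) \<partial>lebesgue)"

definition Lp :: "real \<Rightarrow> (real ^ 'n \<Rightarrow> real) set" where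
  "Lp p = {f. f \<in> borel_measurable lebesgue \<and> Lp_norm p f < \<infinity>}"

definition lp_norm :: "real \<Rightarrow> real \<Rightarrow> (real ^ 'n) set \<Rightarrow> (real ^ 'n \<Rightarrow> real) \<Rightarrow> ennreal" where
  "lp_norm p \<sigma> X f =
     ennreal_root p (ennreal (1 / \<sigma> ^ CARD('n)) * (\<Sum>\<^sub>\<infinity>\<xi>\<in>X. ennreal (\<bar>f \<xi>\<bar> powr p)))"

definition lp :: "real \<Rightarrow> real \<Rightarrow> (real ^ 'n) set \<Rightarrow> (real ^ 'n \<Rightarrow> real) set" where
  "lp p \<sigma> X = {f. lp_norm p \<sigma> X f < \<infinity>}"

section \<open>Derivatives and the Sobolev seminorm\<close>

definition partial_deriv :: "'n::finite \<Rightarrow> (real ^ 'n \<Rightarrow> real) \<Rightarrow> real ^ 'n \<Rightarrow> real" where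
  "partial_deriv i f x = deriv (\<lambda>t. f (x + t *\<^sub>R axis i 1)) 0"

text \<open>The index type carries no order, so the order in which the iterated partial derivatives are
  taken is fixed by an arbitrary enumeration. The seminorm is only applied to band-limited
  functions, which are smooth, so that the order is immaterial and classical and weak derivatives
  agree.\<close>

definition index_list :: "'n::finite list" where
  "index_list = (SOME is. distinct is \<and> set is = UNIV)"

definition multi_deriv :: "('n::finite \<Rightarrow> nat) \<Rightarrow> (real ^ 'n \<Rightarrow> real) \<Rightarrow> real ^ 'n \<Rightarrow> real" where
  "multi_deriv \<alpha> f = foldr (\<lambda>i. partial_deriv i ^^ \<alpha> i) index_list f"

definition sobolev_seminorm :: "real \<Rightarrow> nat \<Rightarrow> (real ^ 'n \<Rightarrow> real) \<Rightarrow> ennreal" where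
  "sobolev_seminorm p s f =
     (\<Sum>\<alpha> | (\<Sum>i\<in>UNIV. \<alpha> i) = s. Lp_norm p (multi_deriv \<alpha> f))"

section \<open>Band-limited functions\<close>

definition fourier :: "(real ^ 'n \<Rightarrow> real) \<Rightarrow> real ^ 'n \<Rightarrow> complex" where
  "fourier \<phi> x =
     (LINT y|lebesgue. complex_of_real (\<phi> y) * exp (- 2 * complex_of_real pi * \<i> * complex_of_real (x \<bullet> y)))"

text \<open>Continuity selects the representative given by Fourier inversion, which is
  the only one for which point values are meaningful. It cannot be omitted: functions are not
  identified almost everywhere, and otherwise every function vanishing outside a countable set
  would count as band-limited, with arbitrary values at the sampling points.\<close>

definition band_limited :: "real \<Rightarrow> real \<Rightarrow> (real ^ 'n \<Rightarrow> real) set" where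
  "band_limited p \<sigma> =
     {\<phi>. \<phi> \<in> Lp p \<inter> Lp 1 \<and> continuous_on UNIV \<phi> \<and>
         closure {x. fourier \<phi> x \<noteq> 0} \<subseteq> {x. \<forall>i. x $ i \<in> {-\<sigma>..\<sigma>}}}"

section \<open>Sampling and averaging operators\<close>

definition sampling_op ::
  "(real ^ 'n) set \<Rightarrow> (real ^ 'n \<Rightarrow> real ^ 'n \<Rightarrow> real) \<Rightarrow> (real ^ 'n \<Rightarrow> real) \<Rightarrow> real ^ 'n \<Rightarrow> real" where
  "sampling_op X \<psi> f x = (\<Sum>\<^sub>\<infinity>\<xi>\<in>X. f \<xi> * \<psi> \<xi> x)"

text \<open>The operator is well defined on \<open>Lp p \<inter> lp p \<sigma> X\<close>: the kernels are measurable and the defining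
  series, a sum over an unordered set, converges almost everywhere. (Where it diverges,
  \<open>sampling_op\<close> has the conventional value 0.)\<close>

definition sampling_op_defined ::
  "real \<Rightarrow> real \<Rightarrow> (real ^ 'n) set \<Rightarrow> (real ^ 'n \<Rightarrow> real ^ 'n \<Rightarrow> real) \<Rightarrow> bool" where
  "sampling_op_defined p \<sigma> X \<psi> \<longleftrightarrow>
     (\<forall>\<xi>\<in>X. \<psi> \<xi> \<in> borel_measurable lebesgue) \<and>
     (\<forall>f \<in> Lp p \<inter> lp p \<sigma> X. AE x in lebesgue. (\<lambda>\<xi>. f \<xi> * \<psi> \<xi> x) summable_on X)"

definition ball_average :: "real \<Rightarrow> (real ^ 'n \<Rightarrow> real) \<Rightarrow> real ^ 'n \<Rightarrow> real" where
  "ball_average \<delta> f x =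
     1 / measure lebesgue (ball (0 :: real ^ 'n) \<delta>) * (LINT y:ball x \<delta>|lebesgue. f y)"

definition averaged_op :: "real \<Rightarrow> nat \<Rightarrow> (real ^ 'n \<Rightarrow> real) \<Rightarrow> real ^ 'n \<Rightarrow> real" where
  "averaged_op \<delta> r f x =
     - (2 / real ((2 * r) choose r)) *
       (\<Sum>j = 1..r. (- 1) ^ j * real ((2 * r) choose (r - j)) *
          ball_average (\<delta> * real j / real r) f x)"

end

theory Submission
  imports Defs "HOL-Complex_Analysis.Complex_Analysis" "HOL-Real_Asymp.Real_Asymp"
begin

text \<open>Given \<open>\<epsilon>\<close>, choose a band-limited \<open>h\<close> with \<open>\<parallel>f - h\<parallel>\<^sub>p < \<epsilon>\<close>, smooth and with integrable decay.
  For this fixed \<open>h\<close>, both \<open>\<parallel>G h - h\<parallel>\<^sub>p\<close> (by \<open>A3\<close>) and \<open>\<parallel>h\<^bsub>\<gamma>/\<sigma>,r\<^esub> - h\<parallel>\<close> (by a Lipschitz bound) tend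
  to 0, while \<open>\<parallel>(f - h)\<^bsub>\<gamma>/\<sigma>,r\<^esub>\<parallel>\<close> is bounded by a constant times \<open>\<epsilon>\<close>, since the averages are taken over
  disjoint balls. Up to \<open>O(\<epsilon>)\<close>, the discrete norm of \<open>f - h\<close> is therefore comparable with that of
  \<open>f\<^bsub>\<gamma>/\<sigma>,r\<^esub> - f\<close>, and by \<open>A1\<close> and \<open>A2\<close> with \<open>\<parallel>G (f - h)\<parallel>\<^sub>p\<close>, hence with \<open>\<parallel>G f - f\<parallel>\<^sub>p\<close>. Only limits matter, so
  \<open>p\<close>-th powers of norms with a quasi-triangle inequality replace the norms.

  The approximants are sums of products of one-variable functions that extend to entire functions of
  exponential type with quadratic decay along horizontal lines. This class is closed under
  differentiation, and its members have Fourier transforms of compact support.\<close>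

section \<open>Functions of exponential type with quadratic decay\<close>

text \<open>The sampling set is a null set, so closeness of \<open>f\<close> and \<open>h\<close> in
  L_p says nothing about the values of \<open>f - h\<close> there. The discrete norm of
  \<open>f - h\<close> is therefore never shown to be small: it is a pivot, estimated once by each
  side of the equivalence and estimating each side in turn. Averages of \<open>f - h\<close> see it
  only through integrals, which is why they are harmless. Keeping \<open>h\<close> fixed while
  \<sigma> grows turns A3 into a statement about limits: the spectrum of \<open>h\<close> stays in
  one cube while the band \<open>\<Lambda> * \<sigma>\<close> widens, and the seminorm of
  \<open>h\<close> is a constant. The approximants must be continuous with compact spectrum, have
  derivatives in L_p, have sampling sums bounded uniformly in \<sigma>, and be dense. Pointwise
  bounds on an entire extension give the first three by working with the functions themselves: the
  spectrum by a contour shift, the derivatives by Cauchy's estimate, the sums by comparison with an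
  integral.\<close>

lemma one_plus_norm_square_le:
  fixes z w :: "'a::real_normed_vector"
  shows "1 + (norm z)\<^sup>2 \<le> 2 * (1 + (norm w)\<^sup>2) * (1 + (norm (z - w))\<^sup>2)"
proof -
  have "norm z \<le> norm w + norm (z - w)"
    by (metis add.commute diff_add_cancel norm_triangle_ineq)
  then have "(norm z)\<^sup>2 \<le> (norm w + norm (z - w))\<^sup>2"
    by (intro power_mono) auto
  also have "\<dots> \<le> 2 * (norm w)\<^sup>2 + 2 * (norm (z - w))\<^sup>2"
    using sum_squares_bound[of "norm w" "norm (z - w)"] by (simp add: power2_sum)
  finally have "1 + (norm z)\<^sup>2 \<le> 1 + 2 * (norm w)\<^sup>2 + 2 * (norm (z - w))\<^sup>2" by simp
  also have "\<dots> \<le> 2 * (1 + (norm w)\<^sup>2) * (1 + (norm (z - w))\<^sup>2)"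
    by (simp add: algebra_simps)
  finally show ?thesis .
qed

text \<open>Peetre's inequality: weights at two points differ by at most a quadratic factor in their
  distance.\<close>

lemma inverse_one_plus_norm_square_le:
  fixes z w :: "'a::real_normed_vector"
  shows "1 / (1 + (norm w)\<^sup>2) \<le> 2 * (1 + (norm (z - w))\<^sup>2) / (1 + (norm z)\<^sup>2)"
proof -
  have "0 < 1 + (norm z)\<^sup>2" "0 < 1 + (norm w)\<^sup>2" by (simp_all add: add_pos_nonneg)
  then show ?thesis
    using one_plus_norm_square_le[of z w] by (simp add: field_simps)
qed

text \<open>At distance at most 1 the Peetre factor is 2 * (1 + 1); this is the origin of every
  factor 4 below.\<close>

lemma inverse_one_plus_norm_square_near:
  fixes z w :: "'a::real_normed_vector"
  assumes "norm (z - w) \<le> 1"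
  shows "1 / (1 + (norm w)\<^sup>2) \<le> 4 / (1 + (norm z)\<^sup>2)"
proof -
  have "(norm (z - w))\<^sup>2 \<le> 1" using assms by (simp add: power_le_one)
  then have "2 * (1 + (norm (z - w))\<^sup>2) / (1 + (norm z)\<^sup>2) \<le> 4 / (1 + (norm z)\<^sup>2)"
    by (intro divide_right_mono) (auto simp: add_nonneg_nonneg)
  then show ?thesis using inverse_one_plus_norm_square_le[of w z] by linarith
qed

text \<open>The hypothesis of the easy half of the Paley-Wiener theorem, with decay built in. The
  weight involves \<open>cmod z\<close>, not only the real part, so that it is constant on circles
  about 0 and bounds a whole half circle at once.\<close>

definition exp_type :: "(real \<Rightarrow> real) \<Rightarrow> bool" where
  "exp_type h \<longleftrightarrow> (\<exists>H C \<tau>. H holomorphic_on UNIV \<and> 0 \<le> \<tau> \<and> (\<forall>t. H (of_real t) = of_real (h t)) \<and>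
     (\<forall>z. cmod (H z) \<le> C * exp (\<tau> * \<bar>Im z\<bar>) / (1 + (cmod z)\<^sup>2)))"

lemma exp_typeE:
  assumes "exp_type h"
  obtains H C \<tau> where "H holomorphic_on UNIV" "0 \<le> C" "0 \<le> \<tau>" "\<And>t. H (of_real t) = of_real (h t)"
    "\<And>z. cmod (H z) \<le> C * exp (\<tau> * \<bar>Im z\<bar>) / (1 + (cmod z)\<^sup>2)"
proof -
  obtain H C \<tau> where *: "H holomorphic_on UNIV" "0 \<le> \<tau>" "\<forall>t. H (of_real t) = of_real (h t)"
    "\<forall>z. cmod (H z) \<le> C * exp (\<tau> * \<bar>Im z\<bar>) / (1 + (cmod z)\<^sup>2)"
    using assms by (auto simp: exp_type_def)
  have "0 \<le> C" using order_trans[OF norm_ge_zero *(4)[rule_format, of 0]] by simp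
  then show thesis using * that by metis
qed

lemma exp_type_bound:
  assumes "exp_type h"
  obtains C where "0 \<le> C" "\<And>t. \<bar>h t\<bar> \<le> C / (1 + t\<^sup>2)"
proof -
  obtain H C \<tau> where H: "0 \<le> C" "\<And>t. H (of_real t) = of_real (h t)"
    "\<And>z. cmod (H z) \<le> C * exp (\<tau> * \<bar>Im z\<bar>) / (1 + (cmod z)\<^sup>2)"
    using exp_typeE[OF assms] by metis
  have "\<bar>h t\<bar> \<le> C / (1 + t\<^sup>2)" for t
    using H(3)[of "of_real t"] by (simp add: H(2))
  then show thesis using H(1) that by blast
qed

text \<open>The complex derivative can be computed along the real axis, where \<open>H\<close> has
  constant imaginary part 0. Hence the derivative of the extension again extends a real
  function.\<close>

lemma has_real_derivative_of_complex_ext: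
  assumes "\<And>t. H (of_real t) = complex_of_real (h t)" and "(H has_field_derivative D) (at (of_real t))"
  shows "(h has_real_derivative Re D) (at t)" "D = of_real (Re D)"
proof -
  have v: "((\<lambda>t. complex_of_real (h t)) has_vector_derivative D) (at t)"
    using has_vector_derivative_real_field[OF assms(2)] assms(1) by (simp add: o_def)
  from bounded_linear.has_vector_derivative[OF bounded_linear_Re this] show "(h has_real_derivative Re D) (at t)"
    by (simp add: has_real_derivative_iff_has_vector_derivative)
  have "((\<lambda>t::real. 0::real) has_vector_derivative Im D) (at t)"
    using bounded_linear.has_vector_derivative[OF bounded_linear_Im v] by simp
  then have "Im D = 0"
    using has_vector_derivative_const vector_derivative_unique_at by blast
  then show "D = of_real (Re D)" by (simp add: complex_eq_iff)
qed

text \<open>Cauchy's estimate on the unit circle about \<open>z\<close>: there the imaginary part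
  grows by at most 1, costing \<open>exp \<tau>\<close>, and the weight changes by at most a factor
  4. The type is unchanged.\<close>

lemma exp_type_deriv:
  assumes "exp_type h"
  obtains h' where "exp_type h'" "\<And>t. (h has_real_derivative h' t) (at t)"
proof -
  obtain H C \<tau> where H: "H holomorphic_on UNIV" "0 \<le> C" "0 \<le> \<tau>" "\<And>t. H (of_real t) = of_real (h t)"
    "\<And>z. cmod (H z) \<le> C * exp (\<tau> * \<bar>Im z\<bar>) / (1 + (cmod z)\<^sup>2)"
    using exp_typeE[OF assms] by metis
  have D: "(H has_field_derivative deriv H z) (at z)" for z
    using H(1) holomorphic_derivI by blast
  have "cmod (deriv H z) \<le> (4 * C * exp \<tau>) * exp (\<tau> * \<bar>Im z\<bar>) / (1 + (cmod z)\<^sup>2)" for z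
  proof -
    have "cmod ((deriv ^^ 1) H z) \<le> fact 1 * ((4 * C * exp \<tau>) * exp (\<tau> * \<bar>Im z\<bar>) / (1 + (cmod z)\<^sup>2)) / 1 ^ 1"
    proof (rule Cauchy_inequality)
      show "H holomorphic_on ball z 1" "continuous_on (cball z 1) H"
        using H(1) holomorphic_on_imp_continuous_on holomorphic_on_subset by blast+
      fix w assume w: "cmod (z - w) = 1"
      have "\<bar>Im w\<bar> \<le> \<bar>Im z\<bar> + 1" using abs_Im_le_cmod[of "z - w"] w by (simp add: minus_complex.simps)
      then have "exp (\<tau> * \<bar>Im w\<bar>) \<le> exp (\<tau> * (\<bar>Im z\<bar> + 1))"
        using H(3) by (simp add: mult_left_mono)
      then have 1: "exp (\<tau> * \<bar>Im w\<bar>) \<le> exp \<tau> * exp (\<tau> * \<bar>Im z\<bar>)"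
        by (simp add: algebra_simps flip: exp_add)
      have "cmod (H w) \<le> C * exp (\<tau> * \<bar>Im w\<bar>) * (1 / (1 + (cmod w)\<^sup>2))" using H(5)[of w] by simp
      also have "\<dots> \<le> C * (exp \<tau> * exp (\<tau> * \<bar>Im z\<bar>)) * (4 / (1 + (cmod z)\<^sup>2))"
        using 1 H(2) inverse_one_plus_norm_square_near[of z w] w
        by (intro mult_mono) (auto intro!: mult_nonneg_nonneg)
      finally show "cmod (H w) \<le> (4 * C * exp \<tau>) * exp (\<tau> * \<bar>Im z\<bar>) / (1 + (cmod z)\<^sup>2)"
        by (simp add: algebra_simps)
    qed simp
    then show ?thesis by simp
  qed
  moreover have "deriv H holomorphic_on UNIV" using H(1) holomorphic_deriv by blast
  moreover have "deriv H (of_real t) = of_real (Re (deriv H (of_real t)))" for t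
    using has_real_derivative_of_complex_ext(2)[OF H(4) D] .
  ultimately have "exp_type (\<lambda>t. Re (deriv H (of_real t)))"
    unfolding exp_type_def using H(3)
    by (intro exI[of _ "deriv H"] exI[of _ "4 * C * exp \<tau>"] exI[of _ \<tau>]) auto
  moreover have "(h has_real_derivative Re (deriv H (of_real t))) (at t)" for t
    using has_real_derivative_of_complex_ext(1)[OF H(4) D] .
  ultimately show thesis using that by blast
qed

lemma exp_type_continuous:
  assumes "exp_type h"
  shows "continuous_on UNIV h"
  using exp_type_deriv[OF assms] by (metis DERIV_isCont continuous_at_imp_continuous_on)

text \<open>Mean value bound by the derivative, which is again of exponential type. The weight is
  retained so that differences can still be summed over the sampling points.\<close>

lemma exp_type_Lipschitz:
  assumes "exp_type h"
  obtains C where "0 \<le> C" "\<And>t u. \<bar>t - u\<bar> \<le> 1 \<Longrightarrow> \<bar>h t - h u\<bar> \<le> C * \<bar>t - u\<bar> / (1 + t\<^sup>2)"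
proof -
  obtain h' where h': "exp_type h'" "\<And>t. (h has_real_derivative h' t) (at t)"
    using exp_type_deriv[OF assms] by blast
  obtain C where C: "0 \<le> C" "\<And>t. \<bar>h' t\<bar> \<le> C / (1 + t\<^sup>2)" using exp_type_bound[OF h'(1)] by blast
  have "\<bar>h t - h u\<bar> \<le> 4 * C * \<bar>t - u\<bar> / (1 + t\<^sup>2)" if "\<bar>t - u\<bar> \<le> 1" for t u
  proof -
    have "norm (h t - h u) \<le> 4 * C / (1 + t\<^sup>2) * norm (t - u)"
    proof (rule field_differentiable_bound[where S = "cball t 1" and f' = h'])
      fix v assume "v \<in> cball t 1"
      then have "1 / (1 + v\<^sup>2) \<le> 4 / (1 + t\<^sup>2)"
        using inverse_one_plus_norm_square_near[of t v] by (simp add: dist_norm)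
      from mult_left_mono[OF this C(1)] C(2)[of v]
      show "norm (h' v) \<le> 4 * C / (1 + t\<^sup>2)" by (simp add: mult.commute)
    qed (use that h'(2) in \<open>auto simp: dist_real_def intro: has_field_derivative_at_within\<close>)
    then show ?thesis by (simp add: algebra_simps)
  qed
  then show thesis using C(1) that[of "4 * C"] by auto
qed

lemma integrable_inverse_one_plus_square: "integrable lborel (\<lambda>t::real. 1 / (1 + t\<^sup>2))"
proof -
  have "set_integrable lborel (einterval (-\<infinity>) \<infinity>) (\<lambda>x::real. inverse (1 + x\<^sup>2))"
  proof (rule interval_integral_FTC_nonneg)
    show "DERIV arctan x :> inverse (1 + x\<^sup>2)" for x by (rule DERIV_arctan)
    show "isCont (\<lambda>x. inverse (1 + x\<^sup>2)) x" for x :: real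
      by (intro continuous_intros) (auto simp: add_nonneg_eq_0_iff)
    show "((arctan \<circ> real_of_ereal) \<longlongrightarrow> - (pi / 2)) (at_right (-\<infinity>))"
      by (simp add: ereal_tendsto_simps tendsto_arctan_at_bot)
    show "((arctan \<circ> real_of_ereal) \<longlongrightarrow> pi / 2) (at_left \<infinity>)"
      by (simp add: ereal_tendsto_simps tendsto_arctan_at_top)
  qed auto
  then show ?thesis by (simp add: set_integrable_def inverse_eq_divide einterval_def)
qed

lemma exp_type_integrable:
  assumes "exp_type h"
  shows "integrable lborel (\<lambda>t. complex_of_real (h t) * exp (- 2 * complex_of_real pi * \<i> * complex_of_real (\<xi> * t)))"
proof -
  obtain C where C: "0 \<le> C" "\<And>t. \<bar>h t\<bar> \<le> C / (1 + t\<^sup>2)" using exp_type_bound[OF assms] by blast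
  show ?thesis
  proof (rule Bochner_Integration.integrable_bound[OF integrable_mult_right[OF integrable_inverse_one_plus_square, of C]])
    show "(\<lambda>t. complex_of_real (h t) * exp (- 2 * complex_of_real pi * \<i> * complex_of_real (\<xi> * t))) \<in> borel_measurable lborel"
      using exp_type_continuous[OF assms]
      by (simp, intro borel_measurable_continuous_onI continuous_intros) auto
    show "AE t in lborel. norm (complex_of_real (h t) * exp (- 2 * complex_of_real pi * \<i> * complex_of_real (\<xi> * t))) \<le> norm (C * (1 / (1 + t\<^sup>2)))"
      using C by (auto simp: norm_mult norm_exp_eq_Re intro!: AE_I2 order_trans[OF C(2)])
  qed
qed

text \<open>The integral over \<open>{-T..T}\<close> is shifted to a half circle in the half plane where the
  exponential factor compensates the growth of the entire extension.\<close>

lemma exp_type_fourier_vanishes_pos: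
  assumes "exp_type h"
  obtains \<tau> where "\<And>\<xi>. \<tau> \<le> \<xi> \<Longrightarrow>
    (LINT t|lborel. complex_of_real (h t) * exp (- 2 * complex_of_real pi * \<i> * complex_of_real (\<xi> * t))) = 0"
proof -
  obtain H C \<tau> where H: "H holomorphic_on UNIV" "0 \<le> C" "0 \<le> \<tau>" "\<And>t. H (of_real t) = of_real (h t)"
    "\<And>z. cmod (H z) \<le> C * exp (\<tau> * \<bar>Im z\<bar>) / (1 + (cmod z)\<^sup>2)"
    using exp_typeE[OF assms] by metis
  have "(LINT t|lborel. complex_of_real (h t) * exp (- 2 * complex_of_real pi * \<i> * complex_of_real (\<xi> * t))) = 0"
    if \<xi>: "\<tau> / (2 * pi) \<le> \<xi>" for \<xi>
  proof -
    define F where "F = (\<lambda>z. H z * exp (- 2 * complex_of_real pi * \<i> * \<xi> * z))"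
    define e where "e = (\<lambda>t. complex_of_real (h t) * exp (- 2 * complex_of_real pi * \<i> * complex_of_real (\<xi> * t)))"
    have Fe: "F (of_real t) = e t" for t by (simp add: F_def e_def H(4) mult.assoc)
    have Fh: "F holomorphic_on UNIV" unfolding F_def by (intro holomorphic_intros H)
    \<comment> \<open>A global primitive takes the part of Cauchy's theorem: the integrals over the
      interval and over the half circle are the same increment of \<open>P\<close>.\<close>
    then obtain P where P: "\<And>z. (P has_field_derivative F z) (at z)"
      using holomorphic_convex_primitive'[of UNIV F] by auto
    \<comment> \<open>The exponential has modulus exp (2 pi \<xi> Im z), which in the lower half
      plane absorbs the growth exp (\<tau> |Im z|) as soon as 2 pi \<xi> is at least \<tau>; hence
      the threshold \<open>\<tau> / (2 * pi)\<close>.\<close>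
    have Fb: "cmod (F z) \<le> C / (1 + (cmod z)\<^sup>2)" if "Im z \<le> 0" for z
    proof -
      have "\<tau> \<le> 2 * pi * \<xi>" using \<xi> by (simp add: field_simps)
      then have "\<tau> * \<bar>Im z\<bar> + 2 * pi * \<xi> * Im z \<le> 0"
        using that mult_right_mono[of \<tau> "2 * pi * \<xi>" "- Im z"] by simp
      then have le: "exp (\<tau> * \<bar>Im z\<bar> + 2 * pi * \<xi> * Im z) \<le> 1" by simp
      have "cmod (F z) = cmod (H z) * exp (2 * pi * \<xi> * Im z)"
        by (simp add: F_def norm_mult norm_exp_eq_Re)
      also have "\<dots> \<le> C * exp (\<tau> * \<bar>Im z\<bar>) / (1 + (cmod z)\<^sup>2) * exp (2 * pi * \<xi> * Im z)"
        using H(5) by (intro mult_right_mono) auto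
      also have "\<dots> = C * exp (\<tau> * \<bar>Im z\<bar> + 2 * pi * \<xi> * Im z) / (1 + (cmod z)\<^sup>2)"
        by (simp add: exp_add)
      also have "\<dots> \<le> C * 1 / (1 + (cmod z)\<^sup>2)"
        using le H(2) by (intro divide_right_mono mult_left_mono) (auto simp: add_nonneg_nonneg)
      finally show ?thesis by simp
    qed
    have PT: "cmod (P (of_real T) - P (of_real (- T))) \<le> C / (1 + T\<^sup>2) * T * pi" if T: "0 < T" for T :: real
    proof -
      \<comment> \<open>Angles from pi to 2 pi lead from -T to T through the lower half plane;
        length times maximum is of order 1/T.\<close>
      let ?g = "part_circlepath 0 T pi (2 * pi)"
      have ci: "(F has_contour_integral (P (pathfinish ?g) - P (pathstart ?g))) ?g"
        by (rule contour_integral_primitive[of UNIV P F]) (use P in auto)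
      have "cmod (P (pathfinish ?g) - P (pathstart ?g)) \<le> C / (1 + T\<^sup>2) * T * (2 * pi - pi)"
      proof (rule has_contour_integral_bound_part_circlepath_strong[OF ci, of "{}"])
        fix z assume "z \<in> path_image ?g - {}"
        then obtain s where s: "pi \<le> s" "s \<le> 2 * pi" "z = T * cis s"
          by (auto simp: path_image_part_circlepath' closed_segment_eq_real_ivl cis_conv_exp)
        have "sin s \<le> 0" using s sin_ge_zero[of "s - pi"] by (simp add: sin_diff)
        then have "Im z \<le> 0" using s T by (simp add: mult_nonneg_nonpos)
        moreover have "cmod z = T" using s T by (simp add: norm_mult)
        ultimately show "cmod (F z) \<le> C / (1 + T\<^sup>2)" using Fb[of z] by simp
      qed (use T H(2) in \<open>auto simp: add_nonneg_nonneg\<close>)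
      moreover have "exp (\<i> * (2 * complex_of_real pi)) = 1"
        using exp_two_pi_i by (simp add: mult_ac)
      moreover have "pathfinish ?g = of_real T * exp (\<i> * (2 * complex_of_real pi))" "pathstart ?g = of_real (- T)"
        using exp_pi_i by (simp_all add: mult_ac)
      ultimately show ?thesis by (simp only: mult_1_right) (simp add: algebra_simps)
    qed
    have FTC: "(LINT t|lborel. indicator {- T..T} t *\<^sub>R e t) = P (of_real T) - P (of_real (- T))" if "0 < T" for T :: real
    proof -
      have "has_bochner_integral lborel (\<lambda>t. indicator {- T..T} t *\<^sub>R e t) ((P \<circ> of_real) T - (P \<circ> of_real) (- T))"
      proof (rule has_bochner_integral_FTC_Icc)
        show "- T \<le> T" using that by simp
        show "((P \<circ> of_real) has_vector_derivative e x) (at x within {- T..T})" for x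
          using has_vector_derivative_real_field[OF P[of "of_real x"]]
          by (simp add: Fe has_vector_derivative_at_within o_def)
        show "continuous_on {- T..T} e"
          using exp_type_continuous[OF assms] unfolding e_def
          by (intro continuous_intros) (auto intro: continuous_on_subset)
      qed
      then show ?thesis by (simp add: has_bochner_integral_integral_eq o_def)
    qed
    have int: "integrable lborel e" unfolding e_def by (rule exp_type_integrable[OF assms])
    have "(\<lambda>n. LINT t|lborel. indicator {- real (Suc n)..real (Suc n)} t *\<^sub>R e t) \<longlonglongrightarrow> (LINT t|lborel. e t)"
    proof (rule integral_dominated_convergence[where w = "\<lambda>t. norm (e t)"])
      show "AE t in lborel. (\<lambda>n. indicator {- real (Suc n)..real (Suc n)} t *\<^sub>R e t) \<longlonglongrightarrow> e t"
      proof (rule AE_I2)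
        fix t :: real
        obtain N where "\<bar>t\<bar> \<le> real N" using real_arch_simple by blast
        then have "\<forall>\<^sub>F n in sequentially. indicator {- real (Suc n)..real (Suc n)} t *\<^sub>R e t = e t"
          by (intro eventually_sequentiallyI[of N]) (auto simp: indicator_def)
        then show "(\<lambda>n. indicator {- real (Suc n)..real (Suc n)} t *\<^sub>R e t) \<longlonglongrightarrow> e t"
          by (rule tendsto_eventually)
      qed
      show "AE t in lborel. norm (indicator {- real (Suc n)..real (Suc n)} t *\<^sub>R e t) \<le> norm (e t)" for n
        by (auto simp: indicator_def)
    qed (use int in auto)
    moreover have "(\<lambda>n. LINT t|lborel. indicator {- real (Suc n)..real (Suc n)} t *\<^sub>R e t) \<longlonglongrightarrow> 0"
    proof (rule Lim_null_comparison)
      show "\<forall>\<^sub>F n in sequentially. norm (LINT t|lborel. indicator {- real (Suc n)..real (Suc n)} t *\<^sub>R e t)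
        \<le> C / (1 + (real (Suc n))\<^sup>2) * real (Suc n) * pi"
        using PT FTC by (intro always_eventually allI) (metis of_nat_0_less_iff zero_less_Suc)
      show "(\<lambda>n. C / (1 + (real (Suc n))\<^sup>2) * real (Suc n) * pi) \<longlonglongrightarrow> 0"
        by real_asymp
    qed
    ultimately show ?thesis using LIMSEQ_unique by (auto simp: e_def)
  qed
  then show thesis using that by blast
qed

text \<open>Reflection exchanges positive and negative frequencies, which reduces the latter to the
  contour in the lower half plane.\<close>

lemma exp_type_uminus:
  assumes "exp_type h"
  shows "exp_type (\<lambda>t. h (- t))"
proof -
  obtain H C \<tau> where H: "H holomorphic_on UNIV" "0 \<le> \<tau>" "\<And>t. H (of_real t) = of_real (h t)"
    "\<And>z. cmod (H z) \<le> C * exp (\<tau> * \<bar>Im z\<bar>) / (1 + (cmod z)\<^sup>2)"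
    using exp_typeE[OF assms] by metis
  have "(H \<circ> uminus) holomorphic_on UNIV"
    by (rule holomorphic_on_compose_gen[OF _ H(1)]) (auto intro!: holomorphic_intros)
  then show ?thesis
    unfolding exp_type_def using H(2,3) H(4)[of "- _"]
    by (intro exI[of _ "H \<circ> uminus"] exI[of _ C] exI[of _ \<tau>]) (auto simp flip: of_real_minus)
qed

lemma exp_type_fourier_vanishes:
  assumes "exp_type h"
  obtains \<tau> where "0 \<le> \<tau>" "\<And>\<xi>. \<tau> \<le> \<bar>\<xi>\<bar> \<Longrightarrow>
    (LINT t|lborel. complex_of_real (h t) * exp (- 2 * complex_of_real pi * \<i> * complex_of_real (\<xi> * t))) = 0"
proof -
  obtain \<tau>1 where 1: "\<And>\<xi>. \<tau>1 \<le> \<xi> \<Longrightarrow>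
    (LINT t|lborel. complex_of_real (h t) * exp (- 2 * complex_of_real pi * \<i> * complex_of_real (\<xi> * t))) = 0"
    using exp_type_fourier_vanishes_pos[OF assms] by blast
  obtain \<tau>2 where 2: "\<And>\<xi>. \<tau>2 \<le> \<xi> \<Longrightarrow>
    (LINT t|lborel. complex_of_real (h (- t)) * exp (- 2 * complex_of_real pi * \<i> * complex_of_real (\<xi> * t))) = 0"
    using exp_type_fourier_vanishes_pos[OF exp_type_uminus[OF assms]] by blast
  have 3: "(LINT t|lborel. complex_of_real (h t) * exp (- 2 * complex_of_real pi * \<i> * complex_of_real (\<xi> * t))) = 0"
    if "\<tau>2 \<le> - \<xi>" for \<xi>
    using lborel_integral_real_affine[of "-1" "\<lambda>t. complex_of_real (h t) * exp (- 2 * complex_of_real pi * \<i> * complex_of_real (\<xi> * t))" 0] 2[OF that]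
    by simp
  show thesis
  proof (rule that[of "max 0 (max \<tau>1 \<tau>2)"])
    fix \<xi> assume "max 0 (max \<tau>1 \<tau>2) \<le> \<bar>\<xi>\<bar>"
    then have "\<tau>1 \<le> \<xi> \<or> \<tau>2 \<le> - \<xi>" by (cases "0 \<le> \<xi>") auto
    then show "(LINT t|lborel. complex_of_real (h t) * exp (- 2 * complex_of_real pi * \<i> * complex_of_real (\<xi> * t))) = 0"
      using 1 3 by blast
  qed simp
qed

section \<open>The squared sinc kernel and one-dimensional approximation\<close>

definition csinc :: "complex \<Rightarrow> complex" where
  "csinc z = (if z = 0 then 1 else sin z / z)"

lemma csinc_holomorphic: "csinc holomorphic_on UNIV"
proof (rule pole_theorem_0[where g = sin and a = 0])
  show "csinc 0 = deriv sin (0::complex)"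
    using DERIV_imp_deriv[OF DERIV_sin, of "0::complex"] by (simp add: csinc_def)
qed (auto simp: csinc_def intro: holomorphic_on_sin holomorphic_intros)

text \<open>On the unit disc the bound comes from compactness, outside from |sin z| \<le> exp |Im z|
  and 1 / |z|^2 \<le> 2 / (1 + |z|^2). Squaring yields the quadratic decay and, on the real line, a
  nonnegative kernel of Fejer type.\<close>

lemma csinc_square_bound:
  obtains C where "0 \<le> C" "\<And>z. cmod (csinc z ^ 2) \<le> C * exp (2 * \<bar>Im z\<bar>) / (1 + (cmod z)\<^sup>2)"
proof -
  have "compact ((\<lambda>z. csinc z ^ 2) ` cball 0 1)"
    using csinc_holomorphic
    by (intro compact_continuous_image continuous_intros)
       (auto intro: holomorphic_on_imp_continuous_on holomorphic_on_subset)
  then obtain B where B: "\<And>z. cmod z \<le> 1 \<Longrightarrow> cmod (csinc z ^ 2) \<le> B"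
    using compact_imp_bounded bounded_iff by (metis (no_types, lifting) imageI mem_cball_0)
  have B0: "0 \<le> B" using order_trans[OF norm_ge_zero B[of 0]] by simp
  have "cmod (csinc z ^ 2) \<le> (2 * B + 2) * exp (2 * \<bar>Im z\<bar>) / (1 + (cmod z)\<^sup>2)" for z
  proof (cases "cmod z \<le> 1")
    case True
    then have "(cmod z)\<^sup>2 \<le> 1" by (simp add: power_le_one)
    then have "B * (1 + (cmod z)\<^sup>2) \<le> B * 2" using B0 by (intro mult_left_mono) auto
    also have "\<dots> \<le> (2 * B + 2) * 1" by simp
    also have "\<dots> \<le> (2 * B + 2) * exp (2 * \<bar>Im z\<bar>)" using B0 by (intro mult_left_mono) auto
    finally have "B \<le> (2 * B + 2) * exp (2 * \<bar>Im z\<bar>) / (1 + (cmod z)\<^sup>2)"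
      by (subst pos_le_divide_eq) (auto simp: add_pos_nonneg)
    then show ?thesis using B[OF True] by linarith
  next
    case False
    then have z: "1 < (cmod z)\<^sup>2" "z \<noteq> 0" by (auto simp: one_less_power)
    have "(cmod (sin z))\<^sup>2 \<le> (exp \<bar>Im z\<bar>)\<^sup>2"
      using cmod_sin_le_exp[of 1 z] by (intro power_mono) auto
    also have "\<dots> = exp (2 * \<bar>Im z\<bar>)" by (simp add: exp_double)
    finally have "cmod (csinc z ^ 2) \<le> exp (2 * \<bar>Im z\<bar>) * (1 / (cmod z)\<^sup>2)"
      using z(2) by (simp add: csinc_def norm_power norm_divide power_divide divide_right_mono)
    also have "\<dots> \<le> exp (2 * \<bar>Im z\<bar>) * (2 / (1 + (cmod z)\<^sup>2))"
    proof (intro mult_left_mono)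
      have "1 / x \<le> 2 / (1 + x)" if "1 < x" for x :: real using that by (simp add: field_simps)
      then show "1 / (cmod z)\<^sup>2 \<le> 2 / (1 + (cmod z)\<^sup>2)" using z(1) .
    qed simp
    also have "\<dots> \<le> (2 * B + 2) * exp (2 * \<bar>Im z\<bar>) / (1 + (cmod z)\<^sup>2)"
      using B0 by (simp add: divide_right_mono add_nonneg_nonneg)
    finally show ?thesis .
  qed
  then show thesis using that[of "2 * B + 2"] B0 by auto
qed

lemma mono_bounded_tendsto:
  fixes f :: "real \<Rightarrow> real"
  assumes "mono f" "\<And>t. \<bar>f t\<bar> \<le> B"
  shows "(f \<longlongrightarrow> (SUP t. f t)) at_top" "(f \<longlongrightarrow> (INF t. f t)) at_bot"
proof -
  have ba: "bdd_above (range f)" and bb: "bdd_below (range f)"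
    using abs_le_D1[OF assms(2)] abs_le_D2[OF assms(2)]
    by (auto intro!: bdd_aboveI[of _ B] bdd_belowI[of _ "- B"] simp: minus_le_iff)
  show "(f \<longlongrightarrow> (SUP t. f t)) at_top"
  proof (rule order_tendstoI)
    fix a assume "a < (SUP t. f t)"
    then obtain T where "a < f T" using less_cSUP_iff[OF _ ba] by auto
    then have "\<And>t. t \<ge> T \<Longrightarrow> a < f t" using assms(1) by (meson less_le_trans monoD)
    then show "\<forall>\<^sub>F t in at_top. a < f t" by (auto simp: eventually_at_top_linorder)
  next
    fix a assume "(SUP t. f t) < a"
    then show "\<forall>\<^sub>F t in at_top. f t < a"
      by (intro always_eventually allI) (meson ba cSUP_upper UNIV_I le_less_trans)
  qed
  show "(f \<longlongrightarrow> (INF t. f t)) at_bot"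
  proof (rule order_tendstoI)
    fix a assume "a < (INF t. f t)"
    then show "\<forall>\<^sub>F t in at_bot. a < f t"
      by (intro always_eventually allI) (meson bb cINF_lower UNIV_I less_le_trans)
  next
    fix a assume "(INF t. f t) < a"
    then obtain T where "f T < a" using cINF_less_iff[OF _ bb] by auto
    then have "\<And>t. t \<le> T \<Longrightarrow> f t < a" using assms(1) by (meson le_less_trans monoD)
    then show "\<forall>\<^sub>F t in at_bot. f t < a" by (auto simp: eventually_at_bot_linorder)
  qed
qed

text \<open>The approximants are the convolutions of the indicator function with the dilations of the
  normalised square of the sinc function: differences of translated dilations of a primitive.\<close>

lemma exp_type_approx_indicator:
  fixes a b :: real
  assumes "a \<le> b"
  obtains h C where "\<And>n::nat. exp_type (h n)" "0 \<le> C" "\<And>n t. \<bar>h n t\<bar> \<le> C / (1 + t\<^sup>2)"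
    "\<And>t. t \<noteq> a \<Longrightarrow> t \<noteq> b \<Longrightarrow> (\<lambda>n. h n t) \<longlonglongrightarrow> indicator {a<..<b} t"
proof -
  obtain c where c: "0 \<le> c" "\<And>z. cmod (csinc z ^ 2) \<le> c * exp (2 * \<bar>Im z\<bar>) / (1 + (cmod z)\<^sup>2)"
    using csinc_square_bound by blast
  have hol: "(\<lambda>z. csinc z ^ 2) holomorphic_on UNIV" by (intro holomorphic_intros csinc_holomorphic)
  then obtain K where K: "\<And>z. (K has_field_derivative csinc z ^ 2) (at z)"
    using holomorphic_convex_primitive'[of UNIV "\<lambda>z. csinc z ^ 2"] by auto
  define k where "k t = Re (csinc (of_real t) ^ 2)" for t :: real
  define \<kappa> where "\<kappa> t = Re (K (of_real t))" for t :: real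
  have kr: "csinc (of_real t) ^ 2 = of_real (k t)" for t
    by (auto simp: k_def csinc_def sin_of_real simp flip: of_real_divide of_real_power)
  have k0: "0 \<le> k t" for t
    by (auto simp: k_def csinc_def sin_of_real simp flip: of_real_divide of_real_power)
  have kb: "k t \<le> c / (1 + t\<^sup>2)" for t
    using c(2)[of "of_real t"] k0[of t] unfolding kr by simp
  have vK: "((\<lambda>t. K (of_real t)) has_vector_derivative of_real (k t)) (at t)" for t
    using has_vector_derivative_real_field[OF K[of "of_real t"]] by (simp add: o_def kr)
  have \<kappa>: "(\<kappa> has_real_derivative k t) (at t)" for t
    using bounded_linear.has_vector_derivative[OF bounded_linear_Re vK]
    by (simp add: \<kappa>_def[abs_def] has_real_derivative_iff_has_vector_derivative)
  have Kr: "K (of_real t) - K (of_real u) = of_real (\<kappa> t - \<kappa> u)" for t u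
  proof -
    have "((\<lambda>t. Im (K (of_real t))) has_real_derivative 0) (at t)" for t
      using bounded_linear.has_vector_derivative[OF bounded_linear_Im vK]
      by (simp add: has_real_derivative_iff_has_vector_derivative)
    then have "Im (K (of_real t)) = Im (K (of_real u))"
      by (intro DERIV_isconst_all) auto
    then show ?thesis by (simp add: complex_eq_iff \<kappa>_def)
  qed
  have mono\<kappa>: "mono \<kappa>"
    by (rule monoI, erule DERIV_nonneg_imp_nondecreasing) (use \<kappa> k0 in blast)
  \<comment> \<open>By \<open>kb\<close> the function \<open>c * arctan t - \<kappa> t\<close> is
    nondecreasing, so increments of the monotone \<kappa> are bounded by those of
    \<open>c * arctan\<close>.\<close>
  have bd: "\<bar>\<kappa> t\<bar> \<le> \<bar>\<kappa> 0\<bar> + c * pi" for t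
  proof -
    have d: "((\<lambda>t. c * arctan t - \<kappa> t) has_real_derivative c * inverse (1 + t\<^sup>2) - k t) (at t)" for t
      by (intro DERIV_diff DERIV_cmult DERIV_arctan \<kappa>)
    have m: "c * arctan t - \<kappa> t \<le> c * arctan u - \<kappa> u" if "t \<le> u" for t u
    proof (rule DERIV_nonneg_imp_nondecreasing[OF that])
      show "\<exists>y. ((\<lambda>t. c * arctan t - \<kappa> t) has_real_derivative y) (at x) \<and> 0 \<le> y" for x
        using d[of x] kb[of x] by (auto simp: divide_inverse)
    qed
    have "\<bar>c * arctan t\<bar> \<le> c * pi"
      using arctan_lbound[of t] arctan_ubound[of t] c(1)
      by (auto simp: abs_mult intro!: mult_left_mono)
    then have at: "c * arctan t \<le> c * pi" "- (c * arctan t) \<le> c * pi" by linarith+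
    show ?thesis
    proof (cases "0 \<le> t")
      case True
      then show ?thesis using m[OF True] monoD[OF mono\<kappa> True] at by simp
    next
      case False
      then have "t \<le> 0" by simp
      then show ?thesis using m[of t 0] monoD[OF mono\<kappa>, of t 0] at by simp
    qed
  qed
  define U where "U = (SUP t. \<kappa> t)"
  define V where "V = (INF t. \<kappa> t)"
  have lim: "(\<kappa> \<longlongrightarrow> U) at_top" "(\<kappa> \<longlongrightarrow> V) at_bot"
    unfolding U_def V_def using mono_bounded_tendsto[OF mono\<kappa> bd] by auto
  \<comment> \<open>Equal limits at both ends would make the monotone \<kappa> constant, against
    \<open>k 0 = 1\<close>.\<close>
  have UV: "V < U"
  proof (rule ccontr)
    have "bounded (range \<kappa>)" unfolding bounded_iff using bd by auto
    then have bda: "bdd_above (range \<kappa>)" "bdd_below (range \<kappa>)"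
      by (simp_all add: bounded_imp_bdd_above bounded_imp_bdd_below)
    assume "\<not> V < U"
    then have "\<kappa> t = V" for t
      using cSUP_upper[OF UNIV_I bda(1), of t] cINF_lower[OF bda(2) UNIV_I, of t] by (simp add: U_def V_def)
    then have "\<kappa> = (\<lambda>_. V)" by auto
    then have "(\<kappa> has_real_derivative 0) (at 0)" by simp
    then have "k 0 = 0" using \<kappa> DERIV_unique by blast
    then show False by (simp add: k_def csinc_def)
  qed
  \<comment> \<open>The total mass of the kernel; dividing by it makes the limit inside the interval
    equal to 1.\<close>
  define L where "L = U - V"
  have L: "0 < L" using UV by (simp add: L_def)
  define M where "M = \<bar>a\<bar> + \<bar>b\<bar>"
  have M0: "0 \<le> M" by (simp add: M_def)
  define h where "h n t = (\<kappa> (real (Suc n) * (t - a)) - \<kappa> (real (Suc n) * (t - b))) / L" for n t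
  have 1: "exp_type (h n)" for n
  proof -
    define m where "m = real (Suc n)"
    have m: "1 \<le> m" by (simp add: m_def)
    define H where "H z = (K (of_real m * (z - of_real a)) - K (of_real m * (z - of_real b))) / of_real L" for z
    have "cmod (H z) \<le> (2 * (1 + M\<^sup>2) * c * m * (b - a) / L) * exp ((2 * m) * \<bar>Im z\<bar>) / (1 + (cmod z)\<^sup>2)" for z
    proof -
      let ?w = "\<lambda>u. of_real m * (z - of_real u)"
      let ?B = "2 * (1 + M\<^sup>2) * c * exp ((2 * m) * \<bar>Im z\<bar>) / (1 + (cmod z)\<^sup>2)"
      have "cmod (K (?w a) - K (?w b)) \<le> ?B * cmod (?w a - ?w b)"
      proof (rule field_differentiable_bound[where S = "closed_segment (?w a) (?w b)" and f' = "\<lambda>z. csinc z ^ 2"])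
        fix w assume "w \<in> closed_segment (?w a) (?w b)"
        then obtain s where s: "0 \<le> s" "s \<le> 1" "w = (1 - s) *\<^sub>R ?w a + s *\<^sub>R ?w b"
          by (auto simp: closed_segment_def)
        \<comment> \<open>Every point of the segment is \<open>?w u\<close> with \<open>u\<close>
          between \<open>a\<close> and \<open>b\<close>. All of them have imaginary part m Im z,
          whence the type 2m, and the shift by \<open>u\<close> changes the weight by a factor
          depending on \<open>M\<close> alone.\<close>
        define u where "u = (1 - s) * a + s * b"
        have w: "w = ?w u" unfolding s(3) u_def by (simp add: scaleR_conv_of_real algebra_simps)
        have "\<bar>(1 - s) * a\<bar> \<le> \<bar>a\<bar>" "\<bar>s * b\<bar> \<le> \<bar>b\<bar>"
          using s by (auto simp: abs_mult intro!: mult_left_le_one_le)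
        then have u: "\<bar>u\<bar> \<le> M" by (simp add: u_def M_def)
        have "cmod (z - of_real u) \<le> cmod w"
          using m mult_right_mono[of 1 m "cmod (z - of_real u)"] by (simp add: w norm_mult)
        then have "1 + (cmod (z - of_real u))\<^sup>2 \<le> 1 + (cmod w)\<^sup>2" by (simp add: power_mono)
        then have "1 / (1 + (cmod w)\<^sup>2) \<le> 1 / (1 + (cmod (z - of_real u))\<^sup>2)"
          by (intro divide_left_mono) (auto simp: add_pos_nonneg)
        also have "\<dots> \<le> 2 * (1 + u\<^sup>2) / (1 + (cmod z)\<^sup>2)"
          using inverse_one_plus_norm_square_le[of "z - of_real u" z] by simp
        also have "\<dots> \<le> 2 * (1 + M\<^sup>2) / (1 + (cmod z)\<^sup>2)"
          using u by (intro divide_right_mono mult_left_mono add_left_mono)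
            (auto simp: add_nonneg_nonneg abs_le_square_iff[symmetric])
        finally have w2: "1 / (1 + (cmod w)\<^sup>2) \<le> 2 * (1 + M\<^sup>2) / (1 + (cmod z)\<^sup>2)" .
        have "\<bar>Im w\<bar> = m * \<bar>Im z\<bar>" using m by (simp add: w abs_mult)
        then have "cmod (csinc w ^ 2) \<le> c * exp (2 * m * \<bar>Im z\<bar>) * (1 / (1 + (cmod w)\<^sup>2))"
          using c(2)[of w] by (simp add: mult.assoc)
        also have "\<dots> \<le> c * exp (2 * m * \<bar>Im z\<bar>) * (2 * (1 + M\<^sup>2) / (1 + (cmod z)\<^sup>2))"
          using w2 c(1) by (intro mult_left_mono) auto
        finally show "cmod (csinc w ^ 2) \<le> ?B" by (simp add: algebra_simps)
      qed (auto intro: has_field_derivative_at_within K)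
      also have "cmod (?w a - ?w b) = m * (b - a)"
        using m assms norm_of_real[of "m * (b - a)", where 'a = complex] by (simp add: algebra_simps)
      finally have "cmod (K (?w a) - K (?w b)) / L \<le> ?B * (m * (b - a)) / L"
        using L by (intro divide_right_mono) auto
      then show ?thesis using L by (simp add: H_def norm_divide algebra_simps)
    qed
    moreover have "H holomorphic_on UNIV"
    proof -
      have hK: "K holomorphic_on UNIV" using K by (metis holomorphic_on_open open_UNIV)
      have "(K \<circ> (\<lambda>z. of_real m * (z - of_real v))) holomorphic_on UNIV" for v
        by (rule holomorphic_on_compose_gen[OF _ hK]) (auto intro!: holomorphic_intros)
      then show ?thesis unfolding H_def o_def using L by (intro holomorphic_intros) auto
    qed
    moreover have "H (of_real t) = of_real (h n t)" for t
      using Kr[of "m * (t - a)" "m * (t - b)"] by (simp add: H_def h_def m_def)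
    ultimately show ?thesis
      unfolding exp_type_def using m
      by (intro exI[of _ H] exI[of _ "2 * (1 + M\<^sup>2) * c * m * (b - a) / L"] exI[of _ "2 * m"]) auto
  qed
  define B where "B = \<bar>\<kappa> 0\<bar> + c * pi"
  have B0: "0 \<le> B" using c(1) by (simp add: B_def)
  define C1 where "C1 = 2 * B / L * (1 + (M + 1)\<^sup>2)"
  define C2 where "C2 = 4 * (1 + M\<^sup>2) * c * (b - a) / L"
  have C0: "0 \<le> C1" "0 \<le> C2" using B0 L M0 c(1) assms by (auto simp: C1_def C2_def add_nonneg_nonneg)
  \<comment> \<open>The bound must be uniform in \<open>n\<close>. For |t| \<le> M + 1 boundedness
    of \<kappa> suffices and gives \<open>C1\<close>. Beyond, the integration interval has length m
    (b - a), but its points satisfy |w| \<ge> m; spending one factor m of w^2 on this length leaves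
    the m-free constant \<open>C2\<close>.\<close>
  have 2: "\<bar>h n t\<bar> \<le> (C1 + C2) / (1 + t\<^sup>2)" for n t
  proof -
    define m where "m = real (Suc n)"
    have m: "1 \<le> m" by (simp add: m_def)
    have t0: "0 < 1 + t\<^sup>2" by (simp add: add_pos_nonneg)
    show ?thesis
    proof (cases "\<bar>t\<bar> \<le> M + 1")
      case True
      then have t: "1 + t\<^sup>2 \<le> 1 + (M + 1)\<^sup>2" using M0 by (simp add: abs_le_square_iff[symmetric])
      have "\<bar>h n t\<bar> * (1 + t\<^sup>2) \<le> 2 * B / L * (1 + (M + 1)\<^sup>2)"
      proof (rule mult_mono[OF _ t])
        have "\<bar>\<kappa> (m * (t - a)) - \<kappa> (m * (t - b))\<bar> \<le> 2 * B"
          using bd[of "m * (t - a)", folded B_def] bd[of "m * (t - b)", folded B_def] by arith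
        then show "\<bar>h n t\<bar> \<le> 2 * B / L" using L by (simp add: h_def m_def divide_right_mono)
      qed (use B0 L t0 in auto)
      then have "\<bar>h n t\<bar> * (1 + t\<^sup>2) \<le> C1 + C2" using C0 by (simp add: C1_def)
      then show ?thesis using t0 by (simp add: pos_le_divide_eq)
    next
      case False
      let ?B = "c * (4 * (1 + M\<^sup>2) / (1 + t\<^sup>2)) / m"
      have "norm (\<kappa> (m * (t - a)) - \<kappa> (m * (t - b))) \<le> ?B * norm (m * (t - a) - m * (t - b))"
      proof (rule field_differentiable_bound[where S = "{m * (t - b)..m * (t - a)}" and f' = k])
        fix w assume w: "w \<in> {m * (t - b)..m * (t - a)}"
        define u where "u = t - w / m"
        have wu: "w = m * (t - u)" using m by (simp add: u_def)
        have "a \<le> u" "u \<le> b" using w m by (auto simp: wu)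
        then have u: "\<bar>u\<bar> \<le> M" by (simp add: M_def)
        \<comment> \<open>The margin 1 in \<open>M + 1\<close> serves here: it bounds 1 + (t - u)^2
          by 2 (t - u)^2, from which the factor m is extracted.\<close>
        then have tu: "1 \<le> \<bar>t - u\<bar>" using False by linarith
        then have tu2: "1 \<le> (t - u)\<^sup>2" using abs_le_square_iff[of 1 "t - u"] by simp
        have "m * (1 + (t - u)\<^sup>2) \<le> m * (2 * (t - u)\<^sup>2)" using m tu2 by (intro mult_left_mono) auto
        also have "\<dots> \<le> m * (2 * (m * (t - u)\<^sup>2))"
          using m mult_right_mono[of 1 m "(t - u)\<^sup>2"] by (intro mult_left_mono) auto
        also have "\<dots> \<le> 2 * (1 + w\<^sup>2)" by (simp add: wu power_mult_distrib power2_eq_square algebra_simps)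
        finally have "1 / (1 + w\<^sup>2) \<le> 2 / m * (1 / (1 + (t - u)\<^sup>2))"
          using m by (simp add: field_simps add_pos_nonneg)
        also have "\<dots> \<le> 2 / m * (2 * (1 + u\<^sup>2) / (1 + t\<^sup>2))"
          using inverse_one_plus_norm_square_le[of "t - u" t] m by (intro mult_left_mono) auto
        also have "\<dots> \<le> 2 / m * (2 * (1 + M\<^sup>2) / (1 + t\<^sup>2))"
          using u m t0 by (intro mult_left_mono divide_right_mono add_left_mono)
            (auto simp: abs_le_square_iff[symmetric])
        finally have "c * (1 / (1 + w\<^sup>2)) \<le> c * (2 / m * (2 * (1 + M\<^sup>2) / (1 + t\<^sup>2)))"
          using c(1) by (intro mult_left_mono)
        then show "norm (k w) \<le> ?B" using kb[of w] k0[of w] by (simp add: mult_ac)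
      qed (use m assms in \<open>auto intro: has_field_derivative_at_within \<kappa>\<close>)
      also have "norm (m * (t - a) - m * (t - b)) = m * (b - a)"
        using m assms by (simp add: abs_mult flip: right_diff_distrib)
      also have "?B * (m * (b - a)) = 4 * (1 + M\<^sup>2) * c * (b - a) / (1 + t\<^sup>2)"
        using m by simp
      finally have "\<bar>\<kappa> (m * (t - a)) - \<kappa> (m * (t - b))\<bar> / L \<le> 4 * (1 + M\<^sup>2) * c * (b - a) / (1 + t\<^sup>2) / L"
        using L by (intro divide_right_mono) auto
      then have "\<bar>h n t\<bar> \<le> C2 / (1 + t\<^sup>2)" using L by (simp add: h_def m_def C2_def mult.commute)
      also have "\<dots> \<le> (C1 + C2) / (1 + t\<^sup>2)" using C0 t0 by (intro divide_right_mono) auto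
      finally show ?thesis .
    qed
  qed
  have lim1: "(\<lambda>n. \<kappa> (real (Suc n) * v)) \<longlonglongrightarrow> (if 0 < v then U else V)" if "v \<noteq> 0" for v
  proof (cases "0 < v")
    case True
    then have "filterlim (\<lambda>n. real (Suc n) * v) at_top sequentially" by real_asymp
    then show ?thesis using True filterlim_compose[OF lim(1)] by simp
  next
    case False
    then have "v < 0" using that by simp
    then have "filterlim (\<lambda>n. real (Suc n) * v) at_bot sequentially" by real_asymp
    then show ?thesis using False filterlim_compose[OF lim(2)] by simp
  qed
  have 3: "(\<lambda>n. h n t) \<longlonglongrightarrow> indicator {a<..<b} t" if "t \<noteq> a" "t \<noteq> b" for t
  proof -
    have "(\<lambda>n. h n t) \<longlonglongrightarrow> ((if 0 < t - a then U else V) - (if 0 < t - b then U else V)) / L"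
      unfolding h_def using that L by (intro tendsto_intros lim1) auto
    also have "((if 0 < t - a then U else V) - (if 0 < t - b then U else V)) / L = indicator {a<..<b} t"
      using assms that L by (auto simp: indicator_def L_def)
    finally show ?thesis .
  qed
  show thesis using that[OF 1 _ 2 3] C0 by auto
qed

section \<open>Sums of products of functions of exponential type\<close>

lemma Basis_cart: "Basis = range (\<lambda>i. axis i (1::real))"
  by (auto simp: Basis_vec_def)

lemma inj_axis_one: "inj (\<lambda>i. axis i (1::real))"
  by (auto simp: inj_def axis_eq_axis)

lemma prod_Basis_cart:
  fixes F :: "real ^ 'n \<Rightarrow> 'b::comm_monoid_mult"
  shows "(\<Prod>b\<in>Basis. F b) = (\<Prod>i\<in>UNIV. F (axis i 1))"
  unfolding Basis_cart by (subst prod.reindex[OF inj_axis_one]) (simp add: o_def)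

text \<open>Lebesgue measure is the image under \<open>T\<close> of the product measure indexed by
  \<open>Basis\<close>. Reindexing the basis by coordinates turns Fubini's theorem for finite
  products into the coordinate form.\<close>

lemma lborel_cart_prod:
  fixes g :: "'n::finite \<Rightarrow> real \<Rightarrow> 'b::{real_normed_field,banach,second_countable_topology}"
  assumes int: "\<And>i. integrable lborel (g i)"
  shows integrable_cart_prod: "integrable lborel (\<lambda>x::real ^ 'n. \<Prod>i\<in>UNIV. g i (x $ i))"
    and integral_cart_prod: "(LINT x|lborel. (\<Prod>i\<in>UNIV. g i ((x::real ^ 'n) $ i))) = (\<Prod>i\<in>UNIV. LINT t|lborel. g i t)"
proof -
  let ?M = "\<lambda>b::real ^ 'n. lborel :: real measure"
  interpret product_sigma_finite ?M by standard
  define G where "G b = g (axis_index b)" for b :: "real ^ 'n"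
  define T where "T = (\<lambda>f. \<Sum>b\<in>Basis. f b *\<^sub>R b :: real ^ 'n)"
  have G: "(\<Prod>i\<in>UNIV. g i (x $ i)) = (\<Prod>b\<in>Basis. G b (x \<bullet> b))" for x
    by (simp add: prod_Basis_cart G_def cart_eq_inner_axis)
  have GT: "(\<Prod>i\<in>UNIV. g i (T f $ i)) = (\<Prod>b\<in>Basis. G b (f b))" for f
    unfolding G by (intro prod.cong refl) (simp add: T_def inner_sum_left_Basis)
  have Gint: "integrable lborel (G b)" for b using int by (simp add: G_def)
  have [measurable]: "g i \<in> borel_measurable borel" for i using int[of i] by auto
  have T: "T \<in> (\<Pi>\<^sub>M b\<in>Basis. lborel) \<rightarrow>\<^sub>M borel" unfolding T_def by measurable
  have m: "(\<lambda>x::real ^ 'n. \<Prod>i\<in>UNIV. g i (x $ i)) \<in> borel_measurable borel" by measurable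
  have eq: "(lborel :: (real ^ 'n) measure) = distr (\<Pi>\<^sub>M b\<in>Basis. lborel) borel T"
    unfolding T_def by (rule lborel_eq)
  show "integrable lborel (\<lambda>x::real ^ 'n. \<Prod>i\<in>UNIV. g i (x $ i))"
    unfolding eq integrable_distr_eq[OF T m] GT
    by (intro product_integrable_prod Gint) simp
  have "(LINT x|lborel. (\<Prod>i\<in>UNIV. g i ((x::real ^ 'n) $ i))) = (LINT f|(\<Pi>\<^sub>M b\<in>Basis. lborel). (\<Prod>b\<in>Basis. G b (f b)))"
    unfolding eq integral_distr[OF T m] GT ..
  also have "\<dots> = (\<Prod>b\<in>Basis. LINT t|lborel. G b t)"
    by (intro product_integral_prod Gint) simp
  also have "\<dots> = (\<Prod>i\<in>UNIV. LINT t|lborel. g i t)"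
    by (simp add: prod_Basis_cart G_def)
  finally show "(LINT x|lborel. (\<Prod>i\<in>UNIV. g i ((x::real ^ 'n) $ i))) = (\<Prod>i\<in>UNIV. LINT t|lborel. g i t)" .
qed

text \<open>A product of one-dimensional weights, because the radial weight 1 / (1 + |x|^2) is not
  integrable in dimension two or more.\<close>

definition cart_weight :: "real ^ 'n \<Rightarrow> real" where
  "cart_weight x = (\<Prod>i\<in>UNIV. 1 / (1 + (x $ i)\<^sup>2))"

lemma cart_weight_pos: "0 < cart_weight x"
  unfolding cart_weight_def by (intro prod_pos) (auto simp: add_pos_nonneg)

lemma cart_weight_nonneg: "0 \<le> cart_weight x"
  using cart_weight_pos[of x] by simp

lemma cart_weight_le_1: "cart_weight x \<le> 1"
  unfolding cart_weight_def by (intro prod_le_1) (auto simp: add_nonneg_nonneg field_simps add_pos_nonneg)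

lemma cart_weight_integrable: "integrable lborel (cart_weight :: real ^ 'n \<Rightarrow> real)"
  unfolding cart_weight_def[abs_def]
  by (rule integrable_cart_prod) (rule integrable_inverse_one_plus_square)

lemma cart_weight_measurable [measurable]: "cart_weight \<in> borel_measurable borel"
  using cart_weight_integrable by auto

text \<open>Lets a point value of the weight be replaced by its average over a small ball, and thus
  a sampling sum by an integral.\<close>

lemma cart_weight_near:
  fixes x y :: "real ^ 'n"
  assumes "dist x y \<le> 1"
  shows "cart_weight x \<le> 4 ^ CARD('n) * cart_weight y"
proof -
  have "cart_weight x \<le> (\<Prod>i\<in>UNIV. 4 * (1 / (1 + (y $ i)\<^sup>2)))"
    unfolding cart_weight_def
  proof (intro prod_mono conjI)
    fix i
    have "\<bar>y $ i - x $ i\<bar> \<le> 1"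
      using component_le_norm_cart[of "x - y" i] assms by (simp add: dist_norm)
    then show "1 / (1 + (x $ i)\<^sup>2) \<le> 4 * (1 / (1 + (y $ i)\<^sup>2))"
      using inverse_one_plus_norm_square_near[of "y $ i" "x $ i"] by simp
  qed (auto simp: add_nonneg_nonneg)
  also have "\<dots> = 4 ^ CARD('n) * cart_weight y"
    unfolding cart_weight_def prod.distrib by simp
  finally show ?thesis .
qed

text \<open>Products of one-variable functions, so that the Fourier integral factorises; sums and
  multiples, so that approximation can pass from boxes to general functions.\<close>

inductive_set exp_span :: "(real ^ 'n \<Rightarrow> real) set" where
  prod: "(\<And>i. exp_type (h i)) \<Longrightarrow> (\<lambda>x. \<Prod>i\<in>UNIV. h i (x $ i)) \<in> exp_span"
| add: "f \<in> exp_span \<Longrightarrow> g \<in> exp_span \<Longrightarrow> (\<lambda>x. f x + g x) \<in> exp_span"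
| scale: "f \<in> exp_span \<Longrightarrow> (\<lambda>x. c * f x) \<in> exp_span"

lemma exp_span_bound:
  assumes "f \<in> exp_span"
  shows "\<exists>C\<ge>0. \<forall>x. \<bar>f x\<bar> \<le> C * cart_weight x"
  using assms
proof induction
  case (prod h)
  then have "\<forall>i. \<exists>C\<ge>0. \<forall>t. \<bar>h i t\<bar> \<le> C / (1 + t\<^sup>2)" using exp_type_bound by metis
  then obtain C where C: "\<And>i. 0 \<le> C i" "\<And>i t. \<bar>h i t\<bar> \<le> C i / (1 + t\<^sup>2)" by metis
  have "\<bar>\<Prod>i\<in>UNIV. h i (x $ i)\<bar> \<le> (\<Prod>i\<in>UNIV. C i) * cart_weight x" for x
  proof -
    have "\<bar>\<Prod>i\<in>UNIV. h i (x $ i)\<bar> = (\<Prod>i\<in>UNIV. \<bar>h i (x $ i)\<bar>)" by (rule abs_prod)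
    also have "\<dots> \<le> (\<Prod>i\<in>UNIV. C i * (1 / (1 + (x $ i)\<^sup>2)))"
      using C(2) by (intro prod_mono) auto
    finally show ?thesis by (simp only: prod.distrib cart_weight_def)
  qed
  then show ?case using C(1) by (intro exI[of _ "\<Prod>i\<in>UNIV. C i"]) (auto intro: prod_nonneg)
next
  case (add f g)
  then obtain C D where "0 \<le> C" "0 \<le> D" and C: "\<And>x. \<bar>f x\<bar> \<le> C * cart_weight x" and D: "\<And>x. \<bar>g x\<bar> \<le> D * cart_weight x"
    by auto
  moreover have "\<bar>f x + g x\<bar> \<le> (C + D) * cart_weight x" for x
    using C[of x] D[of x] by (simp add: distrib_right)
  ultimately show ?case by (intro exI[of _ "C + D"]) auto
next
  case (scale f c)
  then obtain C where "0 \<le> C" and C: "\<And>x. \<bar>f x\<bar> \<le> C * cart_weight x" by auto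
  moreover have "\<bar>c * f x\<bar> \<le> (\<bar>c\<bar> * C) * cart_weight x" for x
    using mult_left_mono[OF C[of x], of "\<bar>c\<bar>"] by (simp add: abs_mult mult.assoc)
  ultimately show ?case by (intro exI[of _ "\<bar>c\<bar> * C"]) auto
qed

text \<open>Telescoping: the factors are exchanged one at a time, each exchange costing
  \<open>D\<close> times the product of the bounds.\<close>

lemma abs_prod_diff_le:
  fixes a b w :: "'i \<Rightarrow> real"
  assumes "finite S" "0 \<le> D"
    "\<And>i. i \<in> S \<Longrightarrow> \<bar>a i\<bar> \<le> w i" "\<And>i. i \<in> S \<Longrightarrow> \<bar>b i\<bar> \<le> w i"
    "\<And>i. i \<in> S \<Longrightarrow> \<bar>a i - b i\<bar> \<le> D * w i"
  shows "\<bar>prod a S - prod b S\<bar> \<le> real (card S) * D * prod w S"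
  using assms(1,3-)
proof (induction S)
  case (insert i S)
  have w: "0 \<le> prod w S"
    using insert.prems(1) by (intro prod_nonneg) (meson abs_ge_zero insertI2 order_trans)
  have wi: "0 \<le> w i" using insert.prems(1)[of i] by auto
  have "\<bar>prod b S\<bar> \<le> prod w S" unfolding abs_prod using insert.prems(2) by (intro prod_mono) auto
  then have 1: "\<bar>a i - b i\<bar> * \<bar>prod b S\<bar> \<le> (D * w i) * prod w S"
    using insert.prems(3)[of i] w wi assms(2) by (intro mult_mono) auto
  have 2: "\<bar>a i\<bar> * \<bar>prod a S - prod b S\<bar> \<le> w i * (real (card S) * D * prod w S)"
    using insert wi by (intro mult_mono) auto
  have "prod a (insert i S) - prod b (insert i S) = a i * (prod a S - prod b S) + (a i - b i) * prod b S"
    using insert.hyps by (simp add: algebra_simps)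
  then have "\<bar>prod a (insert i S) - prod b (insert i S)\<bar> \<le> \<bar>a i\<bar> * \<bar>prod a S - prod b S\<bar> + \<bar>a i - b i\<bar> * \<bar>prod b S\<bar>"
    by (metis abs_mult abs_triangle_ineq)
  also have "\<dots> \<le> w i * (real (card S) * D * prod w S) + (D * w i) * prod w S" using 1 2 by linarith
  also have "\<dots> = real (card (insert i S)) * D * prod w (insert i S)"
    using insert.hyps by (simp add: algebra_simps)
  finally show ?case .
qed simp

lemma exp_span_Lipschitz:
  assumes "f \<in> exp_span"
  shows "\<exists>C\<ge>0. \<forall>x y. dist x y \<le> 1 \<longrightarrow> \<bar>f x - f y\<bar> \<le> C * dist x y * cart_weight x"
  using assms
proof induction
  case (prod h)
  then have "\<forall>i. \<exists>C\<ge>0. \<forall>t. \<bar>h i t\<bar> \<le> C / (1 + t\<^sup>2)" using exp_type_bound by metis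
  then obtain C where C: "\<And>i. 0 \<le> C i" "\<And>i t. \<bar>h i t\<bar> \<le> C i / (1 + t\<^sup>2)" by metis
  have "\<forall>i. \<exists>L\<ge>0. \<forall>t u. \<bar>t - u\<bar> \<le> 1 \<longrightarrow> \<bar>h i t - h i u\<bar> \<le> L * \<bar>t - u\<bar> / (1 + t\<^sup>2)"
    using prod exp_type_Lipschitz by metis
  then obtain L where L: "\<And>i. 0 \<le> L i" "\<And>i t u. \<bar>t - u\<bar> \<le> 1 \<Longrightarrow> \<bar>h i t - h i u\<bar> \<le> L i * \<bar>t - u\<bar> / (1 + t\<^sup>2)"
    by metis
  \<comment> \<open>One constant for all three premises of the telescoping bound, all weighted at
    \<open>x\<close>: \<open>C i\<close> for the value at \<open>x\<close>, \<open>4 * C i\<close>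
    for the value at the neighbour \<open>y\<close>, and \<open>L i\<close> for the
    difference.\<close>
  define K where "K = (\<Sum>i\<in>UNIV. 4 * C i + L i)"
  have K: "4 * C i + L i \<le> K" for i
    unfolding K_def using C(1) L(1) by (intro member_le_sum) auto
  have K0: "0 \<le> K" unfolding K_def using C(1) L(1) by (intro sum_nonneg) auto
  have "\<bar>(\<Prod>i\<in>UNIV. h i (x $ i)) - (\<Prod>i\<in>UNIV. h i (y $ i))\<bar> \<le> (real CARD('a) * K ^ CARD('a)) * dist x y * cart_weight x"
    if "dist x y \<le> 1" for x y :: "real ^ 'a"
  proof -
    have d: "\<bar>x $ i - y $ i\<bar> \<le> dist x y" for i
      using component_le_norm_cart[of "x - y" i] by (simp add: dist_norm)
    have "\<bar>(\<Prod>i\<in>UNIV. h i (x $ i)) - (\<Prod>i\<in>UNIV. h i (y $ i))\<bar>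
      \<le> real CARD('a) * dist x y * (\<Prod>i\<in>UNIV. K * (1 / (1 + (x $ i)\<^sup>2)))"
    proof (rule abs_prod_diff_le)
      fix i
      let ?w = "1 / (1 + (x $ i)\<^sup>2)"
      have w: "0 \<le> ?w" by (simp add: add_nonneg_nonneg)
      have "\<bar>h i (x $ i)\<bar> \<le> C i * ?w" using C(2) by simp
      also have "\<dots> \<le> K * ?w" using K[of i] C(1)[of i] L(1)[of i] w by (intro mult_right_mono) auto
      finally show "\<bar>h i (x $ i)\<bar> \<le> K * ?w" .
      have "\<bar>h i (y $ i)\<bar> \<le> C i * (1 / (1 + (y $ i)\<^sup>2))" using C(2) by simp
      also have "\<dots> \<le> C i * (4 / (1 + (x $ i)\<^sup>2))"
        using inverse_one_plus_norm_square_near[of "x $ i" "y $ i"] d[of i] that C(1)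
        by (intro mult_left_mono) auto
      also have "\<dots> \<le> K * ?w" using K[of i] L(1)[of i] w mult_right_mono[of "4 * C i" K ?w] by (simp add: mult.commute)
      finally show "\<bar>h i (y $ i)\<bar> \<le> K * ?w" .
      have "\<bar>h i (x $ i) - h i (y $ i)\<bar> \<le> L i * \<bar>x $ i - y $ i\<bar> / (1 + (x $ i)\<^sup>2)"
        using L(2) d[of i] that by auto
      also have "\<dots> = L i * ?w * \<bar>x $ i - y $ i\<bar>" by simp
      also have "\<dots> \<le> K * ?w * dist x y"
        using K[of i] C(1)[of i] L(1)[of i] w d K0 by (intro mult_mono) auto
      finally show "\<bar>h i (x $ i) - h i (y $ i)\<bar> \<le> dist x y * (K * ?w)" by (simp add: mult_ac)
    qed auto
    also have "(\<Prod>i\<in>UNIV. K * (1 / (1 + (x $ i)\<^sup>2))) = K ^ CARD('a) * cart_weight x"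
      unfolding cart_weight_def prod.distrib by simp
    finally show ?thesis by (simp add: mult_ac)
  qed
  then show ?case using K0 by (intro exI[of _ "real CARD('a) * K ^ CARD('a)"]) auto
next
  case (add f g)
  then obtain C D where "0 \<le> C" "0 \<le> D"
    and C: "\<And>x y. dist x y \<le> 1 \<Longrightarrow> \<bar>f x - f y\<bar> \<le> C * dist x y * cart_weight x"
    and D: "\<And>x y. dist x y \<le> 1 \<Longrightarrow> \<bar>g x - g y\<bar> \<le> D * dist x y * cart_weight x"
    by auto
  moreover have "\<bar>(f x + g x) - (f y + g y)\<bar> \<le> (C + D) * dist x y * cart_weight x" if "dist x y \<le> 1" for x y
  proof -
    have "\<bar>(f x + g x) - (f y + g y)\<bar> \<le> \<bar>f x - f y\<bar> + \<bar>g x - g y\<bar>" by linarith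
    then show ?thesis using C[OF that] D[OF that] by (simp add: distrib_right)
  qed
  ultimately show ?case by (intro exI[of _ "C + D"]) auto
next
  case (scale f c)
  then obtain C where "0 \<le> C" and C: "\<And>x y. dist x y \<le> 1 \<Longrightarrow> \<bar>f x - f y\<bar> \<le> C * dist x y * cart_weight x"
    by auto
  moreover have "\<bar>c * f x - c * f y\<bar> \<le> (\<bar>c\<bar> * C) * dist x y * cart_weight x" if "dist x y \<le> 1" for x y
    using mult_left_mono[OF C[OF that], of "\<bar>c\<bar>"]
    by (simp add: abs_mult mult.assoc flip: right_diff_distrib)
  ultimately show ?case by (intro exI[of _ "\<bar>c\<bar> * C"]) auto
qed

lemma exp_span_continuous:
  assumes "f \<in> exp_span"
  shows "continuous_on UNIV f"
  using assms
proof induction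
  case (prod h)
  have "continuous_on UNIV (\<lambda>x::real ^ 'a. h i (x $ i))" for i
    by (rule continuous_on_compose2[OF exp_type_continuous[OF prod]]) (auto intro!: continuous_intros)
  then show ?case by (intro continuous_intros)
qed (auto intro: continuous_intros)

lemma exp_span_borel_measurable:
  assumes "f \<in> exp_span"
  shows "f \<in> borel_measurable borel"
  using exp_span_continuous[OF assms] by (rule borel_measurable_continuous_onI)

lemma exp_span_directional_derivative:
  fixes f :: "real ^ 'n \<Rightarrow> real"
  assumes "f \<in> exp_span"
  shows "\<exists>f'\<in>exp_span. \<forall>x. ((\<lambda>t. f (x + t *\<^sub>R axis i 1)) has_real_derivative f' x) (at 0)"
  using assms
proof induction
  case (prod h)
  obtain h' where h': "exp_type h'" "\<And>t. (h i has_real_derivative h' t) (at t)"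
    using exp_type_deriv[OF prod] by blast
  let ?h = "\<lambda>j. if j = i then h' else h j"
  have "(\<lambda>x. \<Prod>j\<in>UNIV. ?h j (x $ j)) \<in> exp_span"
    by (rule exp_span.prod) (use prod h' in auto)
  moreover have "((\<lambda>t. \<Prod>j\<in>UNIV. h j ((x + t *\<^sub>R axis i 1) $ j)) has_real_derivative (\<Prod>j\<in>UNIV. ?h j (x $ j))) (at 0)" for x
  proof -
    have split: "(\<Prod>j\<in>UNIV. F j) = F i * (\<Prod>j\<in>UNIV - {i}. F j)" for F :: "'n \<Rightarrow> real"
      by (rule prod.remove) auto
    have "((\<lambda>t. h i (x $ i + t) * (\<Prod>j\<in>UNIV - {i}. h j (x $ j))) has_real_derivative
      h' (x $ i) * (\<Prod>j\<in>UNIV - {i}. h j (x $ j))) (at 0)"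
      using DERIV_cmult_right[OF DERIV_shift[THEN iffD1, of "h i" "h' (x $ i)" 0 "x $ i"]] h'(2)[of "x $ i"]
      by (simp add: add.commute)
    moreover have "(\<Prod>j\<in>UNIV - {i}. h j ((x + t *\<^sub>R axis i 1) $ j)) = (\<Prod>j\<in>UNIV - {i}. h j (x $ j))" for t
      by (intro prod.cong) (auto simp: axis_def)
    moreover have "(\<Prod>j\<in>UNIV - {i}. ?h j (x $ j)) = (\<Prod>j\<in>UNIV - {i}. h j (x $ j))"
      by (intro prod.cong) auto
    ultimately show ?thesis by (subst (1 2) split) simp
  qed
  ultimately show ?case by (intro bexI allI)
next
  case (add f g)
  then obtain f' g' where "f' \<in> exp_span" "\<And>x. ((\<lambda>t. f (x + t *\<^sub>R axis i 1)) has_real_derivative f' x) (at 0)"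
    "g' \<in> exp_span" "\<And>x. ((\<lambda>t. g (x + t *\<^sub>R axis i 1)) has_real_derivative g' x) (at 0)" by auto
  then show ?case
    by (intro bexI[of _ "\<lambda>x. f' x + g' x"]) (auto intro: DERIV_add exp_span.add)
next
  case (scale f c)
  then obtain f' where "f' \<in> exp_span" "\<And>x. ((\<lambda>t. f (x + t *\<^sub>R axis i 1)) has_real_derivative f' x) (at 0)"
    by auto
  then show ?case
    by (intro bexI[of _ "\<lambda>x. c * f' x"]) (auto intro: DERIV_cmult exp_span.scale)
qed

lemma exp_span_partial_deriv:
  assumes "f \<in> exp_span"
  shows "partial_deriv i f \<in> exp_span"
proof -
  obtain f' where f': "f' \<in> exp_span" "\<And>x. ((\<lambda>t. f (x + t *\<^sub>R axis i 1)) has_real_derivative f' x) (at 0)"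
    using exp_span_directional_derivative[OF assms, of i] by auto
  then have "partial_deriv i f = f'"
    by (auto simp: partial_deriv_def fun_eq_iff intro: DERIV_imp_deriv)
  then show ?thesis using f'(1) by simp
qed

lemma exp_span_multi_deriv:
  assumes "f \<in> exp_span"
  shows "multi_deriv \<alpha> f \<in> exp_span"
proof -
  have 1: "(partial_deriv i ^^ k) g \<in> exp_span" if "g \<in> exp_span" for i k and g :: "real ^ 'a \<Rightarrow> real"
    by (induction k) (use that exp_span_partial_deriv in auto)
  have "foldr (\<lambda>i. partial_deriv i ^^ \<alpha> i) is f \<in> exp_span" for "is" :: "'a list"
    by (induction "is") (use assms 1 in auto)
  then show ?thesis by (simp add: multi_deriv_def)
qed

section \<open>Integrability, Sobolev seminorm and spectrum of the approximants\<close>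

lemma ennreal_root_less_top_iff: "ennreal_root p x < top \<longleftrightarrow> x < top"
  by (simp add: ennreal_root_def less_top)

lemma cart_weight_nn_integral: "(\<integral>\<^sup>+x. ennreal (cart_weight (x :: real ^ 'n)) \<partial>lborel) < \<infinity>"
proof -
  have "(\<integral>\<^sup>+x. ennreal (cart_weight (x :: real ^ 'n)) \<partial>lborel) = (\<integral>\<^sup>+x. ennreal (norm (cart_weight (x :: real ^ 'n))) \<partial>lborel)"
    by (intro nn_integral_cong) (simp add: cart_weight_nonneg)
  then show ?thesis using cart_weight_integrable by (simp add: integrable_iff_bounded)
qed

text \<open>The weight is at most 1, so its p-th power is at most itself; a single integrable weight
  serves every p \<ge> 1.\<close>

lemma powr_weight_le:
  assumes "\<bar>v\<bar> \<le> C * cart_weight x" "1 \<le> p"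
  shows "\<bar>v\<bar> powr p \<le> C powr p * cart_weight x"
proof -
  have C: "0 \<le> C" using order_trans[OF abs_ge_zero assms(1)] cart_weight_pos[of x] by (simp add: zero_le_mult_iff)
  have "\<bar>v\<bar> powr p \<le> (C * cart_weight x) powr p" using assms by (intro powr_mono2) auto
  also have "\<dots> = C powr p * cart_weight x powr p" by (rule powr_mult)
  also have "cart_weight x powr p \<le> cart_weight x powr 1"
    using assms(2) cart_weight_nonneg cart_weight_le_1 by (intro powr_mono') auto
  finally show ?thesis using cart_weight_pos[of x] by (simp add: mult_left_mono)
qed

lemma weight_bound_imp_Lp:
  fixes g :: "real ^ 'n \<Rightarrow> real"
  assumes "g \<in> borel_measurable borel" "1 \<le> p" "\<And>x. \<bar>g x\<bar> \<le> C * cart_weight x"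
  shows "g \<in> Lp p"
proof -
  have "(\<integral>\<^sup>+x. ennreal (\<bar>g x\<bar> powr p) \<partial>lborel) \<le> (\<integral>\<^sup>+x. ennreal (C powr p) * ennreal (cart_weight (x :: real ^ 'n)) \<partial>lborel)"
    using powr_weight_le[OF assms(3,2)]
    by (intro nn_integral_mono) (auto simp: cart_weight_nonneg simp flip: ennreal_mult intro: ennreal_leI)
  also have "\<dots> = ennreal (C powr p) * (\<integral>\<^sup>+x. ennreal (cart_weight (x :: real ^ 'n)) \<partial>lborel)"
    by (rule nn_integral_cmult) simp
  also have "\<dots> < \<infinity>" using cart_weight_nn_integral[where 'n = 'n] by (simp add: ennreal_mult_less_top)
  finally show ?thesis
    using assms(1) by (simp add: Lp_def Lp_norm_def ennreal_root_less_top_iff nn_integral_completion measurable_completion)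
qed

lemma exp_span_Lp:
  assumes "f \<in> exp_span" "1 \<le> p"
  shows "f \<in> Lp p"
  using exp_span_bound[OF assms(1)] weight_bound_imp_Lp[OF exp_span_borel_measurable[OF assms(1)] assms(2)] by auto

lemma exp_span_sobolev_finite:
  assumes "f \<in> exp_span" "1 \<le> p"
  shows "sobolev_seminorm p s f < \<infinity>"
proof -
  have "Lp_norm p (multi_deriv \<alpha> f) < \<infinity>" for \<alpha>
    using exp_span_Lp[OF exp_span_multi_deriv[OF assms(1)] assms(2)] by (simp add: Lp_def)
  then show ?thesis
    unfolding sobolev_seminorm_def
    \<comment> \<open>A sum over an infinite set is 0 by convention, so both cases give a finite
      value.\<close>
    by (cases "finite {\<alpha>::'a \<Rightarrow> nat. (\<Sum>i\<in>UNIV. \<alpha> i) = s}") (auto simp: ennreal_sum_less_top)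
qed

lemma exp_span_integrable_exp:
  fixes f :: "real ^ 'n \<Rightarrow> real"
  assumes "f \<in> exp_span"
  shows "integrable lebesgue (\<lambda>y. complex_of_real (f y) * exp (- 2 * complex_of_real pi * \<i> * complex_of_real (x \<bullet> y)))"
proof -
  obtain C where C: "0 \<le> C" "\<And>x. \<bar>f x\<bar> \<le> C * cart_weight x" using exp_span_bound[OF assms] by blast
  have m: "(\<lambda>y. complex_of_real (f y) * exp (- 2 * complex_of_real pi * \<i> * complex_of_real (x \<bullet> y))) \<in> borel_measurable borel"
    using exp_span_continuous[OF assms] by (intro borel_measurable_continuous_onI continuous_intros) auto
  have "integrable lborel (\<lambda>y. complex_of_real (f y) * exp (- 2 * complex_of_real pi * \<i> * complex_of_real (x \<bullet> y)))"
  proof (rule Bochner_Integration.integrable_bound[OF integrable_mult_right[OF cart_weight_integrable, of C]])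
    show "AE y in lborel. norm (complex_of_real (f y) * exp (- 2 * complex_of_real pi * \<i> * complex_of_real (x \<bullet> y))) \<le> norm (C * cart_weight y)"
      using C(1) by (auto simp: norm_mult norm_exp_eq_Re cart_weight_nonneg intro!: AE_I2 order_trans[OF C(2)])
  qed (use m in simp)
  then show ?thesis using m by (subst integrable_completion) auto
qed

text \<open>For a product the Fourier integral factorises, and one vanishing factor suffices. The
  sum of the nonnegative one-dimensional thresholds dominates each of them and hence works for
  whichever coordinate is large.\<close>

lemma exp_span_fourier:
  fixes f :: "real ^ 'n \<Rightarrow> real"
  assumes "f \<in> exp_span"
  shows "\<exists>\<tau>\<ge>0. \<forall>x. (\<exists>i. \<tau> < \<bar>x $ i\<bar>) \<longrightarrow> fourier f x = 0"
  using assms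
proof induction
  case (prod h)
  then have "\<forall>i. \<exists>\<tau>\<ge>0. \<forall>\<xi>. \<tau> \<le> \<bar>\<xi>\<bar> \<longrightarrow>
    (LINT t|lborel. complex_of_real (h i t) * exp (- 2 * complex_of_real pi * \<i> * complex_of_real (\<xi> * t))) = 0"
    using exp_type_fourier_vanishes by metis
  then obtain \<tau> where \<tau>: "\<And>i. 0 \<le> \<tau> i" "\<And>i \<xi>. \<tau> i \<le> \<bar>\<xi>\<bar> \<Longrightarrow>
    (LINT t|lborel. complex_of_real (h i t) * exp (- 2 * complex_of_real pi * \<i> * complex_of_real (\<xi> * t))) = 0"
    by metis
  have le: "\<tau> i \<le> (\<Sum>i\<in>UNIV. \<tau> i)" for i using \<tau>(1) by (intro member_le_sum) auto
  have "fourier (\<lambda>x. \<Prod>i\<in>UNIV. h i (x $ i)) x = 0" if i: "(\<Sum>i\<in>UNIV. \<tau> i) < \<bar>x $ i\<bar>" for x :: "real ^ 'n" and i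
  proof -
    let ?g = "\<lambda>i t. complex_of_real (h i t) * exp (- 2 * complex_of_real pi * \<i> * complex_of_real ((x $ i) * t))"
    have eq: "complex_of_real (\<Prod>i\<in>UNIV. h i (y $ i)) * exp (- 2 * complex_of_real pi * \<i> * complex_of_real (x \<bullet> y))
      = (\<Prod>i\<in>UNIV. ?g i (y $ i))" for y :: "real ^ 'n"
      by (simp only: prod.distrib exp_sum[symmetric] finite sum_distrib_left[symmetric] of_real_prod)
        (simp add: inner_vec_def)
    have m: "(\<lambda>y::real ^ 'n. \<Prod>i\<in>UNIV. ?g i (y $ i)) \<in> borel_measurable lborel"
      using integrable_cart_prod[of ?g, OF exp_type_integrable[OF prod]] by (rule borel_measurable_integrable)
    have "fourier (\<lambda>x. \<Prod>i\<in>UNIV. h i (x $ i)) x = (LINT y|lebesgue. (\<Prod>i\<in>UNIV. ?g i (y $ i)))"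
      unfolding fourier_def eq ..
    also have "\<dots> = (LINT y|lborel. (\<Prod>i\<in>UNIV. ?g i (y $ i)))"
      by (rule integral_completion[OF m])
    also have "\<dots> = (\<Prod>i\<in>UNIV. LINT t|lborel. ?g i t)"
      by (rule integral_cart_prod[OF exp_type_integrable[OF prod]])
    also have "\<dots> = 0"
      using \<tau>(2)[of i "x $ i"] le[of i] i by (intro prod_zero bexI[of _ i]) auto
    finally show ?thesis .
  qed
  then show ?case using \<tau>(1) by (intro exI[of _ "\<Sum>i\<in>UNIV. \<tau> i"]) (auto intro: sum_nonneg)
next
  case (add f g)
  then obtain \<tau>1 \<tau>2 where t: "0 \<le> \<tau>1" "\<And>(x :: real ^ 'n) i. \<tau>1 < \<bar>x $ i\<bar> \<Longrightarrow> fourier f x = 0"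
    and t2: "\<And>(x :: real ^ 'n) i. \<tau>2 < \<bar>x $ i\<bar> \<Longrightarrow> fourier g x = 0" by metis
  have "fourier (\<lambda>x. f x + g x) x = fourier f x + fourier g x" for x
    unfolding fourier_def using exp_span_integrable_exp[OF add.hyps(1)] exp_span_integrable_exp[OF add.hyps(2)]
    by (simp add: distrib_right)
  then show ?case using t t2 by (intro exI[of _ "max \<tau>1 \<tau>2"]) auto
next
  case (scale f c)
  then obtain \<tau> where "0 \<le> \<tau>" "\<And>(x :: real ^ 'n) i. \<tau> < \<bar>x $ i\<bar> \<Longrightarrow> fourier f x = 0" by auto
  moreover have "fourier (\<lambda>x. c * f x) x = c * fourier f x" for x
    unfolding fourier_def by (simp add: mult.assoc)
  ultimately show ?case by auto
qed

text \<open>The spectrum lies in a closed cube, so its closure does too, and in every larger cube.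
  Hence a fixed function is admissible in A3 for all large \<sigma>.\<close>

lemma exp_span_band_limited:
  fixes f :: "real ^ 'n \<Rightarrow> real"
  assumes "f \<in> exp_span" "1 \<le> p"
  obtains \<tau> where "\<And>\<sigma>. \<tau> \<le> \<sigma> \<Longrightarrow> f \<in> band_limited p \<sigma>"
proof -
  obtain \<tau> where \<tau>: "0 \<le> \<tau>" "\<And>(x :: real ^ 'n) i. \<tau> < \<bar>x $ i\<bar> \<Longrightarrow> fourier f x = 0"
    using exp_span_fourier[OF assms(1)] by blast
  have "f \<in> band_limited p \<sigma>" if "\<tau> \<le> \<sigma>" for \<sigma>
  proof -
    have "{x. fourier f x \<noteq> 0} \<subseteq> {x. \<forall>i. x $ i \<in> {-\<sigma>..\<sigma>}}"
    proof safe
      fix x i assume "fourier f x \<noteq> 0"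
      then have "\<bar>x $ i\<bar> \<le> \<tau>" using \<tau>(2) not_le by blast
      then show "x $ i \<in> {-\<sigma>..\<sigma>}" using that by auto
    qed
    moreover have "{x::real ^ 'n. \<forall>i. x $ i \<in> {-\<sigma>..\<sigma>}} = cbox (\<chi> i. - \<sigma>) (\<chi> i. \<sigma>)"
      by (auto simp: mem_box_cart)
    ultimately have "closure {x. fourier f x \<noteq> 0} \<subseteq> {x. \<forall>i. x $ i \<in> {-\<sigma>..\<sigma>}}"
      by (metis closed_cbox closure_minimal)
    then show ?thesis
      using exp_span_Lp[OF assms] exp_span_Lp[OF assms(1), of 1] exp_span_continuous[OF assms(1)]
      by (simp add: band_limited_def)
  qed
  then show thesis using that by blast
qed

section \<open>Density in the Lebesgue spaces\<close>

definition Lp_modular :: "real \<Rightarrow> (real ^ 'n \<Rightarrow> real) \<Rightarrow> ennreal" where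
  "Lp_modular p f = (\<integral>\<^sup>+x. ennreal (\<bar>f x\<bar> powr p) \<partial>lebesgue)"

lemma Lp_iff_modular: "f \<in> Lp p \<longleftrightarrow> f \<in> borel_measurable lebesgue \<and> Lp_modular p f < top"
  by (simp add: Lp_def Lp_norm_def Lp_modular_def ennreal_root_less_top_iff)

text \<open>From |a + b| \<le> 2 max (|a|, |b|); the resulting quasi-triangle constant is
  \<open>2 powr p\<close>.\<close>

lemma abs_add_powr_le:
  fixes a b :: real
  assumes "0 \<le> p"
  shows "\<bar>a + b\<bar> powr p \<le> 2 powr p * (\<bar>a\<bar> powr p + \<bar>b\<bar> powr p)"
proof -
  have "\<bar>a + b\<bar> powr p \<le> (2 * max \<bar>a\<bar> \<bar>b\<bar>) powr p"
    using assms by (intro powr_mono2) auto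
  also have "\<dots> = 2 powr p * max \<bar>a\<bar> \<bar>b\<bar> powr p" by (rule powr_mult)
  also have "\<dots> \<le> 2 powr p * (\<bar>a\<bar> powr p + \<bar>b\<bar> powr p)"
    by (intro mult_left_mono) (auto simp: max_def)
  finally show ?thesis .
qed

lemma ennreal_abs_add_powr_le:
  fixes a b :: real
  assumes "0 \<le> p"
  shows "ennreal (\<bar>a + b\<bar> powr p) \<le> ennreal (2 powr p) * (ennreal (\<bar>a\<bar> powr p) + ennreal (\<bar>b\<bar> powr p))"
  using abs_add_powr_le[OF assms, of a b] by (simp add: ennreal_leI flip: ennreal_mult ennreal_plus)

lemma Lp_modular_add_le:
  assumes "f \<in> borel_measurable lebesgue" "g \<in> borel_measurable lebesgue" "0 \<le> p"
  shows "Lp_modular p (\<lambda>x. f x + g x) \<le> ennreal (2 powr p) * (Lp_modular p f + Lp_modular p g)"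
proof -
  have "Lp_modular p (\<lambda>x. f x + g x) \<le> (\<integral>\<^sup>+x. ennreal (2 powr p) * (ennreal (\<bar>f x\<bar> powr p) + ennreal (\<bar>g x\<bar> powr p)) \<partial>lebesgue)"
    unfolding Lp_modular_def using ennreal_abs_add_powr_le[OF assms(3)] by (rule nn_integral_mono)
  also have "\<dots> = ennreal (2 powr p) * (Lp_modular p f + Lp_modular p g)"
    unfolding Lp_modular_def using assms(1,2)
    by (subst nn_integral_cmult) (auto simp: nn_integral_add)
  finally show ?thesis .
qed

lemma Lp_modular_scale: "f \<in> borel_measurable lebesgue \<Longrightarrow> Lp_modular p (\<lambda>x. c * f x) = ennreal (\<bar>c\<bar> powr p) * Lp_modular p f"
  unfolding Lp_modular_def
  by (subst nn_integral_cmult[symmetric]) (auto simp: abs_mult powr_mult ennreal_mult)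

lemma Lp_modular_minus_commute: "Lp_modular p (\<lambda>x. f x - g x) = Lp_modular p (\<lambda>x. g x - f x)"
  by (simp add: Lp_modular_def abs_minus_commute)

lemma Lp_modular_cong_AE: "AE x in lebesgue. f x = g x \<Longrightarrow> Lp_modular p f = Lp_modular p g"
  unfolding Lp_modular_def by (intro nn_integral_cong_AE) auto

lemma Lp_modular_mono: "(\<And>x. \<bar>f x\<bar> \<le> \<bar>g x\<bar>) \<Longrightarrow> 0 \<le> p \<Longrightarrow> Lp_modular p f \<le> Lp_modular p g"
  unfolding Lp_modular_def by (intro nn_integral_mono ennreal_leI powr_mono2) auto

text \<open>The bound passes to the limit almost everywhere, so the p-th power of
  \<open>2 * w\<close> dominates that of the error.\<close>

lemma Lp_modular_dominated_convergence:
  fixes f w :: "real ^ 'n \<Rightarrow> real"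
  assumes [measurable]: "f \<in> borel_measurable lebesgue" "\<And>n::nat. u n \<in> borel_measurable lebesgue" "w \<in> borel_measurable lebesgue"
    and p: "0 < p"
    and conv: "AE x in lebesgue. (\<lambda>n. u n x) \<longlonglongrightarrow> f x"
    and bound: "\<And>n. AE x in lebesgue. \<bar>u n x\<bar> \<le> w x"
    and w: "Lp_modular p w < top"
  shows "(\<lambda>n. Lp_modular p (\<lambda>x. f x - u n x)) \<longlonglongrightarrow> 0"
proof -
  have bound': "AE x in lebesgue. \<forall>n. \<bar>u n x\<bar> \<le> w x" using bound by (simp add: AE_all_countable)
  have "(\<lambda>n. \<integral>\<^sup>+x. ennreal (\<bar>f x - u n x\<bar> powr p) \<partial>lebesgue) \<longlonglongrightarrow> (\<integral>\<^sup>+x. 0 \<partial>(lebesgue :: (real ^ 'n) measure))"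
  proof (rule nn_integral_dominated_convergence[where w = "\<lambda>x. ennreal (\<bar>2 * w x\<bar> powr p)"])
    show "AE x in lebesgue. ennreal (\<bar>f x - u j x\<bar> powr p) \<le> ennreal (\<bar>2 * w x\<bar> powr p)" for j
      using conv bound'
    proof eventually_elim
      case (elim x)
      have "(\<lambda>n. \<bar>u n x\<bar>) \<longlonglongrightarrow> \<bar>f x\<bar>" using elim(1) by (rule tendsto_rabs)
      then have "\<bar>f x\<bar> \<le> w x" by (rule Lim_bounded) (use elim(2) in auto)
      then have "\<bar>f x - u j x\<bar> \<le> \<bar>2 * w x\<bar>" using elim(2)[rule_format, of j] by linarith
      then show ?case using p by (intro ennreal_leI powr_mono2) auto
    qed
    show "AE x in lebesgue. (\<lambda>n. ennreal (\<bar>f x - u n x\<bar> powr p)) \<longlonglongrightarrow> 0"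
      using conv
    proof eventually_elim
      case (elim x)
      have "(\<lambda>n. \<bar>f x - u n x\<bar>) \<longlonglongrightarrow> \<bar>f x - f x\<bar>"
        by (intro tendsto_intros elim)
      then have "(\<lambda>n. \<bar>f x - u n x\<bar> powr p) \<longlonglongrightarrow> 0 powr p"
        by (intro tendsto_powr') (use p in auto)
      then have "(\<lambda>n. ennreal (\<bar>f x - u n x\<bar> powr p)) \<longlonglongrightarrow> ennreal (0 powr p)"
        by (rule tendsto_ennrealI)
      then show ?case by simp
    qed
    show "(\<integral>\<^sup>+x. ennreal (\<bar>2 * w x\<bar> powr p) \<partial>lebesgue) < \<infinity>"
      using Lp_modular_scale[OF assms(3), of p 2] w by (simp add: Lp_modular_def ennreal_mult_less_top)
  qed measurable
  then show ?thesis by (simp add: Lp_modular_def)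
qed

section \<open>The L_p closure of the approximants\<close>

definition exp_approx :: "real \<Rightarrow> (real ^ 'n \<Rightarrow> real) \<Rightarrow> bool" where
  "exp_approx p f \<longleftrightarrow> f \<in> borel_measurable lebesgue \<and>
     (\<forall>e>0. \<exists>h\<in>exp_span. Lp_modular p (\<lambda>x. f x - h x) \<le> ennreal e)"

lemma exp_span_lebesgue_measurable:
  assumes "f \<in> exp_span"
  shows "f \<in> borel_measurable lebesgue"
  using exp_span_borel_measurable[OF assms] by (simp add: measurable_completion)

lemma exp_approx_exp_span: "h \<in> exp_span \<Longrightarrow> exp_approx p h"
  unfolding exp_approx_def by (auto intro!: bexI[of _ h] exp_span_lebesgue_measurable simp: Lp_modular_def)

lemma exp_approx_limit:
  fixes f :: "real ^ 'n \<Rightarrow> real"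
  assumes f: "f \<in> borel_measurable lebesgue" and u: "\<And>n::nat. exp_approx p (u n)" and p: "0 < p"
    and lim: "(\<lambda>n. Lp_modular p (\<lambda>x. f x - u n x)) \<longlonglongrightarrow> 0"
  shows "exp_approx p f"
  unfolding exp_approx_def
proof (intro conjI f allI impI)
  fix e :: real assume e: "0 < e"
  \<comment> \<open>Two errors of size \<open>d\<close>, multiplied by the quasi-triangle constant,
    add up to \<open>e\<close>.\<close>
  define d where "d = e / (2 * 2 powr p)"
  have d: "0 < d" using e by (simp add: d_def)
  obtain n where n: "Lp_modular p (\<lambda>x. f x - u n x) < ennreal d"
    using order_tendstoD(2)[OF lim, of "ennreal d"] d by (auto simp: eventually_sequentially)
  obtain h where h: "h \<in> exp_span" "Lp_modular p (\<lambda>x. u n x - h x) \<le> ennreal d"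
    using u[of n] d by (auto simp: exp_approx_def)
  have um: "u n \<in> borel_measurable lebesgue" using u by (simp add: exp_approx_def)
  have "Lp_modular p (\<lambda>x. f x - h x) = Lp_modular p (\<lambda>x. (f x - u n x) + (u n x - h x))" by simp
  also have "\<dots> \<le> ennreal (2 powr p) * (Lp_modular p (\<lambda>x. f x - u n x) + Lp_modular p (\<lambda>x. u n x - h x))"
    using f um exp_span_lebesgue_measurable[OF h(1)] p by (intro Lp_modular_add_le) auto
  also have "\<dots> \<le> ennreal (2 powr p) * (ennreal d + ennreal d)"
    using n h(2) by (intro mult_left_mono add_mono) auto
  also have "\<dots> = ennreal e" using d by (simp add: d_def flip: ennreal_mult ennreal_plus)
  finally show "\<exists>h\<in>exp_span. Lp_modular p (\<lambda>x. f x - h x) \<le> ennreal e" using h(1) by blast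
qed

lemma exp_approx_add:
  assumes f: "exp_approx p f" and g: "exp_approx p g" and p: "0 < p"
  shows "exp_approx p (\<lambda>x. f x + g x)"
  unfolding exp_approx_def
proof (intro conjI allI impI)
  have m: "f \<in> borel_measurable lebesgue" "g \<in> borel_measurable lebesgue"
    using f g by (auto simp: exp_approx_def)
  then show "(\<lambda>x. f x + g x) \<in> borel_measurable lebesgue" by simp
  fix e :: real assume e: "0 < e"
  define d where "d = e / (2 * 2 powr p)"
  have d: "0 < d" using e by (simp add: d_def)
  obtain h where h: "h \<in> exp_span" "Lp_modular p (\<lambda>x. f x - h x) \<le> ennreal d"
    using f d by (auto simp: exp_approx_def)
  obtain k where k: "k \<in> exp_span" "Lp_modular p (\<lambda>x. g x - k x) \<le> ennreal d"
    using g d by (auto simp: exp_approx_def)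
  have "Lp_modular p (\<lambda>x. (f x + g x) - (h x + k x)) = Lp_modular p (\<lambda>x. (f x - h x) + (g x - k x))"
    by (simp add: add_diff_add)
  also have "\<dots> \<le> ennreal (2 powr p) * (Lp_modular p (\<lambda>x. f x - h x) + Lp_modular p (\<lambda>x. g x - k x))"
    using m exp_span_lebesgue_measurable[OF h(1)] exp_span_lebesgue_measurable[OF k(1)] p
    by (intro Lp_modular_add_le) auto
  also have "\<dots> \<le> ennreal (2 powr p) * (ennreal d + ennreal d)"
    using h(2) k(2) by (intro mult_left_mono add_mono) auto
  also have "\<dots> = ennreal e" using d by (simp add: d_def flip: ennreal_mult ennreal_plus)
  finally show "\<exists>h\<in>exp_span. Lp_modular p (\<lambda>x. f x + g x - h x) \<le> ennreal e"
    using exp_span.add[OF h(1) k(1)] by (intro bexI[of _ "\<lambda>x. h x + k x"]) auto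
qed

lemma exp_approx_scale:
  assumes f: "exp_approx p f" and p: "0 < p"
  shows "exp_approx p (\<lambda>x. c * f x)"
  unfolding exp_approx_def
proof (intro conjI allI impI)
  have m: "f \<in> borel_measurable lebesgue" using f by (auto simp: exp_approx_def)
  then show "(\<lambda>x. c * f x) \<in> borel_measurable lebesgue" by simp
  fix e :: real assume e: "0 < e"
  \<comment> \<open>The summand 1 keeps the denominator positive when \<open>c = 0\<close>.\<close>
  define d where "d = e / (1 + \<bar>c\<bar> powr p)"
  have c1: "0 < 1 + \<bar>c\<bar> powr p" by (simp add: add_pos_nonneg)
  have d: "0 < d" using e c1 by (simp add: d_def)
  obtain h where h: "h \<in> exp_span" "Lp_modular p (\<lambda>x. f x - h x) \<le> ennreal d"
    using f d by (auto simp: exp_approx_def)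
  have "Lp_modular p (\<lambda>x. c * f x - c * h x) = ennreal (\<bar>c\<bar> powr p) * Lp_modular p (\<lambda>x. f x - h x)"
    using Lp_modular_scale[of "\<lambda>x. f x - h x" p c] m exp_span_lebesgue_measurable[OF h(1)]
    by (simp add: right_diff_distrib)
  also have "\<dots> \<le> ennreal (\<bar>c\<bar> powr p) * ennreal d" using h(2) by (intro mult_left_mono) auto
  also have "\<dots> = ennreal (\<bar>c\<bar> powr p * d)" by (simp add: ennreal_mult')
  also have "\<bar>c\<bar> powr p * d \<le> (1 + \<bar>c\<bar> powr p) * d" using d by simp
  also have "(1 + \<bar>c\<bar> powr p) * d = e" using c1 by (simp add: d_def)
  finally show "\<exists>h\<in>exp_span. Lp_modular p (\<lambda>x. c * f x - h x) \<le> ennreal e"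
    using exp_span.scale[OF h(1)] by (intro bexI[of _ "\<lambda>x. c * h x"]) (auto simp: ennreal_leI)
qed

lemma exp_approx_diff:
  assumes "exp_approx p f" "exp_approx p g" "0 < p"
  shows "exp_approx p (\<lambda>x. f x - g x)"
  using exp_approx_add[OF assms(1) exp_approx_scale[OF assms(2,3), of "-1"] assms(3)] by simp

lemma exp_approx_zero:
  assumes "0 < p"
  shows "exp_approx p (\<lambda>x::real ^ 'n. 0)"
proof -
  obtain h where "exp_type h" using exp_type_approx_indicator[of 0 1] by (metis zero_le_one)
  then have "(\<lambda>x::real ^ 'n. \<Prod>i\<in>UNIV. h (x $ i)) \<in> exp_span" by (rule exp_span.prod)
  from exp_approx_scale[OF exp_approx_exp_span[OF this] assms, of 0] show ?thesis by simp
qed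

lemma exp_approx_sum:
  fixes f :: "'i \<Rightarrow> real ^ 'n \<Rightarrow> real"
  assumes "finite I" "\<And>i. i \<in> I \<Longrightarrow> exp_approx p (f i)" "0 < p"
  shows "exp_approx p (\<lambda>x. \<Sum>i\<in>I. f i x)"
  using assms by (induction I) (auto intro: exp_approx_add exp_approx_zero)

lemma exp_approx_cong_AE:
  assumes "exp_approx p f" "AE x in lebesgue. f x = g x" "g \<in> borel_measurable lebesgue"
  shows "exp_approx p g"
proof -
  have "Lp_modular p (\<lambda>x. f x - h x) = Lp_modular p (\<lambda>x. g x - h x)" for h
    by (rule Lp_modular_cong_AE) (use assms(2) in auto)
  then show ?thesis using assms(1,3) by (simp add: exp_approx_def)
qed

lemma AE_lebesgue_coordinate_neq: "AE x in lebesgue. (x :: real ^ 'n) $ i \<noteq> c"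
proof -
  have "{x :: real ^ 'n. x $ i = c} \<in> null_sets lebesgue"
    using negligible_standard_hyperplane[of "axis i (1::real)" c] negligible_iff_null_sets
    by (auto simp: cart_eq_inner_axis axis_in_Basis_iff)
  from AE_not_in[OF this] show ?thesis by auto
qed

lemma indicator_lebesgue_measurable:
  fixes A :: "(real ^ 'n) set"
  assumes "A \<in> sets borel"
  shows "(indicator A :: real ^ 'n \<Rightarrow> real) \<in> borel_measurable lebesgue"
  using assms by (intro borel_measurable_indicator) simp

text \<open>Products of the one-dimensional approximants converge off the hyperplanes carrying the
  faces, a null set, and are dominated by a multiple of \<open>cart_weight\<close>.\<close>

lemma exp_approx_box:
  fixes a b :: "real ^ 'n"
  assumes p: "1 \<le> p"
  shows "exp_approx p (indicator (box a b))"
proof (cases "\<forall>i. a $ i \<le> b $ i")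
  case False
  then have "box a b = {}" unfolding interval_eq_empty_cart by (meson less_imp_le not_le)
  then have "indicator (box a b) = (\<lambda>x. 0 :: real)" by (auto simp: fun_eq_iff)
  then show ?thesis using p by (simp add: exp_approx_zero)
next
  case True
  have "\<forall>i. \<exists>h C. (\<forall>n::nat. exp_type (h n)) \<and> 0 \<le> C \<and> (\<forall>n t. \<bar>h n t\<bar> \<le> C / (1 + t\<^sup>2)) \<and>
    (\<forall>t. t \<noteq> a $ i \<longrightarrow> t \<noteq> b $ i \<longrightarrow> (\<lambda>n. h n t) \<longlonglongrightarrow> indicator {a $ i<..<b $ i} t)"
    using True exp_type_approx_indicator[of "a $ _" "b $ _"] by metis
  then obtain h C where h: "\<And>i (n::nat). exp_type (h i n)" "\<And>i. 0 \<le> C i"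
    "\<And>i n t. \<bar>h i n t\<bar> \<le> C i / (1 + t\<^sup>2)"
    "\<And>i t. t \<noteq> a $ i \<Longrightarrow> t \<noteq> b $ i \<Longrightarrow> (\<lambda>n. h i n t) \<longlonglongrightarrow> indicator {a $ i<..<b $ i} t"
    by metis
  define u where "u n x = (\<Prod>i\<in>UNIV. h i n (x $ i))" for n and x :: "real ^ 'n"
  have us: "u n \<in> exp_span" for n unfolding u_def[abs_def] using h(1) by (intro exp_span.prod)
  define w where "w x = (\<Prod>i\<in>UNIV. C i) * cart_weight x" for x :: "real ^ 'n"
  have wm: "w \<in> borel_measurable borel" unfolding w_def[abs_def] by measurable
  have w0: "0 \<le> w x" for x
    unfolding w_def using h(2) by (intro mult_nonneg_nonneg prod_nonneg cart_weight_nonneg) auto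
  show ?thesis
  proof (rule exp_approx_limit)
    show "(indicator (box a b) :: real ^ 'n \<Rightarrow> real) \<in> borel_measurable lebesgue" by (rule indicator_lebesgue_measurable) simp
    show "exp_approx p (u n)" for n by (rule exp_approx_exp_span[OF us])
    show "(\<lambda>n. Lp_modular p (\<lambda>x. indicator (box a b) x - u n x)) \<longlonglongrightarrow> 0"
    proof (rule Lp_modular_dominated_convergence)
      show "u n \<in> borel_measurable lebesgue" for n by (rule exp_span_lebesgue_measurable[OF us])
      show "w \<in> borel_measurable lebesgue" using wm by (simp add: measurable_completion)
      show "Lp_modular p w < top"
        using weight_bound_imp_Lp[OF wm p, of "\<Prod>i\<in>UNIV. C i"] w0 by (simp add: w_def Lp_iff_modular)
      have "\<bar>u n x\<bar> \<le> w x" for n x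
      proof -
        have "\<bar>u n x\<bar> = (\<Prod>i\<in>UNIV. \<bar>h i n (x $ i)\<bar>)" unfolding u_def by (rule abs_prod)
        also have "\<dots> \<le> (\<Prod>i\<in>UNIV. C i * (1 / (1 + (x $ i)\<^sup>2)))"
          using h(3) by (intro prod_mono) auto
        finally show ?thesis by (simp only: prod.distrib cart_weight_def w_def)
      qed
      then show "AE x in lebesgue. \<bar>u n x\<bar> \<le> w x" for n by simp
      have "AE x in lebesgue. \<forall>i. x $ i \<noteq> a $ i \<and> x $ i \<noteq> b $ i"
        by (simp add: AE_all_countable AE_lebesgue_coordinate_neq)
      then show "AE x in lebesgue. (\<lambda>n. u n x) \<longlonglongrightarrow> indicator (box a b) x"
      proof eventually_elim
        case (elim x)
        then have "(\<lambda>n. u n x) \<longlonglongrightarrow> (\<Prod>i\<in>UNIV. indicator {a $ i<..<b $ i} (x $ i))"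
          unfolding u_def by (intro tendsto_prod h(4)) auto
        also have "(\<Prod>i\<in>UNIV. indicator {a $ i<..<b $ i} (x $ i)) = (indicator (box a b) x :: real)"
        proof (cases "x \<in> box a b")
          case True
          then show ?thesis by (auto simp: mem_box_cart)
        next
          case False
          then obtain i where "\<not> (a $ i < x $ i \<and> x $ i < b $ i)" by (auto simp: mem_box_cart)
          then have "indicator {a $ i<..<b $ i} (x $ i) = (0 :: real)" by auto
          then show ?thesis using False by (auto intro!: prod_zero bexI[of _ i])
        qed
        finally show ?case .
      qed
    qed (use p in \<open>auto intro!: indicator_lebesgue_measurable\<close>)
  qed (use p in auto)
qed

lemma indicator_Lp_modular: "0 < p \<Longrightarrow> Lp_modular p (indicator A) = (\<integral>\<^sup>+x. indicator A x \<partial>lebesgue)"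
  unfolding Lp_modular_def by (intro nn_integral_cong) (auto simp: indicator_def)

text \<open>Dynkin's argument with the boxes as generating pi-system. Everything is cut down to one
  fixed box so that complements stay of finite measure and the indicator of the box dominates the
  partial sums of a disjoint union.\<close>

lemma exp_approx_borel_Int_box:
  fixes A :: "(real ^ 'n) set"
  assumes p: "1 \<le> p" and A: "A \<in> sets borel"
  shows "exp_approx p (indicator (A \<inter> box a b))"
proof -
  let ?G = "range (\<lambda>(a, b). box a b :: (real ^ 'n) set)"
  have "Int_stable ?G" by (auto simp: Int_stable_def box_Int_box)
  moreover have "?G \<subseteq> Pow UNIV" by simp
  moreover have "A \<in> sigma_sets UNIV ?G" using A by (simp add: borel_eq_box)
  ultimately show ?thesis
  proof (induction rule: sigma_sets_induct_disjoint)
    case (basic A)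
    then show ?case using exp_approx_box[OF p] by (auto simp: box_Int_box)
  next
    case empty
    have "indicator ({} \<inter> box a b) = (\<lambda>x. 0 :: real)" by (auto simp: fun_eq_iff)
    then show ?case using p by (simp add: exp_approx_zero)
  next
    case (compl A)
    have "indicator ((UNIV - A) \<inter> box a b) = (\<lambda>x. indicator (box a b) x - indicator (A \<inter> box a b) x :: real)"
      by (auto simp: indicator_def fun_eq_iff)
    then show ?case using exp_approx_diff[OF exp_approx_box[OF p] compl(2)] p by simp
  next
    case (union A)
    let ?C = "box a b"
    have Ab: "A i \<in> sets borel" for i using union(2) by (auto simp: borel_eq_box)
    have eq: "(\<Sum>i<n. indicator (A i \<inter> ?C) x) = (indicator ((\<Union>i<n. A i) \<inter> ?C) x :: real)" for n x
    proof -
      have "disjoint_family_on (\<lambda>i. A i \<inter> ?C) {..<n}"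
        using union(1) by (auto simp: disjoint_family_on_def)
      then show ?thesis by (subst indicator_UN_disjoint[symmetric]) auto
    qed
    show ?case
    proof (rule exp_approx_limit)
      show "exp_approx p (\<lambda>x. \<Sum>i<n. indicator (A i \<inter> ?C) x)" for n
        using union(3) p by (intro exp_approx_sum) auto
      show "(indicator ((\<Union>i. A i) \<inter> ?C) :: real ^ 'n \<Rightarrow> real) \<in> borel_measurable lebesgue" using Ab by (intro indicator_lebesgue_measurable) auto
      show "(\<lambda>n. Lp_modular p (\<lambda>x. indicator ((\<Union>i. A i) \<inter> ?C) x - (\<Sum>i<n. indicator (A i \<inter> ?C) x))) \<longlonglongrightarrow> 0"
      proof (rule Lp_modular_dominated_convergence[where w = "indicator ?C"])
        show "Lp_modular p (indicator ?C) < top"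
          using p emeasure_lborel_box_finite[of a b]
          by (simp add: indicator_Lp_modular nn_integral_completion)
        show "AE x in lebesgue. (\<lambda>n. \<Sum>i<n. indicator (A i \<inter> ?C) x) \<longlonglongrightarrow> (indicator ((\<Union>i. A i) \<inter> ?C) x :: real)"
        proof (rule AE_I2)
          fix x
          have "(\<lambda>n. indicator (\<Union>i<n. A i) x * indicator ?C x) \<longlonglongrightarrow> (indicator (\<Union>i. A i) x * indicator ?C x :: real)"
            by (intro tendsto_mult LIMSEQ_indicator_UN tendsto_const)
          then show "(\<lambda>n. \<Sum>i<n. indicator (A i \<inter> ?C) x) \<longlonglongrightarrow> (indicator ((\<Union>i. A i) \<inter> ?C) x :: real)"
            unfolding eq by (simp add: indicator_inter_arith)
        qed
        show "AE x in lebesgue. \<bar>\<Sum>i<n. indicator (A i \<inter> ?C) x\<bar> \<le> (indicator ?C x :: real)" for n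
          unfolding eq by (auto simp: indicator_def)
      qed (use p Ab in \<open>auto intro!: indicator_lebesgue_measurable borel_measurable_sum\<close>)
    qed (use p in auto)
  qed
qed

lemma exp_approx_borel_set:
  fixes A :: "(real ^ 'n) set"
  assumes p: "1 \<le> p" and A: "A \<in> sets borel" and fin: "Lp_modular p (indicator A) < top"
  shows "exp_approx p (indicator A)"
proof (rule exp_approx_limit)
  let ?C = "\<lambda>n::nat. box (\<chi> i. - real n) (\<chi> i. real n) :: (real ^ 'n) set"
  show "exp_approx p (indicator (A \<inter> ?C n))" for n
    by (rule exp_approx_borel_Int_box[OF p A])
  show "(\<lambda>n. Lp_modular p (\<lambda>x. indicator A x - indicator (A \<inter> ?C n) x)) \<longlonglongrightarrow> 0"
  proof (rule Lp_modular_dominated_convergence[where w = "indicator A"])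
    show "AE x in lebesgue. (\<lambda>n. indicator (A \<inter> ?C n) x) \<longlonglongrightarrow> (indicator A x :: real)"
    proof (rule AE_I2)
      fix x :: "real ^ 'n"
      obtain N where N: "norm x < real N" using reals_Archimedean2 by blast
      have "\<forall>\<^sub>F n in sequentially. indicator (A \<inter> ?C n) x = (indicator A x :: real)"
      proof (rule eventually_sequentiallyI[of N])
        fix n assume "N \<le> n"
        then have "\<bar>x $ i\<bar> < real n" for i
          using N component_le_norm_cart[of x i] by linarith
        then have "x \<in> ?C n" unfolding mem_box_cart by (auto simp: abs_less_iff minus_less_iff)
        then show "indicator (A \<inter> ?C n) x = (indicator A x :: real)" by (simp add: indicator_def)
      qed
      then show "(\<lambda>n. indicator (A \<inter> ?C n) x) \<longlonglongrightarrow> (indicator A x :: real)"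
        by (rule tendsto_eventually)
    qed
    show "AE x in lebesgue. \<bar>indicator (A \<inter> ?C n) x\<bar> \<le> (indicator A x :: real)" for n
      by (auto simp: indicator_def)
  qed (use p A fin in \<open>auto intro!: indicator_lebesgue_measurable\<close>)
qed (use p A in \<open>auto intro!: indicator_lebesgue_measurable\<close>)

text \<open>Induction over nonnegative measurable functions. Finiteness of the modular is part of
  the claim, so each case first passes it down to its constituents; in the limit case the limit
  itself is the dominating function.\<close>

lemma exp_approx_nonneg:
  fixes u :: "real ^ 'n \<Rightarrow> real"
  assumes p: "1 \<le> p" and "u \<in> borel_measurable lborel" "\<And>x. 0 \<le> u x" "Lp_modular p u < top"
  shows "exp_approx p u"
  using assms(2-)
proof (induction rule: borel_measurable_induct_real)
  case (set A)
  then show ?case using exp_approx_borel_set[OF p] by simp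
next
  case (mult u c)
  show ?case
  proof (cases "c = 0")
    case True
    then show ?thesis using p by (simp add: exp_approx_zero)
  next
    case False
    have "u = (\<lambda>x. (1 / c) * (c * u x))" using False by simp
    then have "Lp_modular p u = ennreal (\<bar>1 / c\<bar> powr p) * Lp_modular p (\<lambda>x. c * u x)"
      using Lp_modular_scale[of "\<lambda>x. c * u x" p "1 / c"] mult by (simp add: measurable_completion)
    then have "Lp_modular p u < top" using mult.prems by (simp add: ennreal_mult_less_top)
    then show ?thesis using mult p by (intro exp_approx_scale) auto
  qed
next
  case (add u v)
  have "Lp_modular p u \<le> Lp_modular p (\<lambda>x. v x + u x)" "Lp_modular p v \<le> Lp_modular p (\<lambda>x. v x + u x)"
    using add p by (auto intro!: Lp_modular_mono)
  then show ?case using add p by (intro exp_approx_add) auto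
next
  case (seq U)
  have le: "U i x \<le> u x" for i x
    using seq by (intro incseq_le) (auto simp: incseq_def le_fun_def)
  have u0: "0 \<le> u x" for x using seq(2) le order_trans by blast
  have "Lp_modular p (U i) \<le> Lp_modular p u" for i
    using le seq(2) p by (intro Lp_modular_mono) (auto simp: u0)
  then have ap: "exp_approx p (U i)" for i using seq by (meson le_less_trans)
  have um: "u \<in> borel_measurable lborel"
    by (rule borel_measurable_LIMSEQ_real[of _ U]) (use seq in auto)
  show ?case
  proof (rule exp_approx_limit[where u = U])
    show "(\<lambda>n. Lp_modular p (\<lambda>x. u x - U n x)) \<longlonglongrightarrow> 0"
      by (rule Lp_modular_dominated_convergence[where w = u])
        (use seq um p le in \<open>auto simp: measurable_completion\<close>)
  qed (use ap um p in \<open>auto simp: measurable_completion\<close>)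
qed

lemma exp_span_dense:
  fixes f :: "real ^ 'n \<Rightarrow> real"
  assumes p: "1 \<le> p" and f: "f \<in> Lp p" and e: "0 < e"
  obtains h where "h \<in> exp_span" "Lp_modular p (\<lambda>x. f x - h x) \<le> ennreal e"
proof -
  have fm: "f \<in> borel_measurable lebesgue" and fin: "Lp_modular p f < top"
    using f by (auto simp: Lp_iff_modular)
  \<comment> \<open>The approximation was built up from Borel sets, hence the passage to a Borel
    representative; the L_p distance does not see the change.\<close>
  obtain g where g: "g \<in> borel_measurable lborel" "AE x in lborel. f x = g x"
    using completion_ex_borel_measurable_real[OF fm] by auto
  have gf: "AE x in lebesgue. g x = f x" using AE_completion[OF g(2)] by auto
  have ging: "Lp_modular p g < top" using Lp_modular_cong_AE[OF gf, of p] fin by simp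
  have "Lp_modular p (\<lambda>x. max (g x) 0) \<le> Lp_modular p g" "Lp_modular p (\<lambda>x. max (- g x) 0) \<le> Lp_modular p g"
    using p by (auto intro!: Lp_modular_mono)
  then have "exp_approx p (\<lambda>x. max (g x) 0)" "exp_approx p (\<lambda>x. max (- g x) 0)"
    using g(1) p ging by (auto intro!: exp_approx_nonneg le_less_trans[OF _ ging])
  then have "exp_approx p (\<lambda>x. max (g x) 0 - max (- g x) 0)" using p by (intro exp_approx_diff) auto
  moreover have "(\<lambda>x. max (g x) 0 - max (- g x) 0) = g" by (auto simp: fun_eq_iff max_def)
  ultimately have "exp_approx p f" using exp_approx_cong_AE[OF _ gf fm] by simp
  then show thesis using e that by (auto simp: exp_approx_def)
qed

section \<open>Discrete norms and averages\<close>

definition lp_modular :: "real \<Rightarrow> real \<Rightarrow> (real ^ 'n) set \<Rightarrow> (real ^ 'n \<Rightarrow> real) \<Rightarrow> ennreal" where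
  "lp_modular p \<sigma> X f = ennreal (1 / \<sigma> ^ CARD('n)) * (\<Sum>\<^sub>\<infinity>\<xi>\<in>X. ennreal (\<bar>f \<xi>\<bar> powr p))"

lemma lp_iff_modular: "f \<in> lp p \<sigma> X \<longleftrightarrow> lp_modular p \<sigma> X f < top"
  by (simp add: lp_def lp_norm_def lp_modular_def ennreal_root_less_top_iff)

lemma summable_on_ennreal_valued [simp]: "(f :: 'a \<Rightarrow> ennreal) summable_on X"
  by (rule nonneg_summable_on_complete) simp

lemma infsum_cmult_ennreal:
  fixes f :: "'a \<Rightarrow> ennreal"
  shows "(\<Sum>\<^sub>\<infinity>x\<in>X. c * f x) = c * (\<Sum>\<^sub>\<infinity>x\<in>X. f x)"
  by (simp add: nonneg_infsum_complete SUP_mult_left_ennreal sum_distrib_left)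

text \<open>In \<open>ennreal\<close> an unordered sum is the supremum of its finite partial sums,
  so all sampling estimates reduce to finite sets of points.\<close>

lemma infsum_le_ennreal:
  fixes f :: "'a \<Rightarrow> ennreal"
  assumes "\<And>F. finite F \<Longrightarrow> F \<subseteq> X \<Longrightarrow> c * sum f F \<le> b"
  shows "c * (\<Sum>\<^sub>\<infinity>x\<in>X. f x) \<le> b"
  unfolding infsum_cmult_ennreal[symmetric]
  by (rule infsum_le_finite_sums) (use assms in \<open>auto simp: sum_distrib_left\<close>)

lemma lp_modular_cong: "(\<And>\<xi>. \<xi> \<in> X \<Longrightarrow> \<bar>f \<xi>\<bar> = \<bar>g \<xi>\<bar>) \<Longrightarrow> lp_modular p \<sigma> X f = lp_modular p \<sigma> X g"
  unfolding lp_modular_def by (simp cong: infsum_cong)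

lemma lp_modular_scale: "lp_modular p \<sigma> X (\<lambda>\<xi>. c * f \<xi>) = ennreal (\<bar>c\<bar> powr p) * lp_modular p \<sigma> X f"
  by (simp add: lp_modular_def abs_mult powr_mult ennreal_mult infsum_cmult_ennreal mult.left_commute)

lemma lp_modular_add_le:
  assumes "0 \<le> p"
  shows "lp_modular p \<sigma> X (\<lambda>\<xi>. f \<xi> + g \<xi>) \<le> ennreal (2 powr p) * (lp_modular p \<sigma> X f + lp_modular p \<sigma> X g)"
proof -
  let ?c = "ennreal (1 / \<sigma> ^ CARD('a))"
  have "lp_modular p \<sigma> X (\<lambda>\<xi>. f \<xi> + g \<xi>)
    \<le> ?c * (\<Sum>\<^sub>\<infinity>\<xi>\<in>X. ennreal (2 powr p) * (ennreal (\<bar>f \<xi>\<bar> powr p) + ennreal (\<bar>g \<xi>\<bar> powr p)))"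
    unfolding lp_modular_def using ennreal_abs_add_powr_le[OF assms]
    by (intro mult_left_mono infsum_mono) auto
  also have "\<dots> = ennreal (2 powr p) * (lp_modular p \<sigma> X f + lp_modular p \<sigma> X g)"
    by (simp add: lp_modular_def infsum_cmult_ennreal infsum_add distrib_left mult.left_commute)
  finally show ?thesis .
qed

lemma lp_modular_zero: "lp_modular p \<sigma> X (\<lambda>\<xi>. 0) = 0"
  by (simp add: lp_modular_def)


section \<open>Sampling sums estimated by integrals over disjoint balls\<close>

lemma sum_nn_integral_balls_le:
  fixes g :: "real ^ 'n \<Rightarrow> ennreal"
  assumes g: "g \<in> borel_measurable lebesgue" and F: "finite F"
    and sep: "pairwise (\<lambda>\<xi> \<xi>'. dist \<xi> \<xi>' > 2 * \<delta>) F" and \<delta>: "\<delta>' \<le> \<delta>"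
  shows "(\<Sum>\<xi>\<in>F. \<integral>\<^sup>+x. g x * indicator (ball \<xi> \<delta>') x \<partial>lebesgue) \<le> (\<integral>\<^sup>+x. g x \<partial>lebesgue)"
proof -
  have "disjoint_family_on (\<lambda>\<xi>. ball \<xi> \<delta>') F"
    unfolding disjoint_family_on_def
  proof safe
    fix \<xi> \<eta> x assume *: "\<xi> \<in> F" "\<eta> \<in> F" "\<xi> \<noteq> \<eta>" "x \<in> ball \<xi> \<delta>'" "x \<in> ball \<eta> \<delta>'"
    then have "2 * \<delta> < dist \<xi> \<eta>" using sep by (simp add: pairwise_def)
    moreover have "dist \<xi> \<eta> < 2 * \<delta>'"
      using *(4,5) dist_triangle[of \<xi> \<eta> x] by (simp add: dist_commute)
    ultimately show "x \<in> {}" using \<delta> by linarith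
  qed
  then have 1: "(\<Sum>\<xi>\<in>F. indicator (ball \<xi> \<delta>') x) \<le> (1::ennreal)" for x
    by (subst indicator_UN_disjoint[OF F, symmetric]) (auto simp: indicator_def)
  have "(\<Sum>\<xi>\<in>F. \<integral>\<^sup>+x. g x * indicator (ball \<xi> \<delta>') x \<partial>lebesgue) = (\<integral>\<^sup>+x. (\<Sum>\<xi>\<in>F. g x * indicator (ball \<xi> \<delta>') x) \<partial>lebesgue)"
    using g by (intro nn_integral_sum[symmetric]) (auto intro!: borel_measurable_times_ennreal borel_measurable_indicator)
  also have "\<dots> \<le> (\<integral>\<^sup>+x. g x \<partial>lebesgue)"
  proof (rule nn_integral_mono)
    show "(\<Sum>\<xi>\<in>F. g x * indicator (ball \<xi> \<delta>') x) \<le> g x" for x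
      using mult_left_mono[OF 1[of x], of "g x"] by (simp add: sum_distrib_left)
  qed
  finally show ?thesis .
qed

lemma emeasure_lborel_ball_neq_top [simp]: "emeasure lborel (ball x \<delta>) \<noteq> top"
  using emeasure_bounded_finite[OF bounded_ball, of x \<delta>] by simp

text \<open>Local integrability follows from |g| \<le> 1 + |g|^p on a ball, which has finite
  measure.\<close>

lemma Lp_set_integrable_ball:
  fixes g :: "real ^ 'n \<Rightarrow> real"
  assumes p: "1 \<le> p" and g: "g \<in> Lp p"
  shows "integrable lebesgue (\<lambda>y. \<bar>g y\<bar> powr p)" "set_integrable lebesgue (ball x \<delta>) g"
proof -
  have m[measurable]: "g \<in> borel_measurable lebesgue" and fin: "Lp_modular p g < top"
    using g by (auto simp: Lp_iff_modular)
  show int: "integrable lebesgue (\<lambda>y. \<bar>g y\<bar> powr p)"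
    using fin by (intro integrableI_bounded) (auto simp: Lp_modular_def)
  have "integrable lebesgue (\<lambda>y. indicator (ball x \<delta>) y + \<bar>g y\<bar> powr p)"
    by (intro Bochner_Integration.integrable_add int) (auto simp: integrable_indicator_iff less_top[symmetric])
  then show "set_integrable lebesgue (ball x \<delta>) g"
    unfolding set_integrable_def
  proof (rule Bochner_Integration.integrable_bound)
    show "(\<lambda>y. indicator (ball x \<delta>) y *\<^sub>R g y) \<in> borel_measurable lebesgue"
      by (intro borel_measurable_scaleR borel_measurable_indicator m) auto
    have "\<bar>g y\<bar> \<le> 1 + \<bar>g y\<bar> powr p" for y
    proof (cases "\<bar>g y\<bar> \<le> 1")
      case False
      then have "\<bar>g y\<bar> powr 1 \<le> \<bar>g y\<bar> powr p" using p by (intro powr_mono) auto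
      then show ?thesis using False by simp
    qed (simp add: add_increasing2)
    then show "AE y in lebesgue. norm (indicator (ball x \<delta>) y *\<^sub>R g y) \<le> norm (indicator (ball x \<delta>) y + \<bar>g y\<bar> powr p)"
      by (intro AE_I2) (auto simp: indicator_def)
  qed
qed

text \<open>Jensen's inequality up to a constant: Markov's inequality suffices, since the part of the
  integrand below half of the mean contributes at most half of the mean.\<close>

lemma ball_average_powr_le:
  fixes g :: "real ^ 'n \<Rightarrow> real"
  assumes p: "1 \<le> p" and g: "g \<in> Lp p" and \<delta>: "0 < \<delta>"
  shows "\<bar>ball_average \<delta> g x\<bar> powr p \<le> 2 powr p / measure lebesgue (ball (0 :: real ^ 'n) \<delta>) * (LINT y:ball x \<delta>|lebesgue. \<bar>g y\<bar> powr p)"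
proof -
  let ?B = "ball x \<delta>"
  define V where "V = measure lebesgue (ball (0 :: real ^ 'n) \<delta>)"
  have V: "0 < V" "measure lebesgue ?B = V" using \<delta> by (simp_all add: V_def content_ball)
  note int = Lp_set_integrable_ball[OF p g]
  have int1: "set_integrable lebesgue ?B (\<lambda>y. \<bar>g y\<bar>)" using int(2) by (rule set_integrable_abs)
  have int2: "set_integrable lebesgue ?B (\<lambda>y. \<bar>g y\<bar> powr p)"
    unfolding set_integrable_def using int(1) by (rule integrable_mult_indicator[rotated]) simp
  define J where "J = (LINT y:?B|lebesgue. \<bar>g y\<bar> powr p)"
  define m where "m = (LINT y:?B|lebesgue. \<bar>g y\<bar>) / V"
  have avg: "\<bar>ball_average \<delta> g x\<bar> \<le> m"
  proof -
    have "\<bar>LINT y:?B|lebesgue. g y\<bar> \<le> (LINT y:?B|lebesgue. \<bar>g y\<bar>)"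
      using set_integral_norm_bound[OF int(2)[of x \<delta>]] by simp
    then show ?thesis using V(1) by (simp add: ball_average_def m_def V_def[symmetric] abs_mult divide_right_mono)
  qed
  have J0: "0 \<le> J" unfolding J_def set_lebesgue_integral_def by (intro integral_nonneg_AE) (auto simp: indicator_def)
  have "m powr p \<le> 2 powr p / V * J"
  proof (cases "0 < m")
    case False
    then have "m = 0" using avg by linarith
    then show ?thesis using J0 V(1) by simp
  next
    case True
    \<comment> \<open>Chosen so that \<open>c * \<bar>g y\<bar> powr p\<close> is |g y| times (2 |g
      y| / m)^(p - 1), a factor of at least 1 wherever |g y| exceeds m/2.\<close>
    define c where "c = 2 powr (p - 1) * m powr (1 - p)"
    have pw: "\<bar>g y\<bar> \<le> m / 2 + c * \<bar>g y\<bar> powr p" for y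
    proof (cases "\<bar>g y\<bar> \<le> m / 2")
      case True
      then show ?thesis by (simp add: c_def add_increasing2)
    next
      case False
      define a where "a = \<bar>g y\<bar>"
      have a: "m / 2 < a" "0 < a" using False True by (auto simp: a_def)
      have "1 = (2 * a / m) powr 0" using a True by simp
      also have "\<dots> \<le> (2 * a / m) powr (p - 1)" using a True p by (intro powr_mono) (auto simp: field_simps)
      finally have "a * 1 \<le> a * (2 * a / m) powr (p - 1)" using a by (intro mult_left_mono) auto
      also have "(2 * a / m) powr (p - 1) = 2 powr (p - 1) * a powr (p - 1) / m powr (p - 1)"
        using a True by (simp add: powr_mult powr_divide)
      also have "\<dots> = 2 powr (p - 1) * a powr (p - 1) * m powr (1 - p)"
        using powr_minus[of m "p - 1"] by (simp add: divide_inverse)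
      also have "a * (2 powr (p - 1) * a powr (p - 1) * m powr (1 - p)) = c * a powr p"
        using a powr_add[of a 1 "p - 1"] by (simp add: c_def)
      finally show ?thesis using True by (simp add: a_def)
    qed
    have "V * m = (LINT y:?B|lebesgue. \<bar>g y\<bar>)" using V by (simp add: m_def)
    also have "\<dots> \<le> (LINT y:?B|lebesgue. m / 2 + c * \<bar>g y\<bar> powr p)"
      using pw by (intro set_integral_mono int1 set_integral_add set_integrable_mult_right int2)
        (auto simp: set_integrable_def integrable_indicator_iff less_top[symmetric])
    also have "\<dots> = V * m / 2 + c * J"
    proof -
      have "set_integrable lebesgue ?B (\<lambda>y. m / 2)"
        unfolding set_integrable_def by (simp add: integrable_indicator_iff less_top[symmetric])
      moreover have "(LINT y:?B|lebesgue. m / 2) = V * m / 2"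
        using V(2) by (subst set_integral_const) (auto simp: less_top[symmetric])
      ultimately show ?thesis using int2 by (subst set_integral_add) (auto simp: J_def)
    qed
    finally have "V * m \<le> 2 * c * J" by simp
    then have "V * m * m powr (p - 1) \<le> 2 * c * J * m powr (p - 1)" by (intro mult_right_mono) auto
    also have "V * m * m powr (p - 1) = V * m powr p" using True powr_add[of m 1 "p - 1"] by simp
    also have "2 * c * J * m powr (p - 1) = 2 * 2 powr (p - 1) * J * (m powr (1 - p) * m powr (p - 1))"
      by (simp add: c_def)
    also have "m powr (1 - p) * m powr (p - 1) = 1" using True by (simp flip: powr_add)
    also have "2 * 2 powr (p - 1) * J * 1 = 2 powr p * J" using powr_add[of 2 1 "p - 1"] by simp
    finally show ?thesis using V(1) by (simp add: field_simps)
  qed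
  moreover have "\<bar>ball_average \<delta> g x\<bar> powr p \<le> m powr p" using avg p by (intro powr_mono2) auto
  ultimately show ?thesis by (simp add: V_def J_def)
qed

text \<open>The local bound is summed over disjoint balls. The normalisation \<sigma>^(-d) meets the
  volume of a ball of radius \<delta>, so the constant depends on \<sigma> only through
  \<open>\<sigma> * \<delta>\<close>.\<close>

lemma lp_modular_ball_average_le:
  fixes g :: "real ^ 'n \<Rightarrow> real"
  assumes p: "1 \<le> p" and g: "g \<in> Lp p" and \<delta>: "0 < \<delta>" "\<delta> \<le> \<gamma> / \<sigma>" and \<sigma>: "0 < \<sigma>"
    and sep: "pairwise (\<lambda>\<xi> \<xi>'. dist \<xi> \<xi>' > 2 * \<gamma> / \<sigma>) X"
  shows "lp_modular p \<sigma> X (ball_average \<delta> g)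
    \<le> ennreal (2 powr p / (unit_ball_vol (real CARD('n)) * (\<sigma> * \<delta>) ^ CARD('n))) * Lp_modular p g"
  unfolding lp_modular_def
proof (rule infsum_le_ennreal)
  fix F assume F: "finite F" "F \<subseteq> X"
  let ?V = "measure lebesgue (ball (0 :: real ^ 'n) \<delta>)"
  have V: "0 < ?V" using \<delta> by (simp add: content_ball)
  have sepF: "pairwise (\<lambda>\<xi> \<xi>'. dist \<xi> \<xi>' > 2 * (\<gamma> / \<sigma>)) F"
    using pairwise_subset[OF sep F(2)] by simp
  have gm: "g \<in> borel_measurable lebesgue" using g by (simp add: Lp_iff_modular)
  have 1: "ennreal (\<bar>ball_average \<delta> g \<xi>\<bar> powr p) \<le> ennreal (2 powr p / ?V) * (\<integral>\<^sup>+y. ennreal (\<bar>g y\<bar> powr p) * indicator (ball \<xi> \<delta>) y \<partial>lebesgue)" for \<xi>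
  proof -
    have "set_integrable lebesgue (ball \<xi> \<delta>) (\<lambda>y. \<bar>g y\<bar> powr p)"
      unfolding set_integrable_def using Lp_set_integrable_ball(1)[OF p g]
      by (rule integrable_mult_indicator[rotated]) simp
    then have "(\<integral>\<^sup>+y. ennreal (indicator (ball \<xi> \<delta>) y *\<^sub>R (\<bar>g y\<bar> powr p)) \<partial>lebesgue) = ennreal (LINT y:ball \<xi> \<delta>|lebesgue. \<bar>g y\<bar> powr p)"
      unfolding set_integrable_def set_lebesgue_integral_def
      by (intro nn_integral_eq_integral) auto
    moreover have "(\<integral>\<^sup>+y. ennreal (indicator (ball \<xi> \<delta>) y *\<^sub>R (\<bar>g y\<bar> powr p)) \<partial>lebesgue)
      = (\<integral>\<^sup>+y. ennreal (\<bar>g y\<bar> powr p) * indicator (ball \<xi> \<delta>) y \<partial>lebesgue)"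
      by (intro nn_integral_cong) (auto simp: indicator_def)
    ultimately have eq: "ennreal (LINT y:ball \<xi> \<delta>|lebesgue. \<bar>g y\<bar> powr p) = (\<integral>\<^sup>+y. ennreal (\<bar>g y\<bar> powr p) * indicator (ball \<xi> \<delta>) y \<partial>lebesgue)"
      by simp
    have V0: "0 \<le> 2 powr p / ?V" using V by simp
    show ?thesis
      using ennreal_leI[OF ball_average_powr_le[OF p g \<delta>(1), of \<xi>]] unfolding ennreal_mult'[OF V0] eq .
  qed
  have "(\<Sum>\<xi>\<in>F. ennreal (\<bar>ball_average \<delta> g \<xi>\<bar> powr p))
    \<le> (\<Sum>\<xi>\<in>F. ennreal (2 powr p / ?V) * (\<integral>\<^sup>+y. ennreal (\<bar>g y\<bar> powr p) * indicator (ball \<xi> \<delta>) y \<partial>lebesgue))"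
    using 1 by (intro sum_mono)
  also have "\<dots> \<le> ennreal (2 powr p / ?V) * Lp_modular p g"
    unfolding sum_distrib_left[symmetric] Lp_modular_def
    using gm by (intro mult_left_mono sum_nn_integral_balls_le[OF _ F(1) sepF \<delta>(2)]) auto
  finally have "ennreal (1 / \<sigma> ^ CARD('n)) * (\<Sum>\<xi>\<in>F. ennreal (\<bar>ball_average \<delta> g \<xi>\<bar> powr p))
    \<le> ennreal (1 / \<sigma> ^ CARD('n)) * (ennreal (2 powr p / ?V) * Lp_modular p g)"
    by (rule mult_left_mono) simp
  also have "\<dots> = ennreal (1 / \<sigma> ^ CARD('n) * (2 powr p / ?V)) * Lp_modular p g"
    using \<sigma> V by (simp add: mult.assoc[symmetric] flip: ennreal_mult)
  also have "1 / \<sigma> ^ CARD('n) * (2 powr p / ?V) = 2 powr p / (unit_ball_vol (real CARD('n)) * (\<sigma> * \<delta>) ^ CARD('n))"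
    using \<delta>(1) by (simp add: content_ball power_mult_distrib mult_ac)
  finally show "ennreal (1 / \<sigma> ^ CARD('n)) * (\<Sum>\<xi>\<in>F. ennreal (\<bar>ball_average \<delta> g \<xi>\<bar> powr p))
    \<le> ennreal (2 powr p / (unit_ball_vol (real CARD('n)) * (\<sigma> * \<delta>) ^ CARD('n))) * Lp_modular p g" .
qed

text \<open>The weight at a point is at most 4^d times its average over the ball of radius
  \<open>\<gamma> / \<sigma>\<close>, whose radius is at most 1 because \<gamma> \<le> \<sigma>.
  Summing over disjoint balls gives the full integral, and the powers of \<sigma> cancel, so the
  bound is uniform in \<sigma>.\<close>

lemma lp_modular_weight_le:
  fixes g :: "real ^ 'n \<Rightarrow> real"
  assumes p: "1 \<le> p" and \<gamma>: "0 < \<gamma>" and \<sigma>: "\<gamma> \<le> \<sigma>"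
    and sep: "pairwise (\<lambda>\<xi> \<xi>'. dist \<xi> \<xi>' > 2 * \<gamma> / \<sigma>) X"
    and g: "\<And>x. \<bar>g x\<bar> \<le> C * cart_weight x"
  shows "lp_modular p \<sigma> X g
    \<le> ennreal (C powr p) * (ennreal (4 ^ CARD('n) / (unit_ball_vol (real CARD('n)) * \<gamma> ^ CARD('n))) * (\<integral>\<^sup>+x. ennreal (cart_weight (x :: real ^ 'n)) \<partial>lborel))"
  unfolding lp_modular_def
proof (rule infsum_le_ennreal)
  fix F assume F: "finite F" "F \<subseteq> X"
  define \<delta> where "\<delta> = \<gamma> / \<sigma>"
  have \<sigma>0: "0 < \<sigma>" using \<gamma> \<sigma> by simp
  have \<delta>: "0 < \<delta>" "\<delta> \<le> 1" using \<gamma> \<sigma> \<sigma>0 by (auto simp: \<delta>_def)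
  define V where "V = measure lebesgue (ball (0 :: real ^ 'n) \<delta>)"
  have V: "0 < V" "V = unit_ball_vol (real CARD('n)) * \<delta> ^ CARD('n)"
    using \<delta> by (simp_all add: V_def content_ball)
  have sepF: "pairwise (\<lambda>\<xi> \<xi>'. dist \<xi> \<xi>' > 2 * \<delta>) F"
    using pairwise_subset[OF sep F(2)] by (simp add: \<delta>_def)
  have 1: "ennreal (cart_weight \<xi>) \<le> ennreal (4 ^ CARD('n) / V) * (\<integral>\<^sup>+x. ennreal (cart_weight x) * indicator (ball \<xi> \<delta>) x \<partial>lebesgue)" for \<xi> :: "real ^ 'n"
  proof -
    have "ennreal (cart_weight \<xi>) * ennreal V = (\<integral>\<^sup>+x. ennreal (cart_weight \<xi>) * indicator (ball \<xi> \<delta>) x \<partial>lebesgue)"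
      using \<delta> V(2) content_ball[of \<delta> \<xi>] by (simp add: nn_integral_cmult_indicator emeasure_eq_ennreal_measure less_top[symmetric])
    also have "\<dots> \<le> (\<integral>\<^sup>+x. ennreal (4 ^ CARD('n)) * (ennreal (cart_weight x) * indicator (ball \<xi> \<delta>) x) \<partial>lebesgue)"
    proof (rule nn_integral_mono)
      fix x
      have "dist \<xi> x < \<delta> \<Longrightarrow> cart_weight \<xi> \<le> 4 ^ CARD('n) * cart_weight x"
        using cart_weight_near[of \<xi> x] \<delta>(2) by linarith
      then show "ennreal (cart_weight \<xi>) * indicator (ball \<xi> \<delta>) x \<le> ennreal (4 ^ CARD('n)) * (ennreal (cart_weight x) * indicator (ball \<xi> \<delta>) x)"
        by (auto simp: indicator_def ennreal_leI cart_weight_nonneg simp flip: ennreal_mult)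
    qed
    also have "\<dots> = ennreal (4 ^ CARD('n)) * (\<integral>\<^sup>+x. ennreal (cart_weight x) * indicator (ball \<xi> \<delta>) x \<partial>lebesgue)"
      by (intro nn_integral_cmult borel_measurable_times_ennreal borel_measurable_indicator)
        (auto intro!: measurable_compose[OF _ measurable_ennreal] simp: measurable_completion)
    finally have "ennreal (1 / V) * (ennreal (cart_weight \<xi>) * ennreal V) \<le> ennreal (1 / V) * (ennreal (4 ^ CARD('n)) * (\<integral>\<^sup>+x. ennreal (cart_weight x) * indicator (ball \<xi> \<delta>) x \<partial>lebesgue))"
      by (rule mult_left_mono) simp
    then show ?thesis using V(1) by (simp add: mult.assoc[symmetric] cart_weight_nonneg flip: ennreal_mult)
  qed
  have "(\<Sum>\<xi>\<in>F. ennreal (\<bar>g \<xi>\<bar> powr p)) \<le> (\<Sum>\<xi>\<in>F. ennreal (C powr p) * (ennreal (4 ^ CARD('n) / V) * (\<integral>\<^sup>+x. ennreal (cart_weight x) * indicator (ball \<xi> \<delta>) x \<partial>lebesgue)))"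
  proof (rule sum_mono)
    fix \<xi>
    have "ennreal (\<bar>g \<xi>\<bar> powr p) \<le> ennreal (C powr p) * ennreal (cart_weight \<xi>)"
      using powr_weight_le[OF g p, of \<xi>] by (simp add: ennreal_leI cart_weight_nonneg flip: ennreal_mult)
    also have "\<dots> \<le> ennreal (C powr p) * (ennreal (4 ^ CARD('n) / V) * (\<integral>\<^sup>+x. ennreal (cart_weight x) * indicator (ball \<xi> \<delta>) x \<partial>lebesgue))"
      using 1 by (rule mult_left_mono) simp
    finally show "ennreal (\<bar>g \<xi>\<bar> powr p) \<le> \<dots>" .
  qed
  also have "\<dots> \<le> ennreal (C powr p) * (ennreal (4 ^ CARD('n) / V) * (\<integral>\<^sup>+x. ennreal (cart_weight (x :: real ^ 'n)) \<partial>lebesgue))"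
    unfolding sum_distrib_left[symmetric]
    by (intro mult_left_mono sum_nn_integral_balls_le[OF _ F(1) sepF order_refl])
      (auto intro!: measurable_compose[OF _ measurable_ennreal] simp: measurable_completion)
  finally have "ennreal (1 / \<sigma> ^ CARD('n)) * (\<Sum>\<xi>\<in>F. ennreal (\<bar>g \<xi>\<bar> powr p))
    \<le> ennreal (1 / \<sigma> ^ CARD('n)) * (ennreal (C powr p) * (ennreal (4 ^ CARD('n) / V) * (\<integral>\<^sup>+x. ennreal (cart_weight (x :: real ^ 'n)) \<partial>lborel)))"
    unfolding nn_integral_completion by (rule mult_left_mono) simp
  also have "\<dots> = ennreal (C powr p) * (ennreal (1 / \<sigma> ^ CARD('n) * (4 ^ CARD('n) / V)) * (\<integral>\<^sup>+x. ennreal (cart_weight (x :: real ^ 'n)) \<partial>lborel))"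
  proof -
    have "ennreal (1 / \<sigma> ^ CARD('n) * (4 ^ CARD('n) / V)) = ennreal (1 / \<sigma> ^ CARD('n)) * ennreal (4 ^ CARD('n) / V)"
      using \<sigma>0 V(1) by (intro ennreal_mult) auto
    then show ?thesis by (simp only: mult_ac)
  qed
  also have "1 / \<sigma> ^ CARD('n) * (4 ^ CARD('n) / V) = 4 ^ CARD('n) / (unit_ball_vol (real CARD('n)) * \<gamma> ^ CARD('n))"
    using \<sigma>0 by (simp add: V(2) \<delta>_def power_divide)
  finally show "ennreal (1 / \<sigma> ^ CARD('n)) * (\<Sum>\<xi>\<in>F. ennreal (\<bar>g \<xi>\<bar> powr p))
    \<le> ennreal (C powr p) * (ennreal (4 ^ CARD('n) / (unit_ball_vol (real CARD('n)) * \<gamma> ^ CARD('n))) * (\<integral>\<^sup>+x. ennreal (cart_weight (x :: real ^ 'n)) \<partial>lborel))" .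
qed

section \<open>The averaged operator\<close>

lemma ball_average_diff:
  fixes f g :: "real ^ 'n \<Rightarrow> real"
  assumes "1 \<le> p" "f \<in> Lp p" "g \<in> Lp p"
  shows "ball_average \<delta> (\<lambda>x. f x - g x) x = ball_average \<delta> f x - ball_average \<delta> g x"
  unfolding ball_average_def
  using set_integral_diff(2)[OF Lp_set_integrable_ball(2)[OF assms(1,2)] Lp_set_integrable_ball(2)[OF assms(1,3)], of x \<delta>]
  by (simp add: right_diff_distrib)

lemma averaged_op_diff:
  fixes f g :: "real ^ 'n \<Rightarrow> real"
  assumes "1 \<le> p" "f \<in> Lp p" "g \<in> Lp p"
  shows "averaged_op \<delta> r (\<lambda>x. f x - g x) x = averaged_op \<delta> r f x - averaged_op \<delta> r g x"
  unfolding averaged_op_def ball_average_diff[OF assms]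
  by (simp add: right_diff_distrib sum_subtractf)

text \<open>The averaged operator reproduces constants. After reversing the index this is the
  alternating partial sum of the row 2r of Pascal's triangle up to r - 1, which is, up to sign, (2r
  - 1 choose r - 1), half of the central coefficient.\<close>

lemma averaged_op_coefficients_sum:
  assumes "1 \<le> r"
  shows "(\<Sum>j = 1..r. - (2 / real ((2 * r) choose r)) * ((- 1) ^ j * real ((2 * r) choose (r - j)))) = 1"
proof -
  obtain q where q: "r = Suc q" using assms by (cases r) auto
  have "(\<Sum>j = 1..r. (- 1) ^ j * real ((2 * r) choose (r - j))) = (\<Sum>k\<le>q. (- 1) ^ (r - k) * real ((2 * r) choose k))"
    by (rule sum.reindex_bij_witness[of _ "\<lambda>k. r - k" "\<lambda>j. r - j"]) (auto simp: q)
  also have "\<dots> = (- 1) ^ r * (\<Sum>k\<le>q. (real (2 * r) gchoose k) * (- 1) ^ k)"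
  proof -
    have "(- 1) ^ (r - k) * real ((2 * r) choose k) = (- 1) ^ r * ((real (2 * r) gchoose k) * (- 1) ^ k)" if "k \<le> q" for k
    proof -
      have "(- 1 :: real) ^ r = (- 1) ^ (r - k) * (- 1) ^ k" using that q by (simp flip: power_add)
      moreover have "(- 1 :: real) ^ k * (- 1) ^ k = 1" by (simp flip: power_mult_distrib)
      ultimately show ?thesis by (simp add: binomial_gbinomial mult_ac)
    qed
    then show ?thesis by (simp add: sum_distrib_left)
  qed
  also have "\<dots> = (- 1) ^ r * ((- 1) ^ q * (real (2 * r) - 1 gchoose q))"
    by (simp only: gbinomial_sum_lower_neg)
  also have "real (2 * r) - 1 = real (2 * r - 1)" using q by simp
  also have "(- 1) ^ r * ((- 1) ^ q * (real (2 * r - 1) gchoose q)) = - real ((2 * r - 1) choose q)"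
    by (simp add: q binomial_gbinomial flip: power_mult_distrib mult.assoc)
  also have "2 * ((2 * r - 1) choose q) = (2 * r) choose r"
  proof -
    have "(2 * r) choose r = ((2 * r - 1) choose q) + ((2 * r - 1) choose r)"
      using q by simp
    moreover have "(2 * r - 1) choose r = (2 * r - 1) choose q"
      using binomial_symmetric[of r "2 * r - 1"] q by simp
    ultimately show ?thesis by simp
  qed
  then have "real ((2 * r - 1) choose q) = real ((2 * r) choose r) / 2" by simp
  finally have "(\<Sum>j = 1..r. (- 1) ^ j * real ((2 * r) choose (r - j))) = - real ((2 * r) choose r) / 2" by simp
  moreover have "0 < (2 * r) choose r" by (simp add: zero_less_binomial_iff)
  ultimately show ?thesis unfolding sum_distrib_left[symmetric] by simp
qed

text \<open>Both bounds share the factor \<open>T\<close>, so that repeated use only composes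
  constants.\<close>

lemma lp_modular_add_le_mult:
  assumes "0 \<le> p" "lp_modular p \<sigma> X f \<le> a * T" "lp_modular p \<sigma> X g \<le> b * T"
  shows "lp_modular p \<sigma> X (\<lambda>\<xi>. f \<xi> + g \<xi>) \<le> ennreal (2 powr p) * (a + b) * T"
proof -
  have "lp_modular p \<sigma> X (\<lambda>\<xi>. f \<xi> + g \<xi>) \<le> ennreal (2 powr p) * (lp_modular p \<sigma> X f + lp_modular p \<sigma> X g)"
    by (rule lp_modular_add_le[OF assms(1)])
  also have "\<dots> \<le> ennreal (2 powr p) * (a * T + b * T)"
    by (intro mult_left_mono add_mono assms(2,3)) simp
  finally show ?thesis by (simp add: distrib_right mult.assoc)
qed

lemma Lp_modular_add_le_mult:
  assumes "0 \<le> p" "f \<in> borel_measurable lebesgue" "g \<in> borel_measurable lebesgue"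
    "Lp_modular p f \<le> a * T" "Lp_modular p g \<le> b * T"
  shows "Lp_modular p (\<lambda>x. f x + g x) \<le> ennreal (2 powr p) * (a + b) * T"
proof -
  have "Lp_modular p (\<lambda>x. f x + g x) \<le> ennreal (2 powr p) * (Lp_modular p f + Lp_modular p g)"
    by (rule Lp_modular_add_le[OF assms(2,3,1)])
  also have "\<dots> \<le> ennreal (2 powr p) * (a * T + b * T)"
    by (intro mult_left_mono add_mono assms(4,5)) simp
  finally show ?thesis by (simp add: distrib_right mult.assoc)
qed

text \<open>\<open>K\<close> is produced before \<sigma>, \<open>X\<close>, \<open>T\<close> and the
  functions are given, which is the uniformity needed as \<sigma> varies. The quasi-triangle
  constants accumulate over \<open>I\<close>, hence the induction.\<close>

lemma lp_modular_sum_le: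
  fixes B :: "'i \<Rightarrow> ennreal"
  assumes "finite I" "0 \<le> p" "\<And>i. i \<in> I \<Longrightarrow> B i < top"
  obtains K where "K < top"
    "\<And>\<sigma> X T (f :: 'i \<Rightarrow> real ^ 'n \<Rightarrow> real). (\<And>i. i \<in> I \<Longrightarrow> lp_modular p \<sigma> X (f i) \<le> B i * T) \<Longrightarrow>
       lp_modular p \<sigma> X (\<lambda>\<xi>. \<Sum>i\<in>I. f i \<xi>) \<le> K * T"
  using assms(1,3)
proof (induction I arbitrary: thesis)
  case empty
  show ?case by (rule empty(1)[of 0]) (simp_all add: lp_modular_zero)
next
  case (insert i I)
  obtain K where K: "K < top" "\<And>\<sigma> X T (f :: 'i \<Rightarrow> real ^ 'n \<Rightarrow> real). (\<And>i. i \<in> I \<Longrightarrow> lp_modular p \<sigma> X (f i) \<le> B i * T) \<Longrightarrow>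
    lp_modular p \<sigma> X (\<lambda>\<xi>. \<Sum>i\<in>I. f i \<xi>) \<le> K * T"
    using insert.IH insert.prems(2) by blast
  show ?case
  proof (rule insert.prems(1))
    show "ennreal (2 powr p) * (B i + K) < top"
      using K(1) insert.prems(2)[of i] by (simp add: ennreal_mult_less_top)
    fix \<sigma> X T and f :: "'i \<Rightarrow> real ^ 'n \<Rightarrow> real"
    assume *: "\<And>j. j \<in> insert i I \<Longrightarrow> lp_modular p \<sigma> X (f j) \<le> B j * T"
    have "lp_modular p \<sigma> X (\<lambda>\<xi>. f i \<xi> + (\<Sum>i\<in>I. f i \<xi>)) \<le> ennreal (2 powr p) * (B i + K) * T"
      by (rule lp_modular_add_le_mult[OF assms(2)]) (use * K(2) in auto)
    then show "lp_modular p \<sigma> X (\<lambda>\<xi>. \<Sum>i\<in>insert i I. f i \<xi>) \<le> ennreal (2 powr p) * (B i + K) * T"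
      using insert.hyps by simp
  qed
qed

lemma averaged_op_eq_sum:
  "averaged_op \<delta> r f x = (\<Sum>j = 1..r. - (2 / real ((2 * r) choose r)) * ((- 1) ^ j * real ((2 * r) choose (r - j))) *
     ball_average (\<delta> * real j / real r) f x)"
  unfolding averaged_op_def by (simp add: sum_distrib_left mult.assoc)

text \<open>The radii are \<gamma> j / (\<sigma> r): at most \<open>\<gamma> / \<sigma>\<close>, so
  the balls are disjoint, and with product \<open>\<sigma> * ?\<delta>\<close> free of \<sigma>, so
  \<open>K\<close> is uniform.\<close>

lemma lp_modular_averaged_op_le:
  assumes p: "1 \<le> p" and \<gamma>: "0 < \<gamma>"
  obtains K where "K < top" "\<And>\<sigma> X (g :: real ^ 'n \<Rightarrow> real). 0 < \<sigma> \<Longrightarrow> g \<in> Lp p \<Longrightarrow>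
    pairwise (\<lambda>\<xi> \<xi>'. dist \<xi> \<xi>' > 2 * \<gamma> / \<sigma>) X \<Longrightarrow>
    lp_modular p \<sigma> X (averaged_op (\<gamma> / \<sigma>) r g) \<le> K * Lp_modular p g"
proof -
  define c where "c j = - (2 / real ((2 * r) choose r)) * ((- 1) ^ j * real ((2 * r) choose (r - j)))" for j
  define B where "B j = ennreal (\<bar>c j\<bar> powr p) * ennreal (2 powr p / (unit_ball_vol (real CARD('n)) * (\<gamma> * real j / real r) ^ CARD('n)))" for j
  have p0: "0 \<le> p" using p by simp
  have Bfin: "B j < top" for j by (simp add: B_def ennreal_mult_less_top)
  have "lp_modular p \<sigma> X (\<lambda>\<xi>. c j * ball_average (\<gamma> / \<sigma> * real j / real r) g \<xi>) \<le> B j * Lp_modular p g"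
    if "0 < \<sigma>" "g \<in> Lp p" "pairwise (\<lambda>\<xi> \<xi>'. dist \<xi> \<xi>' > 2 * \<gamma> / \<sigma>) X" "j \<in> {1..r}"
    for \<sigma> X j and g :: "real ^ 'n \<Rightarrow> real"
  proof -
    let ?\<delta> = "\<gamma> / \<sigma> * real j / real r"
    have d: "0 < ?\<delta>" "?\<delta> \<le> \<gamma> / \<sigma>" "\<sigma> * ?\<delta> = \<gamma> * real j / real r"
      using that(1,4) \<gamma> by (auto simp: field_simps)
    have "lp_modular p \<sigma> X (\<lambda>\<xi>. c j * ball_average ?\<delta> g \<xi>) = ennreal (\<bar>c j\<bar> powr p) * lp_modular p \<sigma> X (ball_average ?\<delta> g)"
      by (rule lp_modular_scale)
    also have "\<dots> \<le> ennreal (\<bar>c j\<bar> powr p) * (ennreal (2 powr p / (unit_ball_vol (real CARD('n)) * (\<sigma> * ?\<delta>) ^ CARD('n))) * Lp_modular p g)"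
      by (intro mult_left_mono lp_modular_ball_average_le[OF p that(2) d(1,2) that(1,3)]) simp
    finally show ?thesis unfolding d(3) by (simp add: B_def mult.assoc)
  qed
  note bound = this
  obtain K where K: "K < top" "\<And>\<sigma> X T (f :: nat \<Rightarrow> real ^ 'n \<Rightarrow> real). (\<And>j. j \<in> {1..r} \<Longrightarrow> lp_modular p \<sigma> X (f j) \<le> B j * T) \<Longrightarrow>
    lp_modular p \<sigma> X (\<lambda>\<xi>. \<Sum>j = 1..r. f j \<xi>) \<le> K * T"
    using lp_modular_sum_le[of "{1..r}" p B] p0 Bfin by blast
  have "lp_modular p \<sigma> X (averaged_op (\<gamma> / \<sigma>) r g) \<le> K * Lp_modular p g"
    if "0 < \<sigma>" "g \<in> Lp p" "pairwise (\<lambda>\<xi> \<xi>'. dist \<xi> \<xi>' > 2 * \<gamma> / \<sigma>) X" for \<sigma> X and g :: "real ^ 'n \<Rightarrow> real"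
    unfolding averaged_op_eq_sum[abs_def] c_def[symmetric] by (rule K(2)) (rule bound[OF that])
  then show thesis using that K(1) by blast
qed

lemma exp_span_ball_average_close:
  fixes h :: "real ^ 'n \<Rightarrow> real"
  assumes h: "h \<in> exp_span" and \<delta>: "0 < \<delta>" "\<delta> \<le> 1"
    and L: "0 \<le> L" "\<And>x y. dist x y \<le> 1 \<Longrightarrow> \<bar>h x - h y\<bar> \<le> L * dist x y * cart_weight x"
  shows "\<bar>ball_average \<delta> h x - h x\<bar> \<le> L * \<delta> * cart_weight x"
proof -
  define V where "V = measure lebesgue (ball (0 :: real ^ 'n) \<delta>)"
  have V: "0 < V" "measure lebesgue (ball x \<delta>) = V" using \<delta> by (simp_all add: V_def content_ball)
  have int: "set_integrable lebesgue (ball x \<delta>) h"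
    by (rule Lp_set_integrable_ball(2)[OF order_refl exp_span_Lp[OF h order_refl]])
  have intc: "set_integrable lebesgue (ball x \<delta>) (\<lambda>y. c)" for c :: real
    unfolding set_integrable_def by (simp add: integrable_indicator_iff less_top[symmetric])
  have const: "(LINT y:ball x \<delta>|lebesgue. c) = V * c" for c :: real
    using V(2) by (subst set_integral_const) auto
  have "\<bar>LINT y:ball x \<delta>|lebesgue. h y - h x\<bar> \<le> (LINT y:ball x \<delta>|lebesgue. \<bar>h y - h x\<bar>)"
    using set_integral_norm_bound[OF set_integral_diff(1)[OF int intc]] by simp
  also have "\<dots> \<le> (LINT y:ball x \<delta>|lebesgue. L * \<delta> * cart_weight x)"
  proof (rule set_integral_mono)
    show "set_integrable lebesgue (ball x \<delta>) (\<lambda>y. \<bar>h y - h x\<bar>)"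
      by (intro set_integrable_abs set_integral_diff int intc)
    fix y assume y: "y \<in> ball x \<delta>"
    have "\<bar>h x - h y\<bar> \<le> L * dist x y * cart_weight x" using L(2)[of x y] y \<delta>(2) by simp
    also have "\<dots> \<le> L * \<delta> * cart_weight x"
      using y L(1) by (intro mult_right_mono mult_left_mono) (auto simp: cart_weight_nonneg)
    finally show "\<bar>h y - h x\<bar> \<le> L * \<delta> * cart_weight x" by (simp add: abs_minus_commute)
  qed (rule intc)
  also have "\<dots> = V * (L * \<delta> * cart_weight x)" by (rule const)
  finally have *: "\<bar>LINT y:ball x \<delta>|lebesgue. h y - h x\<bar> \<le> V * (L * \<delta> * cart_weight x)" .
  have "(LINT y:ball x \<delta>|lebesgue. h y - h x) = (LINT y:ball x \<delta>|lebesgue. h y) - V * h x"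
    using set_integral_diff(2)[OF int intc[of "h x"]] const[of "h x"] by simp
  then have "V * (ball_average \<delta> h x - h x) = (LINT y:ball x \<delta>|lebesgue. h y - h x)"
    using V(1) by (simp add: ball_average_def V_def[symmetric] right_diff_distrib)
  then have "V * \<bar>ball_average \<delta> h x - h x\<bar> \<le> V * (L * \<delta> * cart_weight x)"
    using * V(1) by (metis abs_mult abs_of_pos)
  then show ?thesis using V(1) by simp
qed

text \<open>A first-order rate in \<delta> is enough, because \<open>h\<close> stays fixed while
  \<delta> tends to 0.\<close>

lemma exp_span_averaged_op_close:
  fixes h :: "real ^ 'n \<Rightarrow> real"
  assumes h: "h \<in> exp_span" and r: "1 \<le> r"
  shows "\<exists>K\<ge>0. \<forall>\<delta> x. 0 < \<delta> \<longrightarrow> \<delta> \<le> 1 \<longrightarrow> \<bar>averaged_op \<delta> r h x - h x\<bar> \<le> K * \<delta> * cart_weight x"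
proof -
  define c where "c j = - (2 / real ((2 * r) choose r)) * ((- 1) ^ j * real ((2 * r) choose (r - j)))" for j
  obtain L where L: "0 \<le> L" "\<And>x y. dist x y \<le> 1 \<Longrightarrow> \<bar>h x - h y\<bar> \<le> L * dist x y * cart_weight x"
    using exp_span_Lipschitz[OF h] by blast
  have "\<bar>averaged_op \<delta> r h x - h x\<bar> \<le> ((\<Sum>j = 1..r. \<bar>c j\<bar>) * L) * \<delta> * cart_weight x" if \<delta>: "0 < \<delta>" "\<delta> \<le> 1" for \<delta> x
  proof -
    \<comment> \<open>This allows \<open>h x\<close> to be distributed over the terms, leaving a
      combination of single averaging errors.\<close>
    have c1: "(\<Sum>j = 1..r. c j) = 1"
      unfolding c_def by (rule averaged_op_coefficients_sum[OF r])
    have "averaged_op \<delta> r h x = (\<Sum>j = 1..r. c j * ball_average (\<delta> * real j / real r) h x)"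
      unfolding c_def by (rule averaged_op_eq_sum)
    then have "averaged_op \<delta> r h x - h x = (\<Sum>j = 1..r. c j * (ball_average (\<delta> * real j / real r) h x - h x))"
      unfolding right_diff_distrib sum_subtractf sum_distrib_right[symmetric] c1 by simp
    also have "\<bar>\<dots>\<bar> \<le> (\<Sum>j = 1..r. \<bar>c j\<bar> * (L * \<delta> * cart_weight x))"
    proof (rule sum_abs[THEN order_trans], rule sum_mono)
      fix j assume j: "j \<in> {1..r}"
      let ?d = "\<delta> * real j / real r"
      have d: "0 < ?d" "?d \<le> \<delta>" using j \<delta>(1) by (auto simp: field_simps)
      have "\<bar>ball_average ?d h x - h x\<bar> \<le> L * ?d * cart_weight x"
        by (rule exp_span_ball_average_close[OF h d(1) _ L]) (use d \<delta> in auto)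
      also have "\<dots> \<le> L * \<delta> * cart_weight x"
        using d(2) L(1) by (intro mult_right_mono mult_left_mono) (auto simp: cart_weight_nonneg)
      finally show "\<bar>c j * (ball_average ?d h x - h x)\<bar> \<le> \<bar>c j\<bar> * (L * \<delta> * cart_weight x)"
        by (simp add: abs_mult mult_left_mono)
    qed
    finally show ?thesis by (simp add: sum_distrib_right mult.assoc)
  qed
  then show ?thesis using L(1) by (intro exI[of _ "(\<Sum>j = 1..r. \<bar>c j\<bar>) * L"]) (auto intro: sum_nonneg)
qed

section \<open>Measurability and linearity of the sampling operator\<close>

lemma separated_imp_countable:
  fixes X :: "'a::{metric_space,second_countable_topology} set"
  assumes "0 < d" "pairwise (\<lambda>x y. d < dist x y) X"
  shows "countable X"
proof -
  let ?B = "\<lambda>x. ball x (d / 2)"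
  have disj: "disjnt (?B x) (?B y)" if "x \<in> X" "y \<in> X" "x \<noteq> y" for x y
  proof -
    have "d < dist x y" using assms(2) that by (simp add: pairwise_def)
    then have False if "dist x z < d / 2" "dist y z < d / 2" for z
      using dist_triangle[of x y z] that by (simp add: dist_commute)
    then show ?thesis by (auto simp: disjnt_def)
  qed
  have inj: "inj_on ?B X"
  proof (rule inj_onI, rule ccontr)
    fix x y assume "x \<in> X" "y \<in> X" "?B x = ?B y" "x \<noteq> y"
    then show False using disj[of x y] assms(1) by (auto simp: disjnt_def)
  qed
  have "countable (?B ` X)"
  proof (rule countable_disjoint_open_subsets)
    show "pairwise disjnt (?B ` X)" using disj by (auto simp: pairwise_def)
  qed auto
  then show ?thesis using inj by (rule countable_image_inj_on)
qed

text \<open>Enumerating the countable set \<open>X\<close> makes the unordered sum almost everywhere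
  a limit of measurable partial sums; Lebesgue measurability is stable under changes on null sets.
  The quasi-triangle inequality for \<open>Lp_modular\<close> requires this.\<close>

lemma sampling_op_measurable:
  fixes X :: "(real ^ 'n) set"
  assumes X: "countable X" and G: "sampling_op_defined p \<sigma> X \<psi>" and f: "f \<in> Lp p \<inter> lp p \<sigma> X"
  shows "sampling_op X \<psi> f \<in> borel_measurable lebesgue"
proof (cases "finite X")
  case True
  then show ?thesis
    unfolding sampling_op_def[abs_def] using G by (auto simp: sampling_op_defined_def intro!: borel_measurable_sum)
next
  case False
  define e where "e = from_nat_into X"
  have e: "bij_betw e UNIV X" unfolding e_def by (rule bij_betw_from_nat_into[OF X False])
  then have eX: "e n \<in> X" for n by (auto simp: bij_betw_def)
  define S where "S n x = (\<Sum>k<n. f (e k) * \<psi> (e k) x)" for n x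
  have "S n \<in> borel_measurable lebesgue" for n
    unfolding S_def[abs_def]
    by (intro borel_measurable_sum borel_measurable_times borel_measurable_const)
      (use G eX in \<open>auto simp: sampling_op_defined_def\<close>)
  then have lim: "(\<lambda>x. lim (\<lambda>n. S n x)) \<in> borel_measurable lebesgue"
    by (rule borel_measurable_lim_metric)
  have "AE x in lebesgue. (\<lambda>\<xi>. f \<xi> * \<psi> \<xi> x) summable_on X"
    using G f by (auto simp: sampling_op_defined_def)
  then have "AE x in lebesgue. lim (\<lambda>n. S n x) = sampling_op X \<psi> f x"
  proof eventually_elim
    case (elim x)
    then have "((\<lambda>\<xi>. f \<xi> * \<psi> \<xi> x) has_sum sampling_op X \<psi> f x) X"
      by (simp add: sampling_op_def)
    then have "((\<lambda>k. f (e k) * \<psi> (e k) x) has_sum sampling_op X \<psi> f x) UNIV"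
      using has_sum_reindex_bij_betw[OF e, of "\<lambda>\<xi>. f \<xi> * \<psi> \<xi> x"] by simp
    from has_sum_imp_sums[OF this] have "(\<lambda>n. S n x) \<longlonglongrightarrow> sampling_op X \<psi> f x"
      by (simp add: sums_def S_def)
    then show ?case by (rule limI)
  qed
  from borel_measurable_AE[OF lim this] show ?thesis .
qed

text \<open>Only almost everywhere: where a series diverges, its value is 0 by convention and
  linearity may fail.\<close>

lemma sampling_op_diff:
  assumes G: "sampling_op_defined p \<sigma> X \<psi>" and f: "f \<in> Lp p \<inter> lp p \<sigma> X" and h: "h \<in> Lp p \<inter> lp p \<sigma> X"
  shows "AE x in lebesgue. sampling_op X \<psi> (\<lambda>\<xi>. f \<xi> - h \<xi>) x = sampling_op X \<psi> f x - sampling_op X \<psi> h x"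
proof -
  have "AE x in lebesgue. (\<lambda>\<xi>. f \<xi> * \<psi> \<xi> x) summable_on X" "AE x in lebesgue. (\<lambda>\<xi>. h \<xi> * \<psi> \<xi> x) summable_on X"
    using G f h by (auto simp: sampling_op_defined_def)
  then show ?thesis
  proof eventually_elim
    case (elim x)
    have "(\<lambda>\<xi>. (- 1) * (h \<xi> * \<psi> \<xi> x)) summable_on X" using elim(2) by (rule summable_on_cmult_right)
    from infsum_add[OF elim(1) this] show ?case
      unfolding sampling_op_def infsum_cmult_right' by (simp add: left_diff_distrib)
  qed
qed

section \<open>Passing between norms and p-th powers, and null limits in
  \<open>ennreal\<close>\<close>

lemma ennreal_root_le_iff:
  assumes "0 < p" "0 \<le> e"
  shows "ennreal_root p x \<le> ennreal e \<longleftrightarrow> x \<le> ennreal (e powr p)"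
proof (cases x)
  case (real a)
  have "a powr (1 / p) \<le> e \<longleftrightarrow> a \<le> e powr p"
  proof
    assume "a powr (1 / p) \<le> e"
    then have "(a powr (1 / p)) powr p \<le> e powr p" using assms by (intro powr_mono2) auto
    then show "a \<le> e powr p" using assms real by (simp add: powr_powr)
  next
    assume "a \<le> e powr p"
    then have "a powr (1 / p) \<le> (e powr p) powr (1 / p)" using assms real by (intro powr_mono2) auto
    then show "a powr (1 / p) \<le> e" using assms by (simp add: powr_powr)
  qed
  then show ?thesis using real assms by (simp add: ennreal_root_def)
next
  case top
  then show ?thesis by (simp add: ennreal_root_def top_unique)
qed

lemma ennreal_root_le_mult_root:
  assumes "0 < p" "0 \<le> \<kappa>" "ennreal_root p a \<le> ennreal \<kappa> * ennreal_root p b" "b < top"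
  shows "a \<le> ennreal (\<kappa> powr p) * b"
proof -
  obtain \<beta> where \<beta>: "0 \<le> \<beta>" "b = ennreal \<beta>" using assms(4) by (cases b) auto
  then have "ennreal_root p a \<le> ennreal (\<kappa> * \<beta> powr (1 / p))"
    using assms by (simp add: ennreal_root_def ennreal_mult)
  then have "a \<le> ennreal ((\<kappa> * \<beta> powr (1 / p)) powr p)"
    using assms by (subst (asm) ennreal_root_le_iff) auto
  also have "(\<kappa> * \<beta> powr (1 / p)) powr p = \<kappa> powr p * \<beta>"
    using assms(1) \<beta>(1) by (simp add: powr_mult powr_powr)
  finally show ?thesis using \<beta> by (simp add: ennreal_mult)
qed

lemma ennreal_mult_root_le_root:
  assumes "0 < p" "0 < \<kappa>" "ennreal \<kappa> * ennreal_root p b \<le> ennreal_root p a"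
  shows "b \<le> ennreal ((1 / \<kappa>) powr p) * a"
proof (cases "a < top")
  case True
  have "ennreal (1 / \<kappa>) * (ennreal \<kappa> * ennreal_root p b) \<le> ennreal (1 / \<kappa>) * ennreal_root p a"
    using assms(3) by (rule mult_left_mono) simp
  then have "ennreal_root p b \<le> ennreal (1 / \<kappa>) * ennreal_root p a"
    using assms(2) by (simp add: mult.assoc[symmetric] flip: ennreal_mult)
  then show ?thesis using assms True by (intro ennreal_root_le_mult_root) auto
next
  case False
  then show ?thesis using assms(2) by (simp add: less_top[symmetric] ennreal_mult_top)
qed

lemma tendsto_ennreal_zero_iff:
  fixes u :: "'a \<Rightarrow> ennreal"
  shows "(u \<longlongrightarrow> 0) F \<longleftrightarrow> (\<forall>e>0. \<forall>\<^sub>F x in F. u x \<le> ennreal e)"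
proof
  assume u: "(u \<longlongrightarrow> 0) F"
  show "\<forall>e>0. \<forall>\<^sub>F x in F. u x \<le> ennreal e"
  proof (intro allI impI)
    fix e :: real assume "0 < e"
    then have "\<forall>\<^sub>F x in F. u x < ennreal e" using order_tendstoD(2)[OF u] by simp
    then show "\<forall>\<^sub>F x in F. u x \<le> ennreal e" by eventually_elim simp
  qed
next
  assume u: "\<forall>e>0. \<forall>\<^sub>F x in F. u x \<le> ennreal e"
  show "(u \<longlongrightarrow> 0) F"
  proof (rule order_tendstoI)
    fix a :: ennreal assume "0 < a"
    then obtain b where b: "0 < b" "b < a" using dense by blast
    then have "b < top" using less_le_trans top_greatest by blast
    then obtain e where e: "0 < e" "ennreal e < a" using b by (cases b) auto
    have "\<forall>\<^sub>F x in F. u x \<le> ennreal e" using u e by simp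
    then show "\<forall>\<^sub>F x in F. u x < a" by eventually_elim (use e in auto)
  qed simp
qed

lemma tendsto_ennreal_root_zero_iff:
  assumes "0 < p"
  shows "((\<lambda>x. ennreal_root p (u x)) \<longlongrightarrow> 0) F \<longleftrightarrow> (u \<longlongrightarrow> 0) F"
  unfolding tendsto_ennreal_zero_iff
proof (intro iffI allI impI)
  fix e :: real
  assume *: "\<forall>e>0. \<forall>\<^sub>F x in F. ennreal_root p (u x) \<le> ennreal e" and e: "0 < e"
  then have "\<forall>\<^sub>F x in F. ennreal_root p (u x) \<le> ennreal (e powr (1 / p))" by simp
  then show "\<forall>\<^sub>F x in F. u x \<le> ennreal e"
    using assms e by (simp add: ennreal_root_le_iff powr_powr)
next
  fix e :: real
  assume *: "\<forall>e>0. \<forall>\<^sub>F x in F. u x \<le> ennreal e" and e: "0 < e"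
  then have "\<forall>\<^sub>F x in F. u x \<le> ennreal (e powr p)" by simp
  then show "\<forall>\<^sub>F x in F. ennreal_root p (u x) \<le> ennreal e"
    using assms e by (simp add: ennreal_root_le_iff)
qed

text \<open>The range of \<open>x\<close> in the hypothesis may depend on \<open>e\<close>, but
  \<open>K\<close> may not. This is the form in which approximation by a function chosen for
  \<open>e\<close> delivers the estimate.\<close>

lemma tendsto_ennreal_zero_by_bound:
  fixes u v :: "'a \<Rightarrow> ennreal"
  assumes K: "K < top" and le: "\<And>e. 0 < e \<Longrightarrow> \<forall>\<^sub>F x in F. u x \<le> K * (v x + ennreal e)" and v: "(v \<longlongrightarrow> 0) F"
  shows "(u \<longlongrightarrow> 0) F"
  unfolding tendsto_ennreal_zero_iff
proof (intro allI impI)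
  fix e :: real assume e: "0 < e"
  obtain k where k: "0 \<le> k" "K = ennreal k" using K by (cases K) auto
  \<comment> \<open>One half for \<open>v\<close>, one half for the additive error;
    \<open>k + 1\<close> keeps the denominator positive.\<close>
  define d where "d = e / (2 * (k + 1))"
  have d: "0 < d" using e k by (simp add: d_def)
  have "k * (d + d) \<le> (k + 1) * (d + d)" using d by (intro mult_right_mono) auto
  also have "\<dots> = 2 * (k + 1) * d" by (simp add: algebra_simps)
  also have "\<dots> = e" using k(1) by (simp add: d_def)
  finally have kd: "k * (d + d) \<le> e" .
  have "\<forall>\<^sub>F x in F. v x \<le> ennreal d" using v d unfolding tendsto_ennreal_zero_iff by blast
  then show "\<forall>\<^sub>F x in F. u x \<le> ennreal e"
    using le[OF d]
  proof eventually_elim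
    case (elim x)
    have "u x \<le> K * (ennreal d + ennreal d)"
      using elim by (meson add_right_mono mult_left_mono order_trans zero_le)
    also have "\<dots> = ennreal (k * (d + d))" using d k by (simp add: ennreal_mult flip: ennreal_plus)
    also have "\<dots> \<le> ennreal e" using kd by (rule ennreal_leI)
    finally show ?case .
  qed
qed

text \<open>Eliminates the intermediate quantity \<open>y\<close>; the summand 1 in
  \<open>L + 1\<close> absorbs the error \<open>e\<close> standing beside it.\<close>

lemma mult_add_le_trans_ennreal:
  fixes x y z :: ennreal
  assumes "x \<le> K * (y + e)" "y \<le> L * (z + e)"
  shows "x \<le> K * (L + 1) * (z + e)"
proof -
  have "y + e \<le> L * (z + e) + (z + e)" using assms(2) by (intro add_mono) (auto simp: add_increasing)
  also have "\<dots> = (L + 1) * (z + e)" by (simp add: distrib_right)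
  finally have "K * (y + e) \<le> K * ((L + 1) * (z + e))" by (rule mult_left_mono) simp
  then show ?thesis using assms(1) by (simp add: mult.assoc)
qed

section \<open>Convergence of the sampling operators\<close>

lemma exp_span_lp_modular_finite:
  fixes h :: "real ^ 'n \<Rightarrow> real"
  assumes "h \<in> exp_span" "1 \<le> p" "0 < \<gamma>" "\<gamma> \<le> \<sigma>" "pairwise (\<lambda>\<xi> \<xi>'. dist \<xi> \<xi>' > 2 * \<gamma> / \<sigma>) X"
  shows "lp_modular p \<sigma> X h < top"
proof -
  obtain C where C: "\<And>x. \<bar>h x\<bar> \<le> C * cart_weight x" using exp_span_bound[OF assms(1)] by blast
  show ?thesis
    using cart_weight_nn_integral[where 'n = 'n]
    by (intro le_less_trans[OF lp_modular_weight_le[OF assms(2-5) C]]) (simp add: ennreal_mult_less_top)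
qed

lemma exp_span_averaged_op_tendsto:
  fixes h :: "real ^ 'n \<Rightarrow> real"
  assumes h: "h \<in> exp_span" and p: "1 \<le> p" and r: "1 \<le> r" and \<gamma>: "0 < \<gamma>"
    and sep: "\<And>\<sigma>. 0 < \<sigma> \<Longrightarrow> pairwise (\<lambda>\<xi> \<xi>'. dist \<xi> \<xi>' > 2 * \<gamma> / \<sigma>) (X \<sigma>)"
  shows "((\<lambda>\<sigma>. lp_modular p \<sigma> (X \<sigma>) (\<lambda>\<xi>. averaged_op (\<gamma> / \<sigma>) r h \<xi> - h \<xi>)) \<longlongrightarrow> 0) at_top"
proof -
  obtain K where K: "0 \<le> K" "\<And>\<delta> x. 0 < \<delta> \<Longrightarrow> \<delta> \<le> 1 \<Longrightarrow> \<bar>averaged_op \<delta> r h x - h x\<bar> \<le> K * \<delta> * cart_weight x"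
    using exp_span_averaged_op_close[OF h r] by blast
  let ?W = "ennreal (4 ^ CARD('n) / (unit_ball_vol (real CARD('n)) * \<gamma> ^ CARD('n))) * (\<integral>\<^sup>+x. ennreal (cart_weight (x :: real ^ 'n)) \<partial>lborel)"
  have "?W < top" using cart_weight_nn_integral[where 'n = 'n] by (simp add: ennreal_mult_less_top)
  then obtain w where w: "0 \<le> w" "?W = ennreal w" by (cases ?W) auto
  have "((\<lambda>\<sigma>. K * (\<gamma> / \<sigma>)) \<longlongrightarrow> 0) at_top" by real_asymp
  then have "((\<lambda>\<sigma>. (K * (\<gamma> / \<sigma>)) powr p) \<longlongrightarrow> 0 powr p) at_top"
    by (intro tendsto_powr' tendsto_const)
      (use p K(1) \<gamma> in \<open>auto intro!: eventually_mono[OF eventually_gt_at_top[of 0]]\<close>)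
  then have "((\<lambda>\<sigma>. (K * (\<gamma> / \<sigma>)) powr p * w) \<longlongrightarrow> 0 powr p * w) at_top"
    by (rule tendsto_mult[OF _ tendsto_const])
  then have "((\<lambda>\<sigma>. ennreal ((K * (\<gamma> / \<sigma>)) powr p * w)) \<longlongrightarrow> ennreal (0 powr p * w)) at_top"
    by (rule tendsto_ennrealI)
  then have lim: "((\<lambda>\<sigma>. ennreal ((K * (\<gamma> / \<sigma>)) powr p * w)) \<longlongrightarrow> 0) at_top" by simp
  show ?thesis
  proof (rule tendsto_sandwich[OF _ _ tendsto_const lim])
    show "\<forall>\<^sub>F \<sigma> in at_top. lp_modular p \<sigma> (X \<sigma>) (\<lambda>\<xi>. averaged_op (\<gamma> / \<sigma>) r h \<xi> - h \<xi>) \<le> ennreal ((K * (\<gamma> / \<sigma>)) powr p * w)"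
      using eventually_ge_at_top[of \<gamma>]
    proof eventually_elim
      case (elim \<sigma>)
      then have \<sigma>: "0 < \<sigma>" "0 < \<gamma> / \<sigma>" "\<gamma> / \<sigma> \<le> 1" using \<gamma> by auto
      have "lp_modular p \<sigma> (X \<sigma>) (\<lambda>\<xi>. averaged_op (\<gamma> / \<sigma>) r h \<xi> - h \<xi>) \<le> ennreal ((K * (\<gamma> / \<sigma>)) powr p) * ?W"
        by (rule lp_modular_weight_le[OF p \<gamma> elim sep[OF \<sigma>(1)] K(2)[OF \<sigma>(2,3)]])
      then show ?case unfolding w(2) using w(1) by (simp add: ennreal_mult)
    qed
  qed simp
qed

theorem corollary4p2:
  fixes p \<gamma> \<kappa>1 \<kappa>2 \<kappa>3 \<Lambda> :: real
    and r s :: nat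
    and X :: "real \<Rightarrow> (real ^ 'n) set"
    and \<psi> :: "real \<Rightarrow> real ^ 'n \<Rightarrow> real ^ 'n \<Rightarrow> real"
    and f :: "real ^ 'n \<Rightarrow> real"
  assumes p: "1 \<le> p"
    and rs: "1 \<le> r" "1 \<le> s" "s \<le> 2 * r"
    and \<gamma>: "0 < \<gamma>" "\<gamma> \<le> 1"
    and separated: "\<And>\<sigma>. 0 < \<sigma> \<Longrightarrow> pairwise (\<lambda>\<xi> \<xi>'. dist \<xi> \<xi>' > 2 * \<gamma> / \<sigma>) (X \<sigma>)"
    and G_defined: "\<And>\<sigma>. 0 < \<sigma> \<Longrightarrow> sampling_op_defined p \<sigma> (X \<sigma>) (\<psi> \<sigma>)"
    and constants: "0 < \<kappa>1" "0 < \<kappa>2" "0 < \<kappa>3" "0 < \<Lambda>" "\<Lambda> \<le> 1"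
    and A1: "\<And>\<sigma> h. 0 < \<sigma> \<Longrightarrow> h \<in> Lp p \<inter> lp p \<sigma> (X \<sigma>) \<Longrightarrow>
               Lp_norm p (sampling_op (X \<sigma>) (\<psi> \<sigma>) h) \<le> ennreal \<kappa>1 * lp_norm p \<sigma> (X \<sigma>) h"
    and A2: "\<And>\<sigma> h. 0 < \<sigma> \<Longrightarrow> h \<in> Lp p \<inter> lp p \<sigma> (X \<sigma>) \<Longrightarrow>
               ennreal \<kappa>2 * lp_norm p \<sigma> (X \<sigma>) h \<le> Lp_norm p (sampling_op (X \<sigma>) (\<psi> \<sigma>) h)"
    and A3: "\<And>\<sigma> g. 0 < \<sigma> \<Longrightarrow> g \<in> band_limited p (\<Lambda> * \<sigma>) \<Longrightarrow>
               Lp_norm p (\<lambda>x. g x - sampling_op (X \<sigma>) (\<psi> \<sigma>) g x)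
                 \<le> ennreal (\<kappa>3 * (1 / \<sigma> ^ s)) * sobolev_seminorm p s g"
    and f: "f \<in> Lp p" "\<And>\<sigma>. 0 < \<sigma> \<Longrightarrow> f \<in> lp p \<sigma> (X \<sigma>)"
  shows "((\<lambda>\<sigma>. Lp_norm p (\<lambda>x. sampling_op (X \<sigma>) (\<psi> \<sigma>) f x - f x)) \<longlongrightarrow> 0) at_top \<longleftrightarrow>
         ((\<lambda>\<sigma>. lp_norm p \<sigma> (X \<sigma>) (\<lambda>\<xi>. averaged_op (\<gamma> / \<sigma>) r f \<xi> - f \<xi>)) \<longlongrightarrow> 0) at_top"
proof -
  have p0: "0 < p" "0 \<le> p" using p by auto
  define G where "G \<sigma> = sampling_op (X \<sigma>) (\<psi> \<sigma>)" for \<sigma>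
  define M :: "real \<Rightarrow> (real ^ 'n \<Rightarrow> real) \<Rightarrow> real ^ 'n \<Rightarrow> real"
    where "M \<sigma> = averaged_op (\<gamma> / \<sigma>) r" for \<sigma>
  define A where "A \<sigma> = Lp_modular p (\<lambda>x. G \<sigma> f x - f x)" for \<sigma>
  define D where "D \<sigma> = lp_modular p \<sigma> (X \<sigma>) (\<lambda>\<xi>. M \<sigma> f \<xi> - f \<xi>)" for \<sigma>
  have count: "countable (X \<sigma>)" if "0 < \<sigma>" for \<sigma>
    using separated_imp_countable[OF _ separated[OF that]] \<gamma>(1) that by simp
  obtain Ca where Ca: "Ca < top" "\<And>\<sigma> X (g :: real ^ 'n \<Rightarrow> real). 0 < \<sigma> \<Longrightarrow> g \<in> Lp p \<Longrightarrow>
    pairwise (\<lambda>\<xi> \<xi>'. dist \<xi> \<xi>' > 2 * \<gamma> / \<sigma>) X \<Longrightarrow>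
    lp_modular p \<sigma> X (averaged_op (\<gamma> / \<sigma>) r g) \<le> Ca * Lp_modular p g"
    using lp_modular_averaged_op_le[OF p \<gamma>(1)] by blast
  define q where "q = ennreal (2 powr p)"
  define k1 where "k1 = ennreal (\<kappa>1 powr p)"
  define k2 where "k2 = ennreal ((1 / \<kappa>2) powr p)"
  \<comment> \<open>The four constants mirror the bracketing of the decompositions below, with one
    \<open>q\<close> for each use of the quasi-triangle inequality. They are fixed before
    \<open>e\<close>; only the range of \<sigma> will depend on it.\<close>
  define K1 where "K1 = q * (1 + q * (Ca + 1))"
  define KA where "KA = q * (q * (k1 + 1) + 1)"
  define K2 where "K2 = k2 * (q * (1 + q * (1 + 1)))"
  define KD where "KD = q * (q * (Ca + 1) + 1)"
  have fin: "KA * (K1 + 1) < top" "KD * (K2 + 1) < top"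
    using Ca(1) by (simp_all add: KA_def K1_def KD_def K2_def q_def k1_def k2_def ennreal_mult_less_top)
  have main: "\<forall>\<^sub>F \<sigma> in at_top. A \<sigma> \<le> KA * (K1 + 1) * (D \<sigma> + ennreal e) \<and> D \<sigma> \<le> KD * (K2 + 1) * (A \<sigma> + ennreal e)"
    if e: "0 < e" for e
  proof -
    obtain h where h: "h \<in> exp_span" and fh: "Lp_modular p (\<lambda>x. f x - h x) \<le> ennreal e"
      using exp_span_dense[OF p f(1) e] by blast
    have hLp: "h \<in> Lp p" by (rule exp_span_Lp[OF h p])
    have fm: "f \<in> borel_measurable lebesgue" and hm: "h \<in> borel_measurable lebesgue"
      using f(1) hLp by (auto simp: Lp_iff_modular)
    have dLp: "(\<lambda>x. f x - h x) \<in> Lp p"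
      using fh fm hm by (auto simp: Lp_iff_modular intro: le_less_trans)
    obtain \<tau> where \<tau>: "\<And>\<sigma>. \<tau> \<le> \<sigma> \<Longrightarrow> h \<in> band_limited p \<sigma>" using exp_span_band_limited[OF h p] by blast
    obtain S where S: "0 \<le> S" "sobolev_seminorm p s h = ennreal S"
      using exp_span_sobolev_finite[OF h p, of s] by (cases "sobolev_seminorm p s h") auto
    \<comment> \<open>The right side of A3 for the fixed \<open>h\<close>; it tends to 0 since s
      \<ge> 1. The level \<open>e powr (1 / p)\<close> for the norm corresponds to \<open>e\<close>
      for its p-th power.\<close>
    have "((\<lambda>\<sigma>::real. \<kappa>3 * (1 / \<sigma> ^ s) * S) \<longlongrightarrow> 0) at_top" using rs(2) by real_asymp
    then have "\<forall>\<^sub>F \<sigma> in at_top. \<kappa>3 * (1 / \<sigma> ^ s) * S < e powr (1 / p)" using e by (intro order_tendstoD) auto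
    moreover have "\<forall>\<^sub>F \<sigma> in at_top. \<tau> \<le> \<Lambda> * \<sigma>" using constants(4) by real_asymp
    moreover have "\<forall>\<^sub>F \<sigma> in at_top. lp_modular p \<sigma> (X \<sigma>) (\<lambda>\<xi>. M \<sigma> h \<xi> - h \<xi>) \<le> ennreal e"
      using exp_span_averaged_op_tendsto[OF h p rs(1) \<gamma>(1) separated] e
      unfolding M_def tendsto_ennreal_zero_iff by blast
    ultimately show ?thesis
      using eventually_ge_at_top[of \<gamma>]
    proof eventually_elim
      case (elim \<sigma>)
      have \<sigma>: "0 < \<sigma>" using \<gamma>(1) elim(4) by simp
      note sep = separated[OF \<sigma>]
      have hlp: "h \<in> lp p \<sigma> (X \<sigma>)"
        unfolding lp_iff_modular by (rule exp_span_lp_modular_finite[OF h p \<gamma>(1) elim(4) sep])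
      have fI: "f \<in> Lp p \<inter> lp p \<sigma> (X \<sigma>)" and hI: "h \<in> Lp p \<inter> lp p \<sigma> (X \<sigma>)"
        using f \<sigma> hLp hlp by auto
      \<comment> \<open>A1 and A2 speak of L_p functions with finite discrete norm, so
        \<open>f - h\<close> has to be placed in both spaces.\<close>
      have "lp_modular p \<sigma> (X \<sigma>) (\<lambda>\<xi>. f \<xi> + (- 1) * h \<xi>) \<le> q * (lp_modular p \<sigma> (X \<sigma>) f + lp_modular p \<sigma> (X \<sigma>) (\<lambda>\<xi>. (- 1) * h \<xi>))"
        unfolding q_def by (rule lp_modular_add_le[OF p0(2)])
      also have "\<dots> < top"
        using fI hI unfolding lp_modular_scale by (simp add: lp_iff_modular q_def ennreal_mult_less_top)
      finally have dI: "(\<lambda>\<xi>. f \<xi> - h \<xi>) \<in> Lp p \<inter> lp p \<sigma> (X \<sigma>)"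
        using dLp by (simp add: lp_iff_modular)
      have Gm: "G \<sigma> g \<in> borel_measurable lebesgue" if "g \<in> Lp p \<inter> lp p \<sigma> (X \<sigma>)" for g
        unfolding G_def by (rule sampling_op_measurable[OF count[OF \<sigma>] G_defined[OF \<sigma>] that])
      define B where "B = lp_modular p \<sigma> (X \<sigma>) (\<lambda>\<xi>. f \<xi> - h \<xi>)"
      define Gd where "Gd = G \<sigma> (\<lambda>\<xi>. f \<xi> - h \<xi>)"
      have Gd: "AE x in lebesgue. Gd x = G \<sigma> f x - G \<sigma> h x"
        unfolding Gd_def G_def by (rule sampling_op_diff[OF G_defined[OF \<sigma>] fI hI])
      have Gdm: "Gd \<in> borel_measurable lebesgue" unfolding Gd_def by (rule Gm[OF dI])
      have a1: "Lp_modular p Gd \<le> k1 * B"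
        using A1[OF \<sigma> dI] dI constants(1) p0
        unfolding k1_def B_def Gd_def G_def Lp_norm_def lp_norm_def Lp_modular_def[symmetric] lp_modular_def[symmetric]
        by (intro ennreal_root_le_mult_root) (auto simp: lp_iff_modular)
      have a2: "B \<le> k2 * Lp_modular p Gd"
        using A2[OF \<sigma> dI] constants(2) p0
        unfolding k2_def B_def Gd_def G_def Lp_norm_def lp_norm_def Lp_modular_def[symmetric] lp_modular_def[symmetric]
        by (intro ennreal_mult_root_le_root) auto
      have a3: "Lp_modular p (\<lambda>x. h x - G \<sigma> h x) \<le> ennreal e"
      proof -
        have "Lp_norm p (\<lambda>x. h x - G \<sigma> h x) \<le> ennreal (\<kappa>3 * (1 / \<sigma> ^ s)) * ennreal S"
          using A3[OF \<sigma> \<tau>[OF elim(2)]] by (simp add: G_def S(2))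
        also have "\<dots> = ennreal (\<kappa>3 * (1 / \<sigma> ^ s) * S)"
          using S(1) constants(3) \<sigma> by (intro ennreal_mult[symmetric]) auto
        also have "\<dots> \<le> ennreal (e powr (1 / p))" using elim(1) by (intro ennreal_leI) simp
        finally have "Lp_modular p (\<lambda>x. h x - G \<sigma> h x) \<le> ennreal ((e powr (1 / p)) powr p)"
          unfolding Lp_norm_def Lp_modular_def[symmetric] by (subst (asm) ennreal_root_le_iff[OF p0(1)]) auto
        then show ?thesis using e p0 by (simp add: powr_powr)
      qed
      have Mb: "lp_modular p \<sigma> (X \<sigma>) (\<lambda>\<xi>. M \<sigma> f \<xi> - M \<sigma> h \<xi>) \<le> Ca * ennreal e"
      proof -
        have "(\<lambda>\<xi>. M \<sigma> f \<xi> - M \<sigma> h \<xi>) = M \<sigma> (\<lambda>x. f x - h x)"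
          unfolding M_def using averaged_op_diff[OF p f(1) hLp] by auto
        then have "lp_modular p \<sigma> (X \<sigma>) (\<lambda>\<xi>. M \<sigma> f \<xi> - M \<sigma> h \<xi>) \<le> Ca * Lp_modular p (\<lambda>x. f x - h x)"
          unfolding M_def using Ca(2)[OF \<sigma> dLp sep] by simp
        also have "\<dots> \<le> Ca * ennreal e" using fh by (rule mult_left_mono) simp
        finally show ?thesis .
      qed
      have Mc: "lp_modular p \<sigma> (X \<sigma>) (\<lambda>\<xi>. (M \<sigma> f \<xi> - M \<sigma> h \<xi>) + (M \<sigma> h \<xi> - h \<xi>)) \<le> q * (Ca + 1) * ennreal e"
        unfolding q_def by (rule lp_modular_add_le_mult[OF p0(2) Mb]) (use elim(3) in simp)
      have e_le: "c * ennreal e \<le> c * (T + ennreal e)" for c T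
        by (intro mult_left_mono) (simp_all add: add_increasing)
      \<comment> \<open>Of the three differences leading from \<open>f\<close> to \<open>h\<close>
        through both averages, only the first is not already of order \<open>e\<close>.\<close>
      have B1: "B \<le> K1 * (D \<sigma> + ennreal e)"
      proof -
        have "B = lp_modular p \<sigma> (X \<sigma>) (\<lambda>\<xi>. (f \<xi> - M \<sigma> f \<xi>) + ((M \<sigma> f \<xi> - M \<sigma> h \<xi>) + (M \<sigma> h \<xi> - h \<xi>)))"
          by (simp add: B_def)
        also have "\<dots> \<le> K1 * (D \<sigma> + ennreal e)"
          unfolding K1_def q_def
        proof (rule lp_modular_add_le_mult[OF p0(2)])
          have "lp_modular p \<sigma> (X \<sigma>) (\<lambda>\<xi>. f \<xi> - M \<sigma> f \<xi>) = D \<sigma>"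
            unfolding D_def by (rule lp_modular_cong) simp
          then show "lp_modular p \<sigma> (X \<sigma>) (\<lambda>\<xi>. f \<xi> - M \<sigma> f \<xi>) \<le> 1 * (D \<sigma> + ennreal e)"
            by (simp add: add_increasing2)
          show "lp_modular p \<sigma> (X \<sigma>) (\<lambda>\<xi>. (M \<sigma> f \<xi> - M \<sigma> h \<xi>) + (M \<sigma> h \<xi> - h \<xi>)) \<le> ennreal (2 powr p) * (Ca + 1) * (D \<sigma> + ennreal e)"
            using order_trans[OF Mc e_le] by (simp add: q_def)
        qed
        finally show ?thesis .
      qed
      \<comment> \<open>A1 enters through \<open>a1\<close>, A3 through the sampling error of
        \<open>h\<close>, density through \<open>h - f\<close>.\<close>
      have A: "A \<sigma> \<le> KA * (B + ennreal e)"
      proof -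
        have "A \<sigma> = Lp_modular p (\<lambda>x. (Gd x + (G \<sigma> h x - h x)) + (h x - f x))"
          unfolding A_def by (rule Lp_modular_cong_AE) (use Gd in eventually_elim, simp)
        also have "\<dots> \<le> KA * (B + ennreal e)"
          unfolding KA_def q_def
        proof (intro Lp_modular_add_le_mult[OF p0(2)])
          show "Lp_modular p Gd \<le> k1 * (B + ennreal e)"
            using a1 by (rule order_trans) (simp add: mult_left_mono add_increasing2)
          have "Lp_modular p (\<lambda>x. G \<sigma> h x - h x) \<le> ennreal e" using a3 by (subst Lp_modular_minus_commute)
          then show "Lp_modular p (\<lambda>x. G \<sigma> h x - h x) \<le> 1 * (B + ennreal e)" by (simp add: add_increasing)
          have "Lp_modular p (\<lambda>x. h x - f x) \<le> ennreal e" using fh by (subst Lp_modular_minus_commute)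
          then show "Lp_modular p (\<lambda>x. h x - f x) \<le> 1 * (B + ennreal e)" by (simp add: add_increasing)
        qed (use Gdm Gm[OF hI] hm fm in auto)
        finally show ?thesis .
      qed
      \<comment> \<open>The converse direction: A2 bounds \<open>B\<close> by \<open>Gd\<close>,
        which is recovered from the sampling error of \<open>f\<close> up to terms of order
        \<open>e\<close>.\<close>
      have B2: "B \<le> K2 * (A \<sigma> + ennreal e)"
      proof -
        have "Lp_modular p Gd = Lp_modular p (\<lambda>x. (G \<sigma> f x - f x) + ((f x - h x) + (h x - G \<sigma> h x)))"
          by (rule Lp_modular_cong_AE) (use Gd in eventually_elim, simp)
        also have "\<dots> \<le> q * (1 + q * (1 + 1)) * (A \<sigma> + ennreal e)"
          unfolding q_def
        proof (intro Lp_modular_add_le_mult[OF p0(2)])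
          show "Lp_modular p (\<lambda>x. G \<sigma> f x - f x) \<le> 1 * (A \<sigma> + ennreal e)"
            by (simp add: A_def add_increasing2)
          show "Lp_modular p (\<lambda>x. f x - h x) \<le> 1 * (A \<sigma> + ennreal e)" using fh by (simp add: add_increasing)
          show "Lp_modular p (\<lambda>x. h x - G \<sigma> h x) \<le> 1 * (A \<sigma> + ennreal e)" using a3 by (simp add: add_increasing)
        qed (use Gm[OF fI] Gm[OF hI] hm fm in auto)
        finally have "k2 * Lp_modular p Gd \<le> k2 * (q * (1 + q * (1 + 1)) * (A \<sigma> + ennreal e))"
          by (rule mult_left_mono) simp
        then show ?thesis using a2 by (simp add: K2_def mult.assoc)
      qed
      have D: "D \<sigma> \<le> KD * (B + ennreal e)"
      proof -
        have "D \<sigma> = lp_modular p \<sigma> (X \<sigma>) (\<lambda>\<xi>. ((M \<sigma> f \<xi> - M \<sigma> h \<xi>) + (M \<sigma> h \<xi> - h \<xi>)) + (h \<xi> - f \<xi>))"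
          by (simp add: D_def)
        also have "\<dots> \<le> KD * (B + ennreal e)"
          unfolding KD_def q_def
        proof (rule lp_modular_add_le_mult[OF p0(2)])
          show "lp_modular p \<sigma> (X \<sigma>) (\<lambda>\<xi>. (M \<sigma> f \<xi> - M \<sigma> h \<xi>) + (M \<sigma> h \<xi> - h \<xi>)) \<le> ennreal (2 powr p) * (Ca + 1) * (B + ennreal e)"
            using order_trans[OF Mc e_le] by (simp add: q_def)
          have "lp_modular p \<sigma> (X \<sigma>) (\<lambda>\<xi>. h \<xi> - f \<xi>) = B"
            unfolding B_def by (rule lp_modular_cong) simp
          then show "lp_modular p \<sigma> (X \<sigma>) (\<lambda>\<xi>. h \<xi> - f \<xi>) \<le> 1 * (B + ennreal e)"
            by (simp add: add_increasing2)
        qed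
        finally show ?thesis .
      qed
      \<comment> \<open>\<open>B\<close> is eliminated from each pair of estimates.\<close>
      show ?case
        using mult_add_le_trans_ennreal[OF A B1] mult_add_le_trans_ennreal[OF D B2] by blast
    qed
  qed
  have "(A \<longlongrightarrow> 0) at_top \<longleftrightarrow> (D \<longlongrightarrow> 0) at_top"
  proof
    assume "(A \<longlongrightarrow> 0) at_top"
    then show "(D \<longlongrightarrow> 0) at_top"
      by (rule tendsto_ennreal_zero_by_bound[OF fin(2), rotated])
        (use main in \<open>simp add: eventually_conj_iff\<close>)
  next
    assume "(D \<longlongrightarrow> 0) at_top"
    then show "(A \<longlongrightarrow> 0) at_top"
      by (rule tendsto_ennreal_zero_by_bound[OF fin(1), rotated])
        (use main in \<open>simp add: eventually_conj_iff\<close>)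
  qed
  then show ?thesis
    unfolding Lp_norm_def lp_norm_def Lp_modular_def[symmetric] lp_modular_def[symmetric]
      tendsto_ennreal_root_zero_iff[OF p0(1)] A_def[abs_def] D_def[abs_def] G_def M_def .
qed

end
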